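(* Let $\mathbf{P}=(P,\preceq_+,\preceq_-)$ be a compatible double poset. Then the map $(g,t)\mapsto(\Psi_{\mathbf{P}}(g),t)$ is a piecewise linear homeomorphism from $\mathbb{R}^P\times\mathbb{R}$ to itself that preserves the lattice $\mathbb{Z}^P\times\mathbb{Z}$. It maps $\overline{\mathcal{C}}(\mathbf{P})$ onto $\overline{\mathcal{O}}(\mathbf{P})$, and the simplices $\operatorname{conv}\big(\{(2\mathbf{1}_{\Phi_+},1):\Phi_+\in C_+\}\cup\{(-2\mathbf{1}_{\Phi_-},-1):\Phi_-\in C_-\}\big)$, for $C_+\uplus C_-$ ranging over non-interfering pairs of chains, form a regular, unimodular (with respect to $2\mathbb{Z}^P\times(2\mathbb{Z}+1)$), and flag triangulation of $\overline{\mathcal{O}}(\mathbf{P})$.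
   Context: A double poset is a finite set $P$ with partial orders $\preceq_+,\preceq_-$; $P_\sigma=(P,\preceq_\sigma)$; compatible means $P_+,P_-$ have a common linear extension. For a poset $Q$: $\mathcal{O}(Q)=\{f:0\le f(a)\le f(b)\le1\text{ for }a\preceq b\}$ and $\mathcal{C}(Q)=\{g\ge0:\sum_{a\in C}g(a)\le1\text{ for all chains }C\}$. $\overline{\mathcal{O}}(\mathbf{P})=\operatorname{conv}((2\mathcal{O}(P_+)\times\{1\})\cup(-2\mathcal{O}(P_-)\times\{-1\}))$ and $\overline{\mathcal{C}}(\mathbf{P})=\operatorname{conv}((2\mathcal{C}(P_+)\times\{1\})\cup(-2\mathcal{C}(P_-)\times\{-1\}))$. For a poset $Q$ and $g\in\mathbb{R}^Q$ define $\nabla_Q(g)(b)=\max\{g(a_0)+\dots+g(a_k): a_0\prec\dots\prec a_k\preceq b\}$, the maximum over all chains lying weakly below $b$ (not necessarily ending at $b$), where the empty chain contributes $0$. Set $\Psi_{\mathbf{P}}(g)=\nabla_{P_+}(g)-\nabla_{P_-}(-g)$. Filters are up-closed subsets; a chain of filters is a set of filters of $P_\sigma$ totally ordered by inclusion; a pair $C_+\uplus C_-$ of chains of filters of $P_+$, $P_-$ is non-interfering if $\min(\Phi_+)\cap\min(\Phi_-)=\emptyset$ for all $\Phi_\pm\in C_\pm$ (minima w.r.t. $\preceq_\pm$). Regular/unimodular/flag triangulations are as usual (height function; normalized volume $1$; minimal non-faces are edges). *)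

theory Defs
  imports "HOL-Analysis.Analysis"
begin

section \<open>Double posets\<close>

text \<open>
  The ground set \<open>P\<close> is the finite type \<open>'a\<close>, so that \<open>\<real>\<^sup>P\<close> is \<open>real ^ 'a\<close>;
  \<open>(a, b) \<in> r\<close> is read as \<open>a \<preceq> b\<close>.
\<close>

definition double_poset :: "'a rel \<Rightarrow> 'a rel \<Rightarrow> bool" where
  "double_poset rp rm \<longleftrightarrow> partial_order_on UNIV rp \<and> partial_order_on UNIV rm"

definition compatible :: "'a rel \<Rightarrow> 'a rel \<Rightarrow> bool" where
  "compatible rp rm \<longleftrightarrow> (\<exists>L. linear_order_on UNIV L \<and> rp \<subseteq> L \<and> rm \<subseteq> L)"

definition order_polytope :: "'a::finite rel \<Rightarrow> (real ^ 'a) set" where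
  "order_polytope r = {f. \<forall>a b. (a, b) \<in> r \<longrightarrow> 0 \<le> f $ a \<and> f $ a \<le> f $ b \<and> f $ b \<le> 1}"

definition chain_polytope :: "'a::finite rel \<Rightarrow> (real ^ 'a) set" where
  "chain_polytope r = {g. (\<forall>a. 0 \<le> g $ a) \<and> (\<forall>C\<in>Chains r. (\<Sum>a\<in>C. g $ a) \<le> 1)}"

definition double_order_polytope :: "'a::finite rel \<Rightarrow> 'a rel \<Rightarrow> ((real ^ 'a) \<times> real) set" where
  "double_order_polytope rp rm = convex hull
     (((\<lambda>f. 2 *\<^sub>R f) ` order_polytope rp) \<times> {1} \<union> ((\<lambda>f. (-2) *\<^sub>R f) ` order_polytope rm) \<times> {-1})"

definition double_chain_polytope :: "'a::finite rel \<Rightarrow> 'a rel \<Rightarrow> ((real ^ 'a) \<times> real) set" where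
  "double_chain_polytope rp rm = convex hull
     (((\<lambda>g. 2 *\<^sub>R g) ` chain_polytope rp) \<times> {1} \<union> ((\<lambda>g. (-2) *\<^sub>R g) ` chain_polytope rm) \<times> {-1})"

text \<open>\<open>Chains r\<close> contains the empty chain, so the maximum below is over a set containing \<open>0\<close>.\<close>

definition nabla :: "'a::finite rel \<Rightarrow> real ^ 'a \<Rightarrow> real ^ 'a" where
  "nabla r g = (\<chi> b. Max {\<Sum>a\<in>C. g $ a | C. C \<in> Chains r \<and> (\<forall>a\<in>C. (a, b) \<in> r)})"

definition Psi :: "'a::finite rel \<Rightarrow> 'a rel \<Rightarrow> real ^ 'a \<Rightarrow> real ^ 'a" where
  "Psi rp rm g = nabla rp g - nabla rm (- g)"

definition transfer_map :: "'a::finite rel \<Rightarrow> 'a rel \<Rightarrow> (real ^ 'a) \<times> real \<Rightarrow> (real ^ 'a) \<times> real" where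
  "transfer_map rp rm = (\<lambda>(g, t). (Psi rp rm g, t))"

definition integer_lattice :: "((real ^ 'a) \<times> real) set" where
  "integer_lattice = {g. \<forall>a. g $ a \<in> \<int>} \<times> \<int>"

section \<open>Non-interfering chains of filters\<close>

definition poset_filters :: "'a rel \<Rightarrow> 'a set set" where
  "poset_filters r = {\<Phi>. \<forall>a b. a \<in> \<Phi> \<and> (a, b) \<in> r \<longrightarrow> b \<in> \<Phi>}"

definition filter_chain :: "'a rel \<Rightarrow> 'a set set \<Rightarrow> bool" where
  "filter_chain r C \<longleftrightarrow> C \<subseteq> poset_filters r \<and> chain\<^sub>\<subseteq> C"

definition min_elements :: "'a rel \<Rightarrow> 'a set \<Rightarrow> 'a set" where
  "min_elements r \<Phi> = {a \<in> \<Phi>. \<forall>b\<in>\<Phi>. (b, a) \<in> r \<longrightarrow> b = a}"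

definition non_interfering :: "'a rel \<Rightarrow> 'a rel \<Rightarrow> 'a set set \<Rightarrow> 'a set set \<Rightarrow> bool" where
  "non_interfering rp rm Cp Cm \<longleftrightarrow>
     (\<forall>\<Phi>p\<in>Cp. \<forall>\<Phi>m\<in>Cm. min_elements rp \<Phi>p \<inter> min_elements rm \<Phi>m = {})"

definition indicator_vec :: "'a::finite set \<Rightarrow> real ^ 'a" where
  "indicator_vec \<Phi> = (\<chi> a. indicator \<Phi> a)"

definition pair_simplex :: "'a::finite set set \<Rightarrow> 'a set set \<Rightarrow> ((real ^ 'a) \<times> real) set" where
  "pair_simplex Cp Cm = convex hull
     ((\<lambda>\<Phi>. (2 *\<^sub>R indicator_vec \<Phi>, 1)) ` Cp \<union> (\<lambda>\<Phi>. ((-2) *\<^sub>R indicator_vec \<Phi>, -1)) ` Cm)"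

definition non_interfering_simplices :: "'a::finite rel \<Rightarrow> 'a rel \<Rightarrow> ((real ^ 'a) \<times> real) set set" where
  "non_interfering_simplices rp rm =
     {pair_simplex Cp Cm | Cp Cm. filter_chain rp Cp \<and> filter_chain rm Cm \<and> non_interfering rp rm Cp Cm}"

section \<open>Piecewise linear maps\<close>

definition piecewise_linear :: "('b::euclidean_space \<Rightarrow> 'c::euclidean_space) \<Rightarrow> bool" where
  "piecewise_linear f \<longleftrightarrow>
     (\<exists>\<K>. finite \<K> \<and> (\<forall>K\<in>\<K>. polyhedron K) \<and> \<Union>\<K> = UNIV \<and>
       (\<forall>K\<in>\<K>. \<exists>l. linear l \<and> (\<forall>x\<in>K. f x = l x)))"

definition piecewise_linear_homeomorphism :: "('b::euclidean_space \<Rightarrow> 'b) \<Rightarrow> bool" where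
  "piecewise_linear_homeomorphism f \<longleftrightarrow>
     (\<exists>f'. homeomorphism UNIV UNIV f f' \<and> piecewise_linear f \<and> piecewise_linear f')"

section \<open>Triangulations\<close>

text \<open>
  A triangulation is recorded as the set of all its simplices, including the empty one:
  the library's \<open>simplicial_complex\<close> is closed under faces, and \<open>{}\<close> is a face.
\<close>

definition triangulates :: "'b::euclidean_space set set \<Rightarrow> 'b set \<Rightarrow> bool" where
  "triangulates \<T> Q \<longleftrightarrow> simplicial_complex \<T> \<and> \<Union>\<T> = Q"

definition simplex_vertices :: "'b::euclidean_space set \<Rightarrow> 'b set" where
  "simplex_vertices S = {v. v extreme_point_of S}"

definition complex_vertices :: "'b::euclidean_space set set \<Rightarrow> 'b set" where
  "complex_vertices \<T> = {v. {v} \<in> \<T>}"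

text \<open>
  Lower faces of a set in \<open>'b \<times> real\<close> (last coordinate is the height): those minimizing a linear
  functional with positive coefficient, normalized to \<open>1\<close>, in the height direction.
\<close>

definition lower_faces :: "('b::euclidean_space \<times> real) set \<Rightarrow> ('b \<times> real) set set" where
  "lower_faces L = {{p \<in> L. \<forall>q\<in>L. c \<bullet> fst p + snd p \<le> c \<bullet> fst q + snd q} | c. True}"

definition regular_triangulation :: "'b::euclidean_space set set \<Rightarrow> bool" where
  "regular_triangulation \<T> \<longleftrightarrow>
     (\<exists>\<omega>. \<T> - {{}} =
        (\<lambda>F. fst ` F) ` lower_faces (convex hull ((\<lambda>v. (v, \<omega> v)) ` complex_vertices \<T>)))"

text \<open>
  Volume with respect to a full-rank affine lattice, scaled so that a smallest lattice simplex has
  volume \<open>1\<close>; \<open>D\<close> is a fundamental parallelepiped of the lattice of translations.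
\<close>

definition normalized_volume :: "'b::euclidean_space set \<Rightarrow> 'b set \<Rightarrow> real" where
  "normalized_volume D S = fact DIM('b) * measure lborel S / measure lborel D"

definition unimodular_triangulation ::
    "'b::euclidean_space set \<Rightarrow> 'b set \<Rightarrow> 'b set set \<Rightarrow> bool" where
  "unimodular_triangulation \<Lambda> D \<T> \<longleftrightarrow>
     (\<forall>S\<in>\<T>. simplex_vertices S \<subseteq> \<Lambda>) \<and>
     (\<forall>S\<in>\<T>. aff_dim S = int DIM('b) \<longrightarrow> normalized_volume D S = 1)"

definition flag_triangulation :: "'b::euclidean_space set set \<Rightarrow> bool" where
  "flag_triangulation \<T> \<longleftrightarrow>
     (\<forall>N. N \<subseteq> complex_vertices \<T> \<and> N \<notin> simplex_vertices ` \<T> \<and>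
          (\<forall>M. M \<subset> N \<longrightarrow> M \<in> simplex_vertices ` \<T>) \<longrightarrow> card N = 2)"

text \<open>
  The affine lattice \<open>2\<int>\<^sup>P \<times> (2\<int> + 1)\<close>; its lattice of translations is \<open>2\<int>\<^sup>P \<times> 2\<int>\<close>,
  with fundamental parallelepiped the cube of side \<open>2\<close>.
\<close>

definition even_odd_lattice :: "((real ^ 'a) \<times> real) set" where
  "even_odd_lattice = {g. \<forall>a. \<exists>k::int. g $ a = 2 * of_int k} \<times> {t. \<exists>k::int. t = 2 * of_int k + 1}"

definition even_odd_cell :: "((real ^ 'a::finite) \<times> real) set" where
  "even_odd_cell = cbox 0 (2 *\<^sub>R One)"

end

theory Submission
  imports Defs
begin

text \<open>
  Along a common linear extension, \<open>\<Psi>(g)(b)\<close> is \<open>g(b)\<close> plus a piecewise linear function of the earlier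
  coordinates, so \<open>\<Psi>\<close> is inverted recursively. The pair \<open>\<nabla>\<^sub>+(g), \<nabla>\<^sub>-(-g)\<close> is the least
  decomposition of \<open>\<Psi>(g)\<close> as a difference of nonnegative monotone functions on \<open>P\<^sub>+\<close> and \<open>P\<^sub>-\<close>;
  this gives the correspondence of the polytopes, and, with the decomposition of a monotone function into
  its level sets, the uniqueness of representations over non-interfering pairs of chains.

  Two vertices that do not span an edge can be replaced by two vertices with the same sum, namely
  \<open>\<Phi> \<inter> \<Phi>'\<close> and \<open>\<Phi> \<union> \<Phi>'\<close> for incomparable filters on the same side, and the filters without a common
  minimal element for an interfering pair. Both replacements decrease the height \<open>- |P - \<Phi>|\<^sup>2\<close>.
  Hence height-minimal representations are supported on simplices, which yields covering and regularity.

  A full-dimensional simplex is the image of a standard simplex under a diagonal map with entries \<open>2\<close> and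
  \<open>-2\<close> followed by two unitriangular maps, which preserve volume by Fubini's theorem.
\<close>

section \<open>Flag complexes from height-decreasing rewriting\<close>

text \<open>Both exchanges must lower one and the same height. Squared cardinality strictly favours
  intersection and union over an incomparable pair, for filters and for their complements alike.
  Removing a common minimal element shrinks both filters and enlarges both complements, and this
  dictates the complement: with \<open>- |\<Phi>|^2\<close> the second exchange would raise the
  height.

  An exchange keeps the sum of two vertices, so no linear functional plus height can be minimal at
  both vertices of a bad pair; this is one half of regularity. The other half, that each nonempty
  clique is the whole vertex set of a lower face, comes from the uniqueness of clique-supported
  weights, which also makes simplices meet in faces. Exchanges are never iterated: compactness
  provides a minimum.

  The polytope correspondence and the uniqueness share one principle: at every element, one of two
  functions is only as large as 0 and its values at strict predecessors force it to be.
  Compatibility enters here, since one induction has to serve both orders. The triangulation is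
  built directly on the order side and is not transported along \<Psi>.\<close>

locale flag_rewriting =
  fixes V :: "'b::euclidean_space set" and R :: "'b \<Rightarrow> 'b \<Rightarrow> bool" and \<omega> :: "'b \<Rightarrow> real"
  assumes finite_V: "finite V" and V_nonempty: "V \<noteq> {}"
    and R_refl: "R v v"
    and rewrite: "\<lbrakk>v \<in> V; w \<in> V; \<not> R v w\<rbrakk> \<Longrightarrow>
      \<exists>v'\<in>V. \<exists>w'\<in>V. v' + w' = v + w \<and> \<omega> v' + \<omega> w' < \<omega> v + \<omega> w"
    and unique_weights: "\<lbrakk>\<And>v. v \<in> V \<Longrightarrow> 0 \<le> u v; \<And>v. v \<in> V \<Longrightarrow> 0 \<le> u' v; sum u V = 1; sum u' V = 1;
      (\<Sum>v\<in>V. u v *\<^sub>R v) = (\<Sum>v\<in>V. u' v *\<^sub>R v);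
      \<And>v w. \<lbrakk>v \<in> V; w \<in> V; u v > 0; u w > 0\<rbrakk> \<Longrightarrow> R v w;
      \<And>v w. \<lbrakk>v \<in> V; w \<in> V; u' v > 0; u' w > 0\<rbrakk> \<Longrightarrow> R v w; z \<in> V\<rbrakk> \<Longrightarrow> u z = u' z"
begin

definition cliques :: "'b set set" where
  "cliques = {S. S \<subseteq> V \<and> (\<forall>v\<in>S. \<forall>w\<in>S. R v w)}"

definition weights :: "('b \<Rightarrow> real) \<Rightarrow> bool" where
  "weights u \<longleftrightarrow> (\<forall>v\<in>V. 0 \<le> u v) \<and> sum u V = 1"

definition point :: "('b \<Rightarrow> real) \<Rightarrow> 'b" where
  "point u = (\<Sum>v\<in>V. u v *\<^sub>R v)"

definition height :: "('b \<Rightarrow> real) \<Rightarrow> real" where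
  "height u = (\<Sum>v\<in>V. u v * \<omega> v)"

definition support :: "('b \<Rightarrow> real) \<Rightarrow> 'b set" where
  "support u = {v \<in> V. u v > 0}"

definition lifted :: "('b \<times> real) set" where
  "lifted = convex hull ((\<lambda>v. (v, \<omega> v)) ` V)"

lemma cliques_subset: "S \<in> cliques \<Longrightarrow> S' \<subseteq> S \<Longrightarrow> S' \<in> cliques"
  by (auto simp: cliques_def)

lemma clique_in_V: "S \<in> cliques \<Longrightarrow> S \<subseteq> V"
  by (auto simp: cliques_def)

lemma finite_clique: "S \<in> cliques \<Longrightarrow> finite S"
  using finite_subset[OF clique_in_V finite_V] .

lemma point_in_hull:
  assumes "weights u" "support u \<subseteq> S" "S \<subseteq> V"
  shows "point u \<in> convex hull S"
proof -
  have fin: "finite S" using assms(3) finite_V finite_subset by blast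
  have z: "u v = 0" if "v \<in> V - S" for v
    using that assms by (force simp: weights_def support_def)
  have "sum u S = 1"
    using assms z sum.mono_neutral_right[OF finite_V assms(3), of u] by (auto simp: weights_def)
  moreover have "point u = (\<Sum>v\<in>S. u v *\<^sub>R v)"
    unfolding point_def by (rule sum.mono_neutral_right[OF finite_V assms(3)]) (simp add: z)
  ultimately show ?thesis
    using assms unfolding convex_hull_finite[OF fin] by (auto simp: weights_def subset_eq)
qed

lemma hull_weights:
  assumes "x \<in> convex hull S" "S \<subseteq> V"
  obtains u where "weights u" "support u \<subseteq> S" "point u = x" "\<And>v. v \<notin> S \<Longrightarrow> u v = 0"
proof -
  have fin: "finite S" using assms(2) finite_V finite_subset by blast
  obtain w where w: "\<forall>v\<in>S. 0 \<le> w v" "sum w S = 1" "(\<Sum>v\<in>S. w v *\<^sub>R v) = x"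
    using assms unfolding convex_hull_finite[OF fin] by auto
  define u where "u = (\<lambda>v. if v \<in> S then w v else 0)"
  have "sum u V = 1"
    using w sum.mono_neutral_left[OF finite_V assms(2), of u] by (auto simp: u_def)
  moreover have "point u = (\<Sum>v\<in>S. u v *\<^sub>R v)"
    unfolding point_def by (rule sum.mono_neutral_right[OF finite_V assms(2)]) (simp add: u_def)
  moreover have "\<dots> = x" using w(3) by (simp add: u_def)
  moreover have "support u \<subseteq> S" "\<And>v. v \<in> V \<Longrightarrow> 0 \<le> u v" "\<And>v. v \<notin> S \<Longrightarrow> u v = 0"
    using w(1) by (auto simp: support_def u_def split: if_splits)
  ultimately show ?thesis
    using that[of u] by (simp add: weights_def)
qed

text \<open>Translates between weights and points of a polytope, so that minimizing the height over
  all weights with a given point becomes minimizing the last coordinate over a compact set.\<close>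

lemma lifted_iff: "p \<in> lifted \<longleftrightarrow> (\<exists>u. weights u \<and> p = (point u, height u))"
proof -
  have inj: "inj_on (\<lambda>v. (v, \<omega> v)) V" by (auto simp: inj_on_def)
  have pt: "(\<Sum>v\<in>V. f v *\<^sub>R (v, \<omega> v)) = (point f, height f)" for f
    by (simp add: point_def height_def prod_eq_iff fst_sum snd_sum)
  show ?thesis
  proof
    assume "p \<in> lifted"
    then obtain w where w: "\<forall>y\<in>(\<lambda>v. (v, \<omega> v)) ` V. 0 \<le> w y" "sum w ((\<lambda>v. (v, \<omega> v)) ` V) = 1"
      "(\<Sum>y\<in>(\<lambda>v. (v, \<omega> v)) ` V. w y *\<^sub>R y) = p"
      unfolding lifted_def convex_hull_finite[OF finite_imageI[OF finite_V]] by blast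
    define u where "u = (\<lambda>v. w (v, \<omega> v))"
    have "weights u" using w by (auto simp: weights_def u_def sum.reindex[OF inj] o_def)
    moreover have "p = (point u, height u)"
      using w(3) unfolding sum.reindex[OF inj] pt[symmetric] by (simp add: u_def o_def)
    ultimately show "\<exists>u. weights u \<and> p = (point u, height u)" by blast
  next
    assume "\<exists>u. weights u \<and> p = (point u, height u)"
    then obtain u where u: "weights u" "p = (point u, height u)" by blast
    have "(\<Sum>v\<in>V. u v *\<^sub>R (v, \<omega> v)) \<in> lifted"
      unfolding lifted_def
      by (rule convex_sum[OF finite_V convex_convex_hull])
        (use u in \<open>auto simp: weights_def intro: hull_inc\<close>)
    then show "p \<in> lifted" unfolding pt u(2) .
  qed
qed

lemma unique_representation:
  assumes "weights u" "weights u'" "point u = point u'" "support u \<in> cliques" "support u' \<in> cliques"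
  shows "v \<in> V \<Longrightarrow> u v = u' v"
  by (rule unique_weights[of u u'])
    (use assms in \<open>auto simp: weights_def point_def support_def cliques_def\<close>)

text \<open>A common point has one representation supported in each clique. By uniqueness the two
  agree, so their support lies in both cliques.\<close>

lemma inter_hulls:
  assumes "S \<in> cliques" "S' \<in> cliques"
  shows "convex hull S \<inter> convex hull S' = convex hull (S \<inter> S')"
proof
  show "convex hull (S \<inter> S') \<subseteq> convex hull S \<inter> convex hull S'"
    by (simp add: hull_mono)
  show "convex hull S \<inter> convex hull S' \<subseteq> convex hull (S \<inter> S')"
  proof
    fix x assume "x \<in> convex hull S \<inter> convex hull S'"
    then obtain u u' where u: "weights u" "support u \<subseteq> S" "point u = x"
      and u': "weights u'" "support u' \<subseteq> S'" "point u' = x"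
      using assms by (metis IntE clique_in_V hull_weights)
    have "u v = u' v" if "v \<in> V" for v
      using unique_representation[OF u(1) u'(1)] u u' assms that cliques_subset by auto
    then have "support u = support u'" by (auto simp: support_def)
    with u u' have "support u \<subseteq> S \<inter> S'" by auto
    then show "x \<in> convex hull (S \<inter> S')"
      using point_in_hull[OF u(1)] u(3) clique_in_V[OF assms(1)] by blast
  qed
qed

text \<open>An affine dependence could be added with a small factor to the uniform weights on
  \<open>S\<close>, which would give the barycentre a second representation supported in the same
  clique.\<close>

lemma clique_affine_independent:
  assumes "S \<in> cliques"
  shows "\<not> affine_dependent S"
proof
  assume "affine_dependent S"
  then obtain U z where U: "sum U S = 0" "z \<in> S" "U z \<noteq> 0" "(\<Sum>v\<in>S. U v *\<^sub>R v) = 0"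
    using affine_dependent_explicit_finite[OF finite_clique[OF assms]] by auto
  define N where "N = real (card S)"
  have fin: "finite S" by (rule finite_clique[OF assms])
  have N: "N > 0" using U(2) fin by (auto simp: N_def card_gt_0_iff)
  define M where "M = Max ((\<lambda>v. \<bar>U v\<bar>) ` S)"
  have M: "\<bar>U v\<bar> \<le> M" if "v \<in> S" for v
    using that fin by (auto simp: M_def)
  have Mpos: "M > 0" using M[OF U(2)] U(3) by auto
  define u where "u = (\<lambda>v. if v \<in> S then 1 / N else 0)"
  \<comment> \<open>The factor \<open>1 / (M * N)\<close> bounds the perturbation by
    \<open>1 / N\<close> in absolute value, so the weights stay nonnegative.\<close>
  define u' where "u' = (\<lambda>v. if v \<in> S then 1 / N + U v / (M * N) else 0)"
  have sub: "S \<subseteq> V" by (rule clique_in_V[OF assms])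
  have restrict: "(\<Sum>v\<in>V. if v \<in> S then f v else 0) = sum f S" for f :: "'b \<Rightarrow> 'c::comm_monoid_add"
    using sum.mono_neutral_right[OF finite_V sub, of "\<lambda>v. if v \<in> S then f v else 0"] by simp
  have scal: "(if b then c else 0) *\<^sub>R (v::'b) = (if b then c *\<^sub>R v else 0)" for b c v by simp
  have nonneg: "0 \<le> 1 / N + U v / (M * N)" if "v \<in> S" for v
  proof -
    have "- M \<le> U v" using M[OF that] by auto
    then have "0 \<le> (M + U v) / (M * N)" using Mpos N by simp
    then show ?thesis using Mpos N by (simp add: field_simps)
  qed
  have "sum u V = 1" unfolding u_def restrict using N by (simp add: N_def)
  moreover have "sum u' V = 1"
    unfolding u'_def restrict sum.distrib sum_divide_distrib[symmetric] U(1) using N by (simp add: N_def)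
  ultimately have w: "weights u" "weights u'"
    using nonneg N by (auto simp: weights_def u_def u'_def)
  have "(\<Sum>v\<in>S. (U v / (M * N)) *\<^sub>R v) = (1 / (M * N)) *\<^sub>R (\<Sum>v\<in>S. U v *\<^sub>R v)"
    unfolding scaleR_sum_right by (simp add: divide_inverse mult.commute)
  then have "point u = point u'"
    unfolding point_def u_def u'_def scal restrict scaleR_add_left sum.distrib U(4) by simp
  moreover have "support u \<subseteq> S" "support u' \<subseteq> S" by (auto simp: support_def u_def u'_def split: if_splits)
  ultimately have "u z = u' z"
    using unique_representation[OF w] assms cliques_subset U(2) sub by blast
  then show False using U(2,3) Mpos N by (simp add: u_def u'_def)
qed

lemma compact_lifted: "compact lifted"
  unfolding lifted_def by (simp add: finite_V finite_imp_compact_convex_hull)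

text \<open>Mass is moved from a bad pair in the support to the pair with the same sum: total mass
  and point are kept, and the height drops in proportion to the mass moved.\<close>

lemma rewrite_lowers:
  assumes "weights u" "support u \<notin> cliques"
  shows "\<exists>u'. weights u' \<and> point u' = point u \<and> height u' < height u"
proof -
  obtain v w where vw: "v \<in> V" "w \<in> V" "u v > 0" "u w > 0" "\<not> R v w"
    using assms(2) by (auto simp: cliques_def support_def)
  \<comment> \<open>If the two vertices coincided, twice the mass \<open>e\<close> would be taken
    from a single weight.\<close>
  then have ne: "v \<noteq> w" using R_refl by auto
  obtain v' w' where vw': "v' \<in> V" "w' \<in> V" "v' + w' = v + w" "\<omega> v' + \<omega> w' < \<omega> v + \<omega> w"
    using rewrite[OF vw(1,2,5)] by auto
  define e where "e = min (u v) (u w)"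
  \<comment> \<open>Point masses instead of function updates: \<open>v'\<close> and
    \<open>w'\<close> may coincide with each other or with \<open>v\<close> or \<open>w\<close>, and
    linearity absorbs these cases.\<close>
  define d :: "'b \<Rightarrow> 'b \<Rightarrow> real" where "d = (\<lambda>a y. if y = a then 1 else 0)"
  define u' where "u' = (\<lambda>y. u y + e * (d v' y + d w' y - d v y - d w y))"
  have e: "e > 0" "e \<le> u v" "e \<le> u w" using vw by (auto simp: e_def)
  have d: "sum (d a) V = 1" "(\<Sum>y\<in>V. d a y *\<^sub>R y) = a" "(\<Sum>y\<in>V. d a y * \<omega> y) = \<omega> a" if "a \<in> V" for a
  proof -
    have "d a y *\<^sub>R y = (if y = a then y else 0)" "d a y * \<omega> y = (if y = a then \<omega> y else 0)" for y
      by (auto simp: d_def)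
    then show "sum (d a) V = 1" "(\<Sum>y\<in>V. d a y *\<^sub>R y) = a" "(\<Sum>y\<in>V. d a y * \<omega> y) = \<omega> a"
      using that finite_V by (auto simp: d_def)
  qed
  have "0 \<le> u' y" if "y \<in> V" for y
  proof -
    have "0 \<le> u y - e * (d v y + d w y)"
      using that assms(1) e ne by (auto simp: d_def weights_def)
    moreover have "0 \<le> e * (d v' y + d w' y)" using e by (auto simp: d_def)
    ultimately show ?thesis by (simp add: u'_def algebra_simps)
  qed
  moreover have "sum u' V = sum u V"
    using vw vw' by (simp add: u'_def sum.distrib sum_subtractf sum_distrib_left[symmetric] d)
  ultimately have "weights u'" using assms(1) by (simp add: weights_def)
  moreover have "point u' = point u + e *\<^sub>R (v' + w' - v - w)"
  proof -
    have "u' y *\<^sub>R y = u y *\<^sub>R y + e *\<^sub>R (d v' y *\<^sub>R y + d w' y *\<^sub>R y - d v y *\<^sub>R y - d w y *\<^sub>R y)" for y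
      by (simp add: u'_def algebra_simps)
    then show ?thesis
      using vw vw' by (simp only: point_def sum.distrib sum_subtractf scaleR_sum_right[symmetric] d)
  qed
  moreover have "height u' = height u + e * (\<omega> v' + \<omega> w' - \<omega> v - \<omega> w)"
  proof -
    have "u' y * \<omega> y = u y * \<omega> y + e * (d v' y * \<omega> y + d w' y * \<omega> y - d v y * \<omega> y - d w y * \<omega> y)" for y
      by (simp add: u'_def algebra_simps)
    then show ?thesis
      using vw vw' by (simp only: height_def sum.distrib sum_subtractf sum_distrib_left[symmetric] d)
  qed
  moreover have "v' + w' - v - w = 0" using vw'(3) by (simp add: algebra_simps)
  moreover have "e * (\<omega> v' + \<omega> w' - \<omega> v - \<omega> w) < 0"
    using e vw'(4) by (simp add: mult_less_0_iff)
  ultimately show ?thesis by auto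
qed

text \<open>The fibre of \<open>lifted\<close> over \<open>x\<close> is compact and nonempty, so a
  lowest point exists; \<open>rewrite_lowers\<close> would go below it if its support were not a
  clique.\<close>

lemma minimal_representation:
  assumes "x \<in> convex hull V"
  obtains u where "weights u" "point u = x" "support u \<in> cliques"
    "\<And>u'. weights u' \<Longrightarrow> point u' = x \<Longrightarrow> height u \<le> height u'"
proof -
  let ?A = "lifted \<inter> {p. fst p = x}"
  have "closed {p::'b \<times> real. fst p = x}"
    by (intro closed_Collect_eq continuous_intros)
  then have "compact ?A" using compact_lifted by blast
  moreover obtain u0 where "weights u0" "point u0 = x" using assms by (rule hull_weights) auto
  then have "?A \<noteq> {}" using lifted_iff by force
  moreover have "continuous_on ?A snd" by (intro continuous_intros)
  ultimately obtain p where p: "p \<in> ?A" "\<And>q. q \<in> ?A \<Longrightarrow> snd p \<le> snd q"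
    by (metis continuous_attains_inf)
  then obtain u where u: "weights u" "p = (point u, height u)" using lifted_iff by blast
  have min: "height u \<le> height u'" if "weights u'" "point u' = x" for u'
    using p(2)[of "(point u', height u')"] that u lifted_iff by auto
  moreover have "point u = x" using p u by auto
  moreover have "support u \<in> cliques"
    using rewrite_lowers[OF u(1)] min \<open>point u = x\<close> by fastforce
  ultimately show ?thesis using that[of u] u by blast
qed

section \<open>The simplicial complex spanned by the cliques\<close>

definition clique_complex :: "'b set set" where
  "clique_complex = (\<lambda>S. convex hull S) ` cliques"

lemma vertices_clique: "S \<in> cliques \<Longrightarrow> simplex_vertices (convex hull S) = S"
  by (auto simp: simplex_vertices_def extreme_point_of_convex_hull_affine_independent clique_affine_independent)

lemma Union_clique_complex: "\<Union>clique_complex = convex hull V"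
proof
  show "\<Union>clique_complex \<subseteq> convex hull V"
    by (auto simp: clique_complex_def dest: clique_in_V hull_mono)
  show "convex hull V \<subseteq> \<Union>clique_complex"
  proof
    fix x assume "x \<in> convex hull V"
    then obtain u where "weights u" "point u = x" "support u \<in> cliques" by (rule minimal_representation)
    then show "x \<in> \<Union>clique_complex"
      using point_in_hull[of u "support u"] clique_in_V by (auto simp: clique_complex_def)
  qed
qed

lemma simplicial_clique_complex: "simplicial_complex clique_complex"
proof -
  have "finite cliques" by (rule finite_subset[of _ "Pow V"]) (auto simp: cliques_def finite_V)
  \<comment> \<open>The empty clique is included: its hull is the simplex of dimension -1.\<close>
  moreover have "\<exists>n. n simplex (convex hull S)" if "S \<in> cliques" for S
    using simplex_convex_hull[of S "int (card S) - 1"] clique_affine_independent[OF that] by auto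
  moreover have "F \<in> clique_complex" if "S \<in> cliques" "F face_of (convex hull S)" for S F
    using that face_of_convex_hull_affine_independent[OF clique_affine_independent[OF that(1)]] cliques_subset
    by (auto simp: clique_complex_def)
  moreover have "(convex hull S \<inter> convex hull S') face_of (convex hull S)"
    if "S \<in> cliques" "S' \<in> cliques" for S S'
    unfolding inter_hulls[OF that]
    using face_of_convex_hull_affine_independent[OF clique_affine_independent[OF that(1)]] by blast
  ultimately show ?thesis
    unfolding simplicial_complex_def
    by (auto simp: clique_complex_def)
qed

lemma vertices_clique_complex: "complex_vertices clique_complex = V"
proof
  show "complex_vertices clique_complex \<subseteq> V"
  proof
    fix v assume "v \<in> complex_vertices clique_complex"
    then obtain S where S: "{v} = convex hull S" "S \<in> cliques"
      by (auto simp: complex_vertices_def clique_complex_def)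
    then have "S \<noteq> {}" by auto
    moreover have "S \<subseteq> {v}" unfolding S(1) by (rule hull_subset)
    ultimately show "v \<in> V" using clique_in_V[OF S(2)] by auto
  qed
  show "V \<subseteq> complex_vertices clique_complex"
  proof
    fix v assume "v \<in> V"
    then have "{v} \<in> cliques" by (simp add: cliques_def R_refl)
    moreover have "convex hull {v} = {v}" by simp
    ultimately show "v \<in> complex_vertices clique_complex"
      unfolding complex_vertices_def clique_complex_def by (metis (mono_tags) image_eqI mem_Collect_eq)
  qed
qed

text \<open>Being a clique is a condition on pairs. A minimal non-clique contains a bad pair, which
  is itself a non-clique and hence everything; reflexivity of \<open>R\<close> makes its two members
  distinct.\<close>

lemma flag_clique_complex: "flag_triangulation clique_complex"
proof -
  have im: "simplex_vertices ` clique_complex = cliques"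
    unfolding clique_complex_def image_image using vertices_clique by (simp cong: image_cong)
  have "card N = 2" if N: "N \<subseteq> V" "N \<notin> cliques" "\<forall>M. M \<subset> N \<longrightarrow> M \<in> cliques" for N
  proof -
    obtain v w where vw: "v \<in> N" "w \<in> N" "\<not> R v w" using N by (auto simp: cliques_def)
    then have "{v, w} \<notin> cliques" by (auto simp: cliques_def)
    then have "\<not> {v, w} \<subset> N" using N(3) by blast
    then have "N = {v, w}" using vw(1,2) by auto
    moreover have "v \<noteq> w" using vw(3) R_refl by auto
    ultimately show ?thesis by simp
  qed
  then show ?thesis unfolding flag_triangulation_def im vertices_clique_complex by blast
qed

text \<open>A functional \<open>c\<close> selects the set \<open>W c\<close> of vertices minimizing
  \<open>\<phi> c\<close>, and the corresponding lower face projects onto the hull of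
  \<open>W c\<close>. It remains to see that the sets \<open>W c\<close> are exactly the nonempty
  cliques.\<close>

lemma regular_clique_complex: "regular_triangulation clique_complex"
proof -
  define \<phi> :: "'b \<Rightarrow> 'b \<Rightarrow> real" where "\<phi> c v = c \<bullet> v + \<omega> v" for c v
  define m where "m c = Min (\<phi> c ` V)" for c
  define W where "W c = {v \<in> V. \<phi> c v = m c}" for c
  have m_le: "m c \<le> \<phi> c v" if "v \<in> V" for c v
    using that finite_V by (simp add: m_def)
  have W_ne: "W c \<noteq> {}" for c
  proof -
    have "m c \<in> \<phi> c ` V" unfolding m_def using finite_V V_nonempty by (intro Min_in) auto
    then show ?thesis by (auto simp: W_def)
  qed
  have functional: "c \<bullet> point u + height u = (\<Sum>v\<in>V. u v * \<phi> c v)" for c u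
    by (simp add: point_def height_def inner_sum_right \<phi>_def sum.distrib algebra_simps)
  have value_eq: "c \<bullet> point u + height u - m c = (\<Sum>v\<in>V. u v * (\<phi> c v - m c))" if "weights u" for c u
    using that by (simp add: functional weights_def right_diff_distrib sum_subtractf sum_distrib_right[symmetric])
  have terms: "0 \<le> u v * (\<phi> c v - m c)" if "weights u" "v \<in> V" for c u v
    using that m_le by (auto simp: weights_def)
  have value_ge: "m c \<le> c \<bullet> point u + height u" if "weights u" for c u
    using value_eq[OF that, of c] sum_nonneg[of V "\<lambda>v. u v * (\<phi> c v - m c)"] terms[OF that, of _ c] by auto
  have value_min: "c \<bullet> point u + height u = m c \<longleftrightarrow> support u \<subseteq> W c" if "weights u" for c u
  proof -
    have "c \<bullet> point u + height u = m c \<longleftrightarrow> (\<Sum>v\<in>V. u v * (\<phi> c v - m c)) = 0"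
      using value_eq[OF that, of c] by auto
    also have "\<dots> \<longleftrightarrow> (\<forall>v\<in>V. u v * (\<phi> c v - m c) = 0)"
      by (rule sum_nonneg_eq_0_iff[OF finite_V]) (use terms that in auto)
    also have "\<dots> \<longleftrightarrow> support u \<subseteq> W c"
      using that by (force simp: support_def W_def weights_def)
    finally show ?thesis .
  qed
  define F where "F c = {p \<in> lifted. \<forall>q\<in>lifted. c \<bullet> fst p + snd p \<le> c \<bullet> fst q + snd q}" for c
  have F_eq: "F c = {p \<in> lifted. c \<bullet> fst p + snd p = m c}" for c
  proof -
    obtain v where v: "v \<in> W c" using W_ne by blast
    obtain u where u: "weights u" "support u \<subseteq> {v}"
      by (rule hull_weights[of v "{v}"]) (use v in \<open>auto simp: W_def\<close>)
    then have "c \<bullet> point u + height u = m c" using v value_min by auto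
    then obtain q0 where q0: "q0 \<in> lifted" "c \<bullet> fst q0 + snd q0 = m c" using u lifted_iff by (metis fst_conv snd_conv)
    have le: "m c \<le> c \<bullet> fst q + snd q" if "q \<in> lifted" for q
      using that value_ge by (auto simp: lifted_iff)
    show ?thesis
    proof (rule set_eqI, rule iffI)
      fix p assume "p \<in> F c"
      then have "p \<in> lifted" "c \<bullet> fst p + snd p \<le> m c" using q0 unfolding F_def by auto
      then show "p \<in> {p \<in> lifted. c \<bullet> fst p + snd p = m c}" using le[of p] by simp
    next
      fix p assume "p \<in> {p \<in> lifted. c \<bullet> fst p + snd p = m c}"
      then show "p \<in> F c" using le unfolding F_def by simp
    qed
  qed
  have fst_F: "fst ` F c = convex hull (W c)" for c
  proof
    show "fst ` F c \<subseteq> convex hull (W c)"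
    proof
      fix x assume "x \<in> fst ` F c"
      then obtain u where u: "weights u" "x = point u" "c \<bullet> point u + height u = m c"
        unfolding F_eq by (auto simp: lifted_iff)
      then have "support u \<subseteq> W c" using value_min by blast
      then show "x \<in> convex hull (W c)" using point_in_hull[OF u(1), of "W c"] u(2) by (auto simp: W_def)
    qed
    show "convex hull (W c) \<subseteq> fst ` F c"
    proof
      fix x assume "x \<in> convex hull (W c)"
      then obtain u where u: "weights u" "support u \<subseteq> W c" "point u = x"
        by (rule hull_weights) (auto simp: W_def)
      then have "(x, height u) \<in> F c" unfolding F_eq using value_min[OF u(1), of c] lifted_iff by auto
      then show "x \<in> fst ` F c" by force
    qed
  qed
  \<comment> \<open>Exchanging a bad pair in \<open>W c\<close> keeps the sum, hence the total of
    the linear part, and lowers the heights; one of the new vertices would lie below the minimum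
    \<open>m c\<close>.\<close>
  have W_clique: "W c \<in> cliques" for c
  proof (rule ccontr)
    assume "W c \<notin> cliques"
    then obtain v w where vw: "v \<in> V" "w \<in> V" "\<phi> c v = m c" "\<phi> c w = m c" "\<not> R v w"
      by (auto simp: cliques_def W_def)
    then obtain v' w' where vw': "v' \<in> V" "w' \<in> V" "v' + w' = v + w" "\<omega> v' + \<omega> w' < \<omega> v + \<omega> w"
      using rewrite by blast
    have "c \<bullet> v' + c \<bullet> w' = c \<bullet> v + c \<bullet> w" using vw'(3) by (metis inner_add_right)
    then show False using vw vw' m_le[of v' c] m_le[of w' c] by (simp add: \<phi>_def)
  qed
  have "\<exists>c. W c = S" if S: "S \<in> cliques" "S \<noteq> {}" for S
  proof -
    have fin: "finite S" by (rule finite_clique[OF S(1)])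
    have sub: "S \<subseteq> V" by (rule clique_in_V[OF S(1)])
    \<comment> \<open>The barycentre gives positive weight to every vertex of \<open>S\<close>, so a
      functional attaining its minimum there attains it on all of \<open>S\<close>.\<close>
    define b where "b = (\<lambda>v. if v \<in> S then 1 / real (card S) else 0)"
    have b: "weights b"
      using fin S(2) sum.mono_neutral_right[OF finite_V sub, of b] by (auto simp: weights_def b_def)
    have supp_b: "support b = S" using fin S(2) sub by (auto simp: support_def b_def card_gt_0_iff)
    define x where "x = point b"
    define h where "h = height b"
    have x: "x \<in> convex hull V" using point_in_hull[OF b, of V] by (auto simp: x_def support_def)
    \<comment> \<open>A height-minimal representation of \<open>x\<close> is supported on a clique,
      and so is \<open>b\<close>; by uniqueness they agree.\<close>
    have min: "h \<le> height u" if "weights u" "point u = x" for u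
    proof -
      obtain u0 where u0: "weights u0" "point u0 = x" "support u0 \<in> cliques"
        "\<And>u'. weights u' \<Longrightarrow> point u' = x \<Longrightarrow> height u0 \<le> height u'"
        using minimal_representation[OF x] by blast
      have "u0 v = b v" if "v \<in> V" for v
        using unique_representation[OF u0(1) b] u0 supp_b S x_def that by auto
      then have "height u0 = h" by (simp add: height_def h_def)
      then show ?thesis using u0 that by auto
    qed
    define p where "p = (x, h)"
    define top where "top = (x, h + 1)"
    \<comment> \<open>\<open>lifted\<close> may fail to be full-dimensional, and a functional
      exposing one of its faces could then have height coefficient 0. The extra point
      \<open>top\<close> lies on the vertical line through \<open>p\<close> and rules this
      out.\<close>
    define E where "E = convex hull (insert top ((\<lambda>v. (v, \<omega> v)) ` V))"
    have lE: "lifted \<subseteq> E" unfolding lifted_def E_def by (intro hull_mono) auto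
    have pl: "p \<in> lifted" using b by (auto simp: lifted_iff p_def x_def h_def)
    have topE: "top \<in> E" unfolding E_def by (intro hull_inc) auto
    have E_min: "h \<le> t" if t: "(x, t) \<in> E" for t
    proof -
      obtain s r q where "0 \<le> s" "0 \<le> r" "s + r = 1" "q \<in> lifted" "(x, t) = s *\<^sub>R top + r *\<^sub>R q"
        using t V_nonempty unfolding E_def lifted_def
        by (subst (asm) convex_hull_insert) blast+
      then have q: "(x, t) = (1 - s) *\<^sub>R q + s *\<^sub>R top" "q \<in> lifted" "0 \<le> s" "s \<le> 1"
        by (auto simp: add.commute eq_diff_eq[symmetric])
      have "(1 - s) *\<^sub>R fst q = (1 - s) *\<^sub>R x" "t = (1 - s) * snd q + s * (h + 1)"
        using q(1) by (auto simp: top_def prod_eq_iff algebra_simps)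
      show ?thesis
      proof (cases "s = 1")
        case True
        then show ?thesis using \<open>t = _\<close> by simp
      next
        case False
        then have "fst q = x" using \<open>(1 - s) *\<^sub>R fst q = _\<close> by simp
        then have "h \<le> snd q" using q(2) min by (auto simp: lifted_iff)
        then have "(1 - s) * h \<le> (1 - s) * snd q" using q by (intro mult_left_mono) auto
        moreover have "h * s \<le> s * (h + 1)" using q by (simp add: algebra_simps)
        ultimately show ?thesis using \<open>t = _\<close> by (simp add: algebra_simps)
      qed
    qed
    have poly: "polyhedron E" unfolding E_def by (rule polyhedron_convex_hull) (simp add: finite_V)
    \<comment> \<open>The functional exposing the smallest face through \<open>p\<close> is not vertical, since \<open>E\<close> contains
      \<open>top\<close> above \<open>p\<close> but nothing below.\<close>
    obtain G where G: "G face_of E" "p \<in> rel_interior G"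
    proof -
      \<comment> \<open>The shift by one makes the dimension a natural number even for the empty
        set, where \<open>aff_dim\<close> is -1, so that a least value can be chosen.\<close>
      define d where "d = (LEAST d. \<exists>G. G face_of E \<and> p \<in> G \<and> nat (aff_dim G + 1) = d)"
      have "\<exists>G. G face_of E \<and> p \<in> G \<and> nat (aff_dim G + 1) = d"
        unfolding d_def
        by (rule LeastI_ex) (use lE pl convex_convex_hull face_of_refl E_def in blast)
      then obtain G where G: "G face_of E" "p \<in> G" "nat (aff_dim G + 1) = d" by blast
      have "p \<in> rel_interior G"
      proof (rule ccontr)
        assume "p \<notin> rel_interior G"
        have pG: "polyhedron G" using face_of_polyhedron_polyhedron[OF poly G(1)] .
        have "p \<in> rel_frontier G"
          using \<open>p \<notin> rel_interior G\<close> G(2) by (simp add: rel_frontier_def closure_subset[THEN subsetD])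
        then obtain H where H: "H facet_of G" "p \<in> H"
          using rel_frontier_of_polyhedron[OF pG] by auto
        then have "H face_of E" using G(1) face_of_trans facet_of_imp_face_of by blast
        moreover have "nat (aff_dim H + 1) < d"
          using H(1) G(2,3) aff_dim_geq[of H] by (auto simp: facet_of_def)
        ultimately show False using not_less_Least[of _ "\<lambda>d. \<exists>G. G face_of E \<and> p \<in> G \<and> nat (aff_dim G + 1) = d"] H(2)
          unfolding d_def by blast
      qed
      then show ?thesis using that G by blast
    qed
    have pG: "p \<in> G" using G rel_interior_subset by blast
    \<comment> \<open>From any \<open>q\<close> in \<open>G\<close>, the segment to the relatively
      interior point \<open>p\<close> can be prolonged beyond \<open>p\<close> inside
      \<open>G\<close>. For \<open>q = top\<close> this would lead below \<open>p\<close>; for a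
      lifted vertex it exhibits \<open>p\<close> as a mixture with positive weight at that
      vertex.\<close>
    have beyond: "\<exists>e>0. (1 + e) *\<^sub>R p - e *\<^sub>R q \<in> G" if q: "q \<in> G" for q
    proof -
      have "G \<noteq> {}" using pG by blast
      then have "\<forall>q\<in>G. \<exists>e>1. (1 - e) *\<^sub>R q + e *\<^sub>R p \<in> G"
        using convex_rel_interior_iff[OF face_of_imp_convex[OF G(1)], of p] G(2) by simp
      then obtain e where "e > 1" "(1 - e) *\<^sub>R q + e *\<^sub>R p \<in> G" using q by blast
      moreover have "(1 - e) *\<^sub>R q + e *\<^sub>R p = (1 + (e - 1)) *\<^sub>R p - (e - 1) *\<^sub>R q"
        by (simp add: scaleR_left_diff_distrib)
      moreover have "e - 1 > 0" using \<open>e > 1\<close> by simp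
      ultimately show ?thesis by metis
    qed
    have top_G: "top \<notin> G"
    proof
      assume "top \<in> G"
      then obtain e where "e > 0" "(1 + e) *\<^sub>R p - e *\<^sub>R top \<in> G" using beyond by blast
      moreover have "(1 + e) *\<^sub>R p - e *\<^sub>R top = (x, h - e)"
        by (simp add: p_def top_def scaleR_add_left ring_distribs)
      ultimately have "(x, h - e) \<in> E" using face_of_imp_subset[OF G(1)] by auto
      then show False using E_min[of "h - e"] \<open>e > 0\<close> by simp
    qed
    obtain a \<beta> where a: "E \<subseteq> {y. a \<bullet> y \<le> \<beta>}" "G = E \<inter> {y. a \<bullet> y = \<beta>}"
      using G(1) exposed_face_of_polyhedron[OF poly] by (metis exposed_face_of_def)
    have "a \<bullet> p = \<beta>" using pG a by auto
    have "a \<bullet> top < \<beta>" using topE top_G a by force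
    moreover have "a \<bullet> top = a \<bullet> p + snd a" by (simp add: p_def top_def inner_prod_def algebra_simps)
    ultimately have neg: "snd a < 0" using \<open>a \<bullet> p = \<beta>\<close> by simp
    \<comment> \<open>Division by the negative height coefficient normalizes it to 1 and turns the
      maximum of \<open>a\<close> over \<open>E\<close> into a minimum.\<close>
    define c where "c = (1 / snd a) *\<^sub>R fst a"
    have \<phi>a: "a \<bullet> (v, \<omega> v) = snd a * \<phi> c v" for v
      using neg by (simp add: \<phi>_def c_def inner_prod_def algebra_simps)
    have inE: "(v, \<omega> v) \<in> E" if "v \<in> V" for v
      using that unfolding E_def by (intro hull_inc) auto
    have ge: "\<beta> / snd a \<le> \<phi> c v" if "v \<in> V" for v
    proof -
      have "snd a * \<phi> c v \<le> \<beta>" using a(1) inE[OF that] \<phi>a by auto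
      then show ?thesis using neg by (simp add: field_simps)
    qed
    have eq_iff: "\<phi> c v = \<beta> / snd a \<longleftrightarrow> (v, \<omega> v) \<in> G" if "v \<in> V" for v
      using a(2) inE[OF that] \<phi>a[of v] neg by (auto simp: field_simps)
    have "fst a \<bullet> x + snd a * h = \<beta>" using \<open>a \<bullet> p = \<beta>\<close> by (simp add: p_def inner_prod_def)
    then have val: "c \<bullet> point b + height b = \<beta> / snd a"
      using neg by (simp add: c_def x_def[symmetric] h_def[symmetric] field_simps)
    have mc: "m c = \<beta> / snd a"
    proof (rule antisym)
      show "m c \<le> \<beta> / snd a" using value_ge[OF b, of c] val by simp
      show "\<beta> / snd a \<le> m c"
        using ge finite_V V_nonempty by (simp add: m_def)
    qed
    have "S \<subseteq> W c" using value_min[OF b, of c] val mc supp_b by simp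
    \<comment> \<open>A vertex \<open>v\<close> in \<open>W c\<close> lifts into \<open>G\<close>,
      so \<open>p\<close> lies strictly between it and some \<open>?q\<close> in \<open>G\<close>.
      Mixing weights of \<open>?q\<close> with a mass at \<open>v\<close> represents
      \<open>x\<close> at the minimal height; its support is thus a clique, it equals
      \<open>b\<close>, and it is positive at \<open>v\<close>.\<close>
    moreover have "W c \<subseteq> S"
    proof
      fix v assume "v \<in> W c"
      then have v: "v \<in> V" "(v, \<omega> v) \<in> G" using eq_iff mc by (auto simp: W_def)
      obtain e where e: "e > 0" "(1 + e) *\<^sub>R p - e *\<^sub>R (v, \<omega> v) \<in> G" using beyond[OF v(2)] by blast
      let ?q = "(1 + e) *\<^sub>R p - e *\<^sub>R (v, \<omega> v)"
      \<comment> \<open>A face of a hull is spanned by some of the generators. As \<open>top\<close>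
        is outside \<open>G\<close>, only lifted vertices remain, and \<open>?q\<close> has weights
        on \<open>V\<close>.\<close>
      obtain Z where Z: "Z \<subseteq> insert top ((\<lambda>v. (v, \<omega> v)) ` V)" "G = convex hull Z"
        using face_of_convex_hull_subset[OF _ G(1)[unfolded E_def]] finite_V
        by (metis finite_imageI finite_imp_compact finite_insert)
      have "top \<notin> Z" using Z(2) top_G hull_inc by metis
      then have "G \<subseteq> lifted" using Z by (auto simp: lifted_def intro!: hull_mono)
      then obtain u where u: "weights u" "?q = (point u, height u)" using e(2) lifted_iff by blast
      define u' where "u' = (\<lambda>y. (u y + e * (if y = v then 1 else 0)) / (1 + e))"
      have vs: "(\<Sum>y\<in>V. e * (if y = v then 1 else 0)) = e"
        using v(1) finite_V by (simp add: sum_distrib_left[symmetric])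
      have u': "weights u'"
        using u(1) e(1) by (auto simp: weights_def u'_def sum_divide_distrib[symmetric] sum.distrib vs)
      have "u' y *\<^sub>R y = (1 / (1 + e)) *\<^sub>R (u y *\<^sub>R y + (if y = v then e *\<^sub>R v else 0))" for y
        by (simp add: u'_def algebra_simps add_divide_distrib)
      then have "point u' = (1 / (1 + e)) *\<^sub>R (point u + e *\<^sub>R v)"
        unfolding point_def by (simp add: scaleR_sum_right[symmetric] sum.distrib finite_V v(1))
      also have "point u + e *\<^sub>R v = (1 + e) *\<^sub>R x" using u(2) by (simp add: p_def prod_eq_iff algebra_simps)
      finally have pu': "point u' = x" using e(1) by simp
      have "u' y * \<omega> y = (1 / (1 + e)) * (u y * \<omega> y + (if y = v then e * \<omega> v else 0))" for y
        by (simp add: u'_def algebra_simps add_divide_distrib)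
      then have "height u' = (1 / (1 + e)) * (height u + e * \<omega> v)"
        unfolding height_def by (simp add: sum_distrib_left[symmetric] sum.distrib finite_V v(1) sum_divide_distrib[symmetric])
      also have "height u + e * \<omega> v = (1 + e) * h" using u(2) by (simp add: p_def prod_eq_iff algebra_simps)
      finally have hu': "height u' = h" using e(1) by simp
      have "support u' \<in> cliques"
      proof (rule ccontr)
        assume "support u' \<notin> cliques"
        then show False using rewrite_lowers[OF u'] min pu' hu' by fastforce
      qed
      then have "u' v = b v" using unique_representation[OF u' b] v(1) supp_b S(1) pu' x_def by auto
      moreover have "u' v > 0" using u(1) v(1) e(1) by (auto simp: u'_def weights_def add_nonneg_pos)
      ultimately show "v \<in> S" by (auto simp: b_def split: if_splits)
    qed
    ultimately show ?thesis by blast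
  qed
  then have W_range: "range W = cliques - {{}}" using W_clique W_ne by blast
  have "clique_complex - {{}} = (\<lambda>S. convex hull S) ` (cliques - {{}})" by (auto simp: clique_complex_def)
  also have "\<dots> = range (\<lambda>c. convex hull (W c))" unfolding W_range[symmetric] image_image ..
  also have "\<dots> = (\<lambda>F. fst ` F) ` lower_faces lifted"
  proof -
    have "lower_faces lifted = range F" by (auto simp: lower_faces_def F_def[abs_def])
    then show ?thesis by (simp only: image_image fst_F)
  qed
  finally show ?thesis
    unfolding regular_triangulation_def vertices_clique_complex lifted_def[symmetric]
    unfolding lifted_def by blast
qed

end

section \<open>Piecewise linear maps and the transfer map\<close>

lemma piecewise_linear_linear: "linear f \<Longrightarrow> piecewise_linear f"
  unfolding piecewise_linear_def by (intro exI[of _ "{UNIV}"]) auto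

lemma piecewise_linear_zero: "piecewise_linear (\<lambda>x. 0)"
  by (simp add: piecewise_linear_linear linear_zero)

lemma piecewise_linear_compose_linear:
  assumes "linear g" "piecewise_linear f"
  shows "piecewise_linear (\<lambda>x. g (f x))"
proof -
  obtain \<K> where K: "finite \<K>" "\<forall>K\<in>\<K>. polyhedron K" "\<Union>\<K> = UNIV"
    "\<forall>K\<in>\<K>. \<exists>l. linear l \<and> (\<forall>x\<in>K. f x = l x)"
    using assms(2) unfolding piecewise_linear_def by blast
  have "\<exists>l. linear l \<and> (\<forall>x\<in>K. g (f x) = l x)" if k: "K \<in> \<K>" for K
  proof -
    obtain l where "linear l" "\<forall>x\<in>K. f x = l x" using K k by blast
    then have "linear (g \<circ> l)" "\<forall>x\<in>K. g (f x) = (g \<circ> l) x" using assms(1) linear_compose by auto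
    then show ?thesis by blast
  qed
  then show ?thesis unfolding piecewise_linear_def using K by blast
qed

text \<open>The pairwise intersections of the pieces of the two maps form a common
  refinement.\<close>

lemma piecewise_linear_common_pieces:
  assumes "piecewise_linear f" "piecewise_linear g"
  obtains \<K> where "finite \<K>" "\<forall>K\<in>\<K>. polyhedron K" "\<Union>\<K> = UNIV"
    "\<And>K. K \<in> \<K> \<Longrightarrow> \<exists>l. linear l \<and> (\<forall>x\<in>K. f x = l x)"
    "\<And>K. K \<in> \<K> \<Longrightarrow> \<exists>l. linear l \<and> (\<forall>x\<in>K. g x = l x)"
proof -
  obtain \<K> where K: "finite \<K>" "\<forall>K\<in>\<K>. polyhedron K" "\<Union>\<K> = UNIV"
    "\<forall>K\<in>\<K>. \<exists>l. linear l \<and> (\<forall>x\<in>K. f x = l x)"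
    using assms(1) unfolding piecewise_linear_def by blast
  obtain \<J> where J: "finite \<J>" "\<forall>K\<in>\<J>. polyhedron K" "\<Union>\<J> = UNIV"
    "\<forall>K\<in>\<J>. \<exists>l. linear l \<and> (\<forall>x\<in>K. g x = l x)"
    using assms(2) unfolding piecewise_linear_def by blast
  let ?M = "(\<lambda>(K, J). K \<inter> J) ` (\<K> \<times> \<J>)"
  have 1: "finite ?M" using K J by auto
  have 2: "\<forall>K\<in>?M. polyhedron K" using K J by (auto intro: polyhedron_Int)
  have 3: "\<Union>?M = UNIV"
  proof (intro equalityI subsetI UNIV_I)
    fix x
    obtain k j where "k \<in> \<K>" "x \<in> k" "j \<in> \<J>" "x \<in> j" using K(3) J(3) by blast
    then show "x \<in> \<Union>?M" by blast
  qed
  have 4: "\<exists>l. linear l \<and> (\<forall>x\<in>M. f x = l x)" if M: "M \<in> ?M" for M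
  proof -
    obtain k where "k \<in> \<K>" "M \<subseteq> k" using M by auto
    then show ?thesis using K(4) by (meson subsetD)
  qed
  have 5: "\<exists>l. linear l \<and> (\<forall>x\<in>M. g x = l x)" if M: "M \<in> ?M" for M
  proof -
    obtain j where "j \<in> \<J>" "M \<subseteq> j" using M by auto
    then show ?thesis using J(4) by (meson subsetD)
  qed
  show thesis by (rule that[OF 1 2 3 4 5])
qed

lemma piecewise_linear_add:
  assumes "piecewise_linear f" "piecewise_linear g"
  shows "piecewise_linear (\<lambda>x. f x + g x)"
proof -
  obtain \<K> where K: "finite \<K>" "\<forall>K\<in>\<K>. polyhedron K" "\<Union>\<K> = UNIV"
    "\<And>K. K \<in> \<K> \<Longrightarrow> \<exists>l. linear l \<and> (\<forall>x\<in>K. f x = l x)"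
    "\<And>K. K \<in> \<K> \<Longrightarrow> \<exists>l. linear l \<and> (\<forall>x\<in>K. g x = l x)"
    using piecewise_linear_common_pieces[OF assms] by blast
  have "\<exists>l. linear l \<and> (\<forall>x\<in>K. f x + g x = l x)" if k: "K \<in> \<K>" for K
  proof -
    obtain l l' where "linear l" "linear l'" "\<forall>x\<in>K. f x = l x" "\<forall>x\<in>K. g x = l' x"
      using K(4,5)[OF k] by blast
    then have "linear (\<lambda>x. l x + l' x)" "\<forall>x\<in>K. f x + g x = l x + l' x"
      using linear_compose_add by auto
    then show ?thesis by blast
  qed
  then show ?thesis unfolding piecewise_linear_def using K(1-3) by blast
qed

text \<open>On a common piece the difference of the two functions is linear, so a hyperplane through
  the origin separates the region where one dominates from the region where the other does.\<close>

lemma piecewise_linear_max: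
  fixes f g :: "'b::euclidean_space \<Rightarrow> real"
  assumes "piecewise_linear f" "piecewise_linear g"
  shows "piecewise_linear (\<lambda>x. max (f x) (g x))"
proof -
  obtain \<K> where K: "finite \<K>" "\<forall>K\<in>\<K>. polyhedron K" "\<Union>\<K> = UNIV"
    "\<And>K. K \<in> \<K> \<Longrightarrow> \<exists>l. linear l \<and> (\<forall>x\<in>K. f x = l x)"
    "\<And>K. K \<in> \<K> \<Longrightarrow> \<exists>l. linear l \<and> (\<forall>x\<in>K. g x = l x)"
    using piecewise_linear_common_pieces[OF assms] by blast
  have "\<exists>d. \<forall>x\<in>K. f x - g x = d \<bullet> x" if k: "K \<in> \<K>" for K
  proof -
    obtain l l' where l: "linear l" "linear l'" "\<forall>x\<in>K. f x = l x" "\<forall>x\<in>K. g x = l' x"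
      using K(4,5)[OF k] by blast
    have "linear (\<lambda>x. l x - l' x)" using l linear_compose_sub by blast
    \<comment> \<open>The adjoint at 1 is the vector representing a linear functional as an inner
      product; it is the normal of the cutting hyperplane.\<close>
    then have "l x - l' x = adjoint (\<lambda>x. l x - l' x) 1 \<bullet> x" for x
      using adjoint_works[of "\<lambda>x. l x - l' x" x 1] by (simp add: inner_commute)
    then show ?thesis using l by metis
  qed
  then obtain d where d: "\<And>K x. K \<in> \<K> \<Longrightarrow> x \<in> K \<Longrightarrow> f x - g x = d K \<bullet> x" by metis
  define \<M> where "\<M> = (\<lambda>K. K \<inter> {x. d K \<bullet> x \<le> 0}) ` \<K> \<union> (\<lambda>K. K \<inter> {x. d K \<bullet> x \<ge> 0}) ` \<K>"
  have "finite \<M>" using K(1) by (simp add: \<M>_def)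
  moreover have "\<forall>M\<in>\<M>. polyhedron M"
    using K(2) by (auto simp: \<M>_def intro!: polyhedron_Int polyhedron_halfspace_le polyhedron_halfspace_ge)
  moreover have "\<Union>\<M> = UNIV"
  proof (intro equalityI subsetI UNIV_I)
    fix x
    obtain k where k: "k \<in> \<K>" "x \<in> k" using K(3) by blast
    have "x \<in> k \<inter> {x. d k \<bullet> x \<le> 0} \<or> x \<in> k \<inter> {x. d k \<bullet> x \<ge> 0}" using k by auto
    then show "x \<in> \<Union>\<M>" unfolding \<M>_def using k by blast
  qed
  moreover have "\<exists>l. linear l \<and> (\<forall>x\<in>M. max (f x) (g x) = l x)" if M: "M \<in> \<M>" for M
  proof -
    obtain k where k: "k \<in> \<K>" "M = k \<inter> {x. d k \<bullet> x \<le> 0} \<or> M = k \<inter> {x. d k \<bullet> x \<ge> 0}"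
      using M unfolding \<M>_def by blast
    from k(2) show ?thesis
    proof
      assume m: "M = k \<inter> {x. d k \<bullet> x \<le> 0}"
      have eq: "max (f x) (g x) = g x" if "x \<in> M" for x
        using d[OF k(1), of x] that m by auto
      obtain l where "linear l" "\<forall>x\<in>k. g x = l x" using K(5)[OF k(1)] by blast
      then have "linear l \<and> (\<forall>x\<in>M. max (f x) (g x) = l x)" using eq m by simp
      then show ?thesis by blast
    next
      assume m: "M = k \<inter> {x. d k \<bullet> x \<ge> 0}"
      have eq: "max (f x) (g x) = f x" if "x \<in> M" for x
        using d[OF k(1), of x] that m by auto
      obtain l where "linear l" "\<forall>x\<in>k. f x = l x" using K(4)[OF k(1)] by blast
      then have "linear l \<and> (\<forall>x\<in>M. max (f x) (g x) = l x)" using eq m by simp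
      then show ?thesis by blast
    qed
  qed
  ultimately show ?thesis unfolding piecewise_linear_def by (intro exI[of _ \<M>] conjI ballI) simp_all
qed

lemma piecewise_linear_diff:
  assumes "piecewise_linear f" "piecewise_linear g"
  shows "piecewise_linear (\<lambda>x. f x - g x)"
  using piecewise_linear_add[OF assms(1) piecewise_linear_compose_linear[OF linear_uminus assms(2)]] by simp

lemma piecewise_linear_sum:
  assumes "finite I" "\<And>i. i \<in> I \<Longrightarrow> piecewise_linear (f i)"
  shows "piecewise_linear (\<lambda>x. \<Sum>i\<in>I. f i x)"
  using assms
  by (induction I rule: finite_induct) (auto intro: piecewise_linear_add piecewise_linear_zero)

lemma piecewise_linear_Max:
  fixes f :: "'i \<Rightarrow> 'b::euclidean_space \<Rightarrow> real"
  assumes "finite I" "I \<noteq> {}" "\<And>i. i \<in> I \<Longrightarrow> piecewise_linear (f i)"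
  shows "piecewise_linear (\<lambda>x. Max ((\<lambda>i. f i x) ` I))"
  using assms
proof (induction I rule: finite_ne_induct)
  case (insert i I)
  then have "Max ((\<lambda>i. f i x) ` insert i I) = max (f i x) (Max ((\<lambda>i. f i x) ` I))" for x
    by simp
  then show ?case using insert by (simp add: piecewise_linear_max)
qed simp

lemma piecewise_linear_vec:
  fixes f :: "'b::euclidean_space \<Rightarrow> real ^ 'a::finite"
  assumes "\<And>a. piecewise_linear (\<lambda>x. f x $ a)"
  shows "piecewise_linear f"
proof -
  have "linear (\<lambda>t. t *\<^sub>R axis a (1::real) :: real ^ 'a)" for a
    by (intro linearI) (auto simp: scaleR_add_left)
  then have "piecewise_linear (\<lambda>x. \<Sum>a\<in>UNIV. (f x $ a) *\<^sub>R axis a (1::real))"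
    by (intro piecewise_linear_sum piecewise_linear_compose_linear[where g = "\<lambda>t. t *\<^sub>R axis _ 1"] assms) simp_all
  moreover have "(\<lambda>x. \<Sum>a\<in>UNIV. (f x $ a) *\<^sub>R axis a (1::real)) = f"
    by (simp add: fun_eq_iff vec_eq_iff axis_def if_distrib cong: if_cong)
  ultimately show ?thesis by (simp only:)
qed

lemma piecewise_linear_Pair:
  assumes "piecewise_linear f" "piecewise_linear g"
  shows "piecewise_linear (\<lambda>x. (f x, g x))"
proof -
  have "linear (\<lambda>y. (y, 0))" "linear (\<lambda>y. (0, y))" by (auto intro!: linearI)
  then have "piecewise_linear (\<lambda>x. (f x, 0) + (0, g x))"
    using assms by (intro piecewise_linear_add piecewise_linear_compose_linear[of "\<lambda>y. (y, 0)"]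
        piecewise_linear_compose_linear[of "\<lambda>y. (0, y)"])
  then show ?thesis by simp
qed

text \<open>The pieces are finitely many closed sets covering the space and the map is continuous on
  each, so pasting applies.\<close>

lemma piecewise_linear_imp_continuous:
  assumes "piecewise_linear f"
  shows "continuous_on UNIV f"
proof -
  obtain \<K> where K: "finite \<K>" "\<forall>K\<in>\<K>. polyhedron K" "\<Union>\<K> = UNIV"
    "\<forall>K\<in>\<K>. \<exists>l. linear l \<and> (\<forall>x\<in>K. f x = l x)"
    using assms unfolding piecewise_linear_def by blast
  have "continuous_on K f" if "K \<in> \<K>" for K
    using K(4) that by (metis continuous_on_cong linear_continuous_on linear_conv_bounded_linear)
  then have "continuous_on (\<Union>K\<in>\<K>. K) f"
    using K by (intro continuous_on_closed_Union) (auto intro: polyhedron_imp_closed)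
  then show ?thesis using K(3) by simp
qed

section \<open>The chain maximum and its recursion over predecessors\<close>

definition down_chains :: "'a rel \<Rightarrow> 'a \<Rightarrow> 'a set set" where
  "down_chains r b = {C \<in> Chains r. \<forall>a\<in>C. (a, b) \<in> r}"

text \<open>The least value at \<open>b\<close> open to a nonnegative order-preserving function with
  the values \<open>h\<close> at the strict predecessors of \<open>b\<close>.\<close>

definition pred_max :: "'a::finite rel \<Rightarrow> real ^ 'a \<Rightarrow> 'a \<Rightarrow> real" where
  "pred_max r h b = Max (insert 0 ((\<lambda>a. h $ a) ` {a. (a, b) \<in> r \<and> a \<noteq> b}))"

lemma nabla_nth: "nabla r g $ b = Max ((\<lambda>C. \<Sum>a\<in>C. g $ a) ` down_chains r b)"
proof -
  have "{\<Sum>a\<in>C. g $ a | C. C \<in> Chains r \<and> (\<forall>a\<in>C. (a, b) \<in> r)} = (\<lambda>C. \<Sum>a\<in>C. g $ a) ` down_chains r b"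
    by (auto simp: down_chains_def)
  then show ?thesis by (simp add: nabla_def)
qed

lemma empty_down_chain: "{} \<in> down_chains r b"
  by (simp add: down_chains_def Chains_def)

lemma down_chains_nonempty: "down_chains r b \<noteq> {}"
  using empty_down_chain[of r b] by blast

lemma chain_sum_le_nabla: "C \<in> down_chains r b \<Longrightarrow> (\<Sum>a\<in>C. g $ a) \<le> nabla r g $ b"
  unfolding nabla_nth by (rule Max_ge) auto

lemma nabla_attained:
  obtains C where "C \<in> down_chains r b" "nabla r g $ b = (\<Sum>a\<in>C. g $ a)"
proof -
  have "Max ((\<lambda>C. \<Sum>a\<in>C. g $ a) ` down_chains r b) \<in> (\<lambda>C. \<Sum>a\<in>C. g $ a) ` down_chains r b"
    by (intro Max_in) (simp_all add: down_chains_nonempty)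
  then show ?thesis using that by (auto simp: nabla_nth)
qed

lemma nabla_nonneg: "0 \<le> nabla r g $ b"
  using chain_sum_le_nabla[OF empty_down_chain] by simp

lemma nabla_mono:
  assumes "partial_order_on UNIV r" "(a, b) \<in> r"
  shows "nabla r g $ a \<le> nabla r g $ b"
proof -
  obtain C where C: "C \<in> down_chains r a" "nabla r g $ a = (\<Sum>a\<in>C. g $ a)" by (rule nabla_attained)
  have "trans r" using assms(1) by (simp add: partial_order_on_def preorder_on_def)
  then have "C \<in> down_chains r b" using C(1) assms(2) by (auto simp: down_chains_def dest: transD)
  then show ?thesis using chain_sum_le_nabla C(2) by metis
qed

lemma nabla_cong:
  assumes "\<And>a. (a, b) \<in> r \<Longrightarrow> g $ a = g' $ a"
  shows "nabla r g $ b = nabla r g' $ b"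
proof -
  have "(\<Sum>a\<in>C. g $ a) = (\<Sum>a\<in>C. g' $ a)" if "C \<in> down_chains r b" for C
    using that assms by (auto simp: down_chains_def intro: sum.cong)
  then show ?thesis by (simp add: nabla_nth cong: image_cong)
qed

lemma pred_max_nonneg: "0 \<le> pred_max r h b"
  unfolding pred_max_def by (rule Max_ge) auto

lemma pred_max_ge: "(a, b) \<in> r \<Longrightarrow> a \<noteq> b \<Longrightarrow> h $ a \<le> pred_max r h b"
  unfolding pred_max_def by (rule Max_ge) auto

lemma pred_max_le:
  assumes "0 \<le> s" "\<And>a. (a, b) \<in> r \<Longrightarrow> a \<noteq> b \<Longrightarrow> h $ a \<le> s"
  shows "pred_max r h b \<le> s"
  unfolding pred_max_def using assms by (subst Max_le_iff) auto

lemma pred_max_cases: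
  obtains "pred_max r h b = 0" | a where "(a, b) \<in> r" "a \<noteq> b" "pred_max r h b = h $ a"
proof -
  have "pred_max r h b \<in> insert 0 ((\<lambda>a. h $ a) ` {a. (a, b) \<in> r \<and> a \<noteq> b})"
    unfolding pred_max_def by (rule Max_in) auto
  then show ?thesis using that by auto
qed

lemma pred_max_cong:
  assumes "\<And>a. (a, b) \<in> r \<Longrightarrow> a \<noteq> b \<Longrightarrow> h $ a = h' $ a"
  shows "pred_max r h b = pred_max r h' b"
  using assms unfolding pred_max_def by (auto intro!: arg_cong[where f = Max])

lemma chain_has_top:
  assumes "partial_order_on UNIV r" "finite C" "C \<noteq> {}" "C \<in> Chains r"
  shows "\<exists>m\<in>C. \<forall>a\<in>C. (a, m) \<in> r"
  using assms(2-4)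
proof (induction C rule: finite_ne_induct)
  case (singleton x)
  then show ?case by (auto simp: Chains_def)
next
  case (insert x C)
  have "C \<in> Chains r" using insert.prems by (auto simp: Chains_def)
  then obtain m where m: "m \<in> C" "\<forall>a\<in>C. (a, m) \<in> r" using insert.IH by blast
  have tr: "trans r" using assms(1) by (simp add: partial_order_on_def preorder_on_def)
  have rx: "(x, x) \<in> r" using insert.prems by (auto simp: Chains_def)
  have "(x, m) \<in> r \<or> (m, x) \<in> r" using insert.prems m by (auto simp: Chains_def)
  then show ?case
  proof
    assume "(x, m) \<in> r"
    then show ?thesis using m by auto
  next
    assume "(m, x) \<in> r"
    then have "\<forall>a\<in>insert x C. (a, x) \<in> r" using m rx tr by (auto dest: transD)
    then show ?thesis by blast
  qed
qed

text \<open>A chain weakly below \<open>b\<close>, with \<open>b\<close> removed, is empty or has a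
  top that is a strict predecessor of \<open>b\<close>. Whether \<open>b\<close> is then added is
  optional, which accounts for \<open>max 0 (g $ b)\<close>.\<close>

lemma nabla_rec:
  assumes po: "partial_order_on UNIV r"
  shows "nabla r g $ b = max 0 (g $ b) + pred_max r (nabla r g) b"
proof (rule antisym)
  have rf: "(x, x) \<in> r" for x using po by (simp add: partial_order_on_def preorder_on_def refl_on_def)
  have tr: "trans r" and an: "antisym r" using po by (simp_all add: partial_order_on_def preorder_on_def)
  obtain C where C: "C \<in> down_chains r b" "nabla r g $ b = (\<Sum>a\<in>C. g $ a)" by (rule nabla_attained)
  have "(\<Sum>a\<in>C - {b}. g $ a) \<le> pred_max r (nabla r g) b"
  proof (cases "C - {b} = {}")
    case True
    then show ?thesis by (simp add: True pred_max_nonneg)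
  next
    case False
    have "C - {b} \<in> Chains r" using C by (auto simp: down_chains_def Chains_def)
    then obtain m where m: "m \<in> C - {b}" "\<forall>a\<in>C - {b}. (a, m) \<in> r"
      using chain_has_top[OF po _ False] by auto
    then have "C - {b} \<in> down_chains r m" using \<open>C - {b} \<in> Chains r\<close> by (simp add: down_chains_def)
    then have "(\<Sum>a\<in>C - {b}. g $ a) \<le> nabla r g $ m" by (rule chain_sum_le_nabla)
    also have "\<dots> \<le> pred_max r (nabla r g) b"
      using m C by (intro pred_max_ge) (auto simp: down_chains_def)
    finally show ?thesis .
  qed
  moreover have "(\<Sum>a\<in>C. g $ a) \<le> max 0 (g $ b) + (\<Sum>a\<in>C - {b}. g $ a)"
    by (cases "b \<in> C") (auto simp: sum.remove[of C b])
  ultimately show "nabla r g $ b \<le> max 0 (g $ b) + pred_max r (nabla r g) b" using C by simp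
  have ins: "(\<Sum>a\<in>C. g $ a) + max 0 (g $ b) \<le> nabla r g $ b" if "C \<in> down_chains r b" "b \<notin> C" for C
  proof -
    have "insert b C \<in> down_chains r b" using that rf by (auto simp: down_chains_def Chains_def)
    from chain_sum_le_nabla[OF this, of g] chain_sum_le_nabla[OF that(1), of g] that(2)
    show ?thesis by auto
  qed
  show "max 0 (g $ b) + pred_max r (nabla r g) b \<le> nabla r g $ b"
  proof (cases rule: pred_max_cases[of r "nabla r g" b])
    case 1
    then show ?thesis using ins[OF empty_down_chain] by simp
  next
    case (2 a)
    obtain C where C: "C \<in> down_chains r a" "nabla r g $ a = (\<Sum>a\<in>C. g $ a)" by (rule nabla_attained)
    have "C \<in> down_chains r b" using C(1) 2(1) tr by (auto simp: down_chains_def dest: transD)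
    moreover have "b \<notin> C" using C(1) 2(1,2) an by (auto simp: down_chains_def dest: antisymD)
    ultimately show ?thesis using ins[of C] C(2) 2(3) by simp
  qed
qed

text \<open>Since \<open>max 0 x - max 0 (- x) = x\<close>, the two contributions of
  \<open>b\<close> itself add up to the plain coordinate, and all nonlinearity is confined to strict
  predecessors. This is the unitriangular form that makes \<Psi> invertible.\<close>

lemma Psi_rec:
  assumes "partial_order_on UNIV rp" "partial_order_on UNIV rm"
  shows "Psi rp rm g $ b = g $ b + pred_max rp (nabla rp g) b - pred_max rm (nabla rm (- g)) b"
  unfolding Psi_def vector_minus_component nabla_rec[OF assms(1), of g b] nabla_rec[OF assms(2), of "- g" b]
  by (simp add: max_def)

lemma piecewise_linear_nabla:
  assumes "\<And>a. (a, b) \<in> r \<Longrightarrow> piecewise_linear (\<lambda>x. f x $ a)"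
  shows "piecewise_linear (\<lambda>x. nabla r (f x) $ b)"
  unfolding nabla_nth
  by (intro piecewise_linear_Max piecewise_linear_sum assms down_chains_nonempty) (auto simp: down_chains_def)

lemma piecewise_linear_pred_max:
  assumes "\<And>a. (a, b) \<in> r \<Longrightarrow> a \<noteq> b \<Longrightarrow> piecewise_linear (\<lambda>x. h x $ a)"
  shows "piecewise_linear (\<lambda>x. pred_max r (h x) b)"
proof -
  \<comment> \<open>The index \<open>None\<close> stands for the 0 that \<open>pred_max\<close>
    inserts into its maximum.\<close>
  let ?f = "\<lambda>i x. case i of None \<Rightarrow> 0 | Some a \<Rightarrow> h x $ a"
  let ?I = "insert None (Some ` {a. (a, b) \<in> r \<and> a \<noteq> b})"
  have "piecewise_linear (\<lambda>x. Max ((\<lambda>i. ?f i x) ` ?I))"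
    using assms by (intro piecewise_linear_Max) (auto simp: piecewise_linear_zero)
  then show ?thesis by (simp add: pred_max_def image_image)
qed

section \<open>Inversion of the transfer map along a common linear extension\<close>

locale compatible_posets =
  fixes rp rm L :: "'a::finite rel"
  assumes po_p: "partial_order_on UNIV rp" and po_m: "partial_order_on UNIV rm"
    and lin: "linear_order_on UNIV L" and sub_p: "rp \<subseteq> L" and sub_m: "rm \<subseteq> L"
begin

lemma L_trans: "(a, b) \<in> L \<Longrightarrow> (b, c) \<in> L \<Longrightarrow> (a, c) \<in> L"
  using lin by (auto simp: linear_order_on_def partial_order_on_def preorder_on_def dest: transD)

lemma L_antisym: "(a, b) \<in> L \<Longrightarrow> (b, a) \<in> L \<Longrightarrow> a = b"
  using lin by (auto simp: linear_order_on_def partial_order_on_def dest: antisymD)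

lemma L_refl: "(a, a) \<in> L"
  using lin by (auto simp: linear_order_on_def partial_order_on_def preorder_on_def refl_on_def)

lemma L_total: "(a, b) \<in> L \<or> (b, a) \<in> L"
  using lin L_refl by (cases "a = b") (auto simp: linear_order_on_def total_on_def)

lemma L_induct [case_names less]:
  assumes "\<And>b. (\<And>a. (a, b) \<in> L \<Longrightarrow> a \<noteq> b \<Longrightarrow> P a) \<Longrightarrow> P b"
  shows "P b"
proof (induction "card {a. (a, b) \<in> L}" arbitrary: b rule: less_induct)
  case less
  show ?case
  proof (rule assms)
    fix a assume a: "(a, b) \<in> L" "a \<noteq> b"
    then have "{c. (c, a) \<in> L} \<subset> {c. (c, b) \<in> L}" using L_trans L_antisym L_refl by blast
    then show "P a" by (intro less psubset_card_mono) auto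
  qed
qed

lemma L_least:
  assumes "S \<noteq> {}"
  shows "\<exists>b\<in>S. \<forall>a\<in>S. (b, a) \<in> L"
proof -
  obtain s where "s \<in> S" using assms by blast
  then show ?thesis
  proof (induction s rule: L_induct)
    case (less s)
    then show ?case using L_total L_refl by blast
  qed
qed

abbreviation "dn_p \<equiv> nabla rp"
abbreviation "dn_m g \<equiv> nabla rm (- g)"
abbreviation "\<Psi> \<equiv> Psi rp rm"

lemma Psi_nth: "\<Psi> g $ b = g $ b + pred_max rp (dn_p g) b - pred_max rm (dn_m g) b"
  by (rule Psi_rec[OF po_p po_m])

text \<open>The correction terms in \<open>Psi_nth\<close> at \<open>b\<close> see only coordinates
  strictly before \<open>b\<close> in \<open>L\<close>: a chain below a strict predecessor of
  \<open>b\<close> stays strictly before \<open>b\<close>, in either order.\<close>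

lemma pred_max_nabla_cong:
  assumes "\<And>a. (a, b) \<in> L \<Longrightarrow> a \<noteq> b \<Longrightarrow> g $ a = g' $ a"
  shows "pred_max rp (dn_p g) b = pred_max rp (dn_p g') b"
    and "pred_max rm (dn_m g) b = pred_max rm (dn_m g') b"
proof -
  have eq: "g $ c = g' $ c" if "(c, a) \<in> L" "(a, b) \<in> L" "a \<noteq> b" for a c
    using assms that L_trans L_antisym by metis
  show "pred_max rp (dn_p g) b = pred_max rp (dn_p g') b"
    using eq sub_p by (intro pred_max_cong nabla_cong) blast
  show "pred_max rm (dn_m g) b = pred_max rm (dn_m g') b"
    using eq sub_m by (intro pred_max_cong nabla_cong) (simp, blast)
qed

lemma inj_Psi: "inj \<Psi>"
proof (rule injI)
  fix g g' assume eq: "\<Psi> g = \<Psi> g'"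
  have "g $ b = g' $ b" for b
  proof (induction b rule: L_induct)
    case (less b)
    have "\<Psi> g $ b = \<Psi> g' $ b" using eq by simp
    then show ?case using pred_max_nabla_cong[of b g g'] less by (simp add: Psi_nth)
  qed
  then show "g = g'" by (simp add: vec_eq_iff)
qed

lemma nabla_Ints: "(\<And>a. g $ a \<in> \<int>) \<Longrightarrow> nabla r g $ b \<in> \<int>"
  by (rule nabla_attained[of r b g]) (simp add: Ints_sum)

lemma pred_max_Ints: "(\<And>a. h $ a \<in> \<int>) \<Longrightarrow> pred_max r h b \<in> \<int>"
  by (rule pred_max_cases[of r h b]) auto

lemma Psi_Ints: "(\<And>a. g $ a \<in> \<int>) \<Longrightarrow> \<Psi> g $ b \<in> \<int>"
  by (simp add: Psi_def nabla_Ints)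

text \<open>A preimage is built on growing initial segments of \<open>L\<close>. Carrying
  integrality along in the same induction shows that the inverse preserves the lattice too, as each
  new coordinate arises by addition, subtraction and maxima.\<close>

lemma Psi_surj_Ints: "\<exists>g. \<Psi> g = f \<and> ((\<forall>a. f $ a \<in> \<int>) \<longrightarrow> (\<forall>a. g $ a \<in> \<int>))"
proof -
  have "\<exists>g. (\<forall>b\<in>D. \<Psi> g $ b = f $ b) \<and> ((\<forall>a. f $ a \<in> \<int>) \<longrightarrow> (\<forall>a. g $ a \<in> \<int>))"
    if "\<And>a b. b \<in> D \<Longrightarrow> (a, b) \<in> L \<Longrightarrow> a \<in> D" for D
    using that
  proof (induction "card D" arbitrary: D rule: less_induct)
    case less
    show ?case
    proof (cases "D = {}")
      case True
      then show ?thesis by (intro exI[of _ 0]) auto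
    next
      case False
      have "D \<in> Chains L" using L_total by (auto simp: Chains_def)
      then obtain m where m: "m \<in> D" "\<forall>a\<in>D. (a, m) \<in> L"
        using chain_has_top[of L D] False lin by (auto simp: linear_order_on_def)
      have down: "a \<in> D - {m}" if "b \<in> D - {m}" "(a, b) \<in> L" for a b
        using less.prems[of b a] that m L_antisym by auto
      have "card (D - {m}) < card D" using m(1) by (meson card_Diff1_less finite)
      then obtain g where g: "\<forall>b\<in>D - {m}. \<Psi> g $ b = f $ b"
        "(\<forall>a. f $ a \<in> \<int>) \<longrightarrow> (\<forall>a. g $ a \<in> \<int>)"
        using less.hyps[of "D - {m}"] down by blast
      \<comment> \<open>\<open>Psi_nth\<close> at the top \<open>m\<close> of \<open>D\<close>,
        solved for the coordinate at \<open>m\<close>. Changing that coordinate leaves \<Psi> at the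
        other elements of \<open>D\<close> untouched.\<close>
      define z where "z = f $ m - pred_max rp (dn_p g) m + pred_max rm (dn_m g) m"
      define g' where "g' = (\<chi> a. if a = m then z else g $ a)"
      have same: "g' $ a = g $ a" if "a \<noteq> m" for a using that by (simp add: g'_def)
      have "\<Psi> g' $ b = f $ b" if b: "b \<in> D" for b
      proof (cases "b = m")
        case True
        then show ?thesis using pred_max_nabla_cong[of m g' g] same
          by (simp add: Psi_nth) (simp add: g'_def z_def)
      next
        case False
        have "g' $ a = g $ a" if "(a, b) \<in> L" for a
          using down[of b a] that b False by (intro same) auto
        then have "\<Psi> g' $ b = \<Psi> g $ b"
          using pred_max_nabla_cong[of b g' g] L_refl by (simp add: Psi_nth)
        then show ?thesis using g b False by simp
      qed
      moreover have "(\<forall>a. f $ a \<in> \<int>) \<longrightarrow> (\<forall>a. g' $ a \<in> \<int>)"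
        using g(2) by (auto simp: g'_def z_def intro!: Ints_add Ints_diff pred_max_Ints nabla_Ints)
      ultimately show ?thesis by blast
    qed
  qed
  from this[of UNIV] show ?thesis by (auto simp: vec_eq_iff)
qed

lemma bij_Psi: "bij \<Psi>"
  using inj_Psi Psi_surj_Ints by (metis bij_def surj_def)

lemma transfer_map_eq: "transfer_map rp rm = (\<lambda>p. (\<Psi> (fst p), snd p))"
  by (auto simp: transfer_map_def)

lemma transfer_map_lattice: "transfer_map rp rm ` integer_lattice = integer_lattice"
proof
  show "transfer_map rp rm ` integer_lattice \<subseteq> integer_lattice"
    by (auto simp: integer_lattice_def transfer_map_def Psi_Ints)
  show "integer_lattice \<subseteq> transfer_map rp rm ` integer_lattice"
  proof
    fix p :: "(real ^ 'a) \<times> real" assume p: "p \<in> integer_lattice"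
    obtain g where "\<Psi> g = fst p" "\<forall>a. g $ a \<in> \<int>"
      using p Psi_surj_Ints[of "fst p"] by (auto simp: integer_lattice_def)
    then have "(g, snd p) \<in> integer_lattice" "p = transfer_map rp rm (g, snd p)"
      using p by (auto simp: integer_lattice_def transfer_map_eq)
    then show "p \<in> transfer_map rp rm ` integer_lattice" by blast
  qed
qed

lemma piecewise_linear_nth_fst: "piecewise_linear (\<lambda>p :: (real ^ 'a) \<times> real. fst p $ a)"
  by (intro piecewise_linear_linear linearI) auto

lemma piecewise_linear_uminus_nth:
  "piecewise_linear (\<lambda>x. f x $ a) \<Longrightarrow> piecewise_linear (\<lambda>x. (- f x) $ a)"
  using piecewise_linear_compose_linear[OF linear_uminus, of "\<lambda>x. f x $ a"] by simp

lemma transfer_map_homeomorphism: "piecewise_linear_homeomorphism (transfer_map rp rm)"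
proof -
  define G where "G = inv \<Psi>"
  have G: "\<Psi> (G f) = f" "G (\<Psi> g) = g" for f g
    using bij_Psi by (simp_all add: G_def bij_is_inj bij_is_surj surj_f_inv_f)
  have plT: "piecewise_linear (transfer_map rp rm)"
  proof -
    have "piecewise_linear (\<lambda>p :: (real ^ 'a) \<times> real. dn_p (fst p) $ a - dn_m (fst p) $ a)" for a
      by (intro piecewise_linear_diff piecewise_linear_nabla piecewise_linear_uminus_nth piecewise_linear_nth_fst)
    then have "piecewise_linear (\<lambda>p :: (real ^ 'a) \<times> real. \<Psi> (fst p))"
      by (intro piecewise_linear_vec) (simp add: Psi_def)
    then show ?thesis
      unfolding transfer_map_eq by (intro piecewise_linear_Pair piecewise_linear_linear[OF linear_snd])
  qed
  \<comment> \<open>Solving \<open>Psi_nth\<close> for the coordinate at \<open>b\<close> expresses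
    the inverse at \<open>b\<close> through its values at earlier elements, so induction along
    \<open>L\<close> applies.\<close>
  have "piecewise_linear (\<lambda>p :: (real ^ 'a) \<times> real. G (fst p) $ b)" for b
  proof (induction b rule: L_induct)
    case (less b)
    have eq: "G (fst p) $ b = fst p $ b - pred_max rp (dn_p (G (fst p))) b + pred_max rm (dn_m (G (fst p))) b"
      for p :: "(real ^ 'a) \<times> real"
      using Psi_nth[of "G (fst p)" b] by (simp add: G)
    have below: "piecewise_linear (\<lambda>p :: (real ^ 'a) \<times> real. G (fst p) $ c)"
      if "(c, a) \<in> L" "(a, b) \<in> L" "a \<noteq> b" for a c
      using less[of c] that L_trans[of c a b] L_antisym[of a b] by blast
    show ?case unfolding eq
      by (intro piecewise_linear_add piecewise_linear_diff piecewise_linear_pred_max piecewise_linear_nabla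
        piecewise_linear_uminus_nth piecewise_linear_nth_fst; rule below; use sub_p sub_m in blast)
  qed
  then have plG: "piecewise_linear (\<lambda>p :: (real ^ 'a) \<times> real. (G (fst p), snd p))"
    by (intro piecewise_linear_Pair piecewise_linear_vec piecewise_linear_linear[OF linear_snd])
  have "homeomorphism UNIV UNIV (transfer_map rp rm) (\<lambda>p. (G (fst p), snd p))"
    using piecewise_linear_imp_continuous[OF plT] piecewise_linear_imp_continuous[OF plG]
    by (intro homeomorphismI) (auto simp: transfer_map_eq G)
  then show ?thesis unfolding piecewise_linear_homeomorphism_def using plT plG by blast
qed

end

section \<open>The double chain and double order polytopes\<close>

text \<open>The dilate of the order polytope by \<open>s\<close>, given by inequalities so that the
  factor 0, which occurs at heights 1 and -1, needs no division.\<close>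

definition monotone_upto :: "'a::finite rel \<Rightarrow> real \<Rightarrow> real ^ 'a \<Rightarrow> bool" where
  "monotone_upto r s F \<longleftrightarrow> (\<forall>a b. (a, b) \<in> r \<longrightarrow> 0 \<le> F $ a \<and> F $ a \<le> F $ b \<and> F $ b \<le> s)"

text \<open>The slice of a Cayley polytope at height \<open>t\<close> is a weighted Minkowski sum.
  The barycentric coordinates at height \<open>t\<close> are \<open>(1 + t) / 2\<close> and
  \<open>(1 - t) / 2\<close>, and the dilation by 2 clears the denominators.\<close>

lemma double_hull_iff:
  fixes A B :: "(real ^ 'a::finite) set"
  assumes "convex A" "A \<noteq> {}" "convex B" "B \<noteq> {}"
  shows "(x, t) \<in> convex hull (((\<lambda>f. 2 *\<^sub>R f) ` A) \<times> {1::real} \<union> ((\<lambda>f. (-2) *\<^sub>R f) ` B) \<times> {-1}) \<longleftrightarrow>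
    -1 \<le> t \<and> t \<le> 1 \<and> (\<exists>a\<in>A. \<exists>b\<in>B. x = (1 + t) *\<^sub>R a - (1 - t) *\<^sub>R b)"
    (is "?lhs \<longleftrightarrow> ?rhs")
proof -
  have "convex (((\<lambda>f. 2 *\<^sub>R f) ` A) \<times> {1::real})" "convex (((\<lambda>f. (-2) *\<^sub>R f) ` B) \<times> {-1::real})"
    by (intro convex_Times convex_scaling convex_singleton assms)+
  then have eq: "convex hull (((\<lambda>f. 2 *\<^sub>R f) ` A) \<times> {1::real} \<union> ((\<lambda>f. (-2) *\<^sub>R f) ` B) \<times> {-1}) =
    {u *\<^sub>R p + v *\<^sub>R q | u v p q. 0 \<le> u \<and> 0 \<le> v \<and> u + v = 1 \<and>
      p \<in> ((\<lambda>f. 2 *\<^sub>R f) ` A) \<times> {1} \<and> q \<in> ((\<lambda>f. (-2) *\<^sub>R f) ` B) \<times> {-1}}"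
    using assms by (intro convex_hull_union_two) auto
  show ?thesis
  proof
    assume ?lhs
    then obtain u v a b where h: "0 \<le> u" "0 \<le> v" "u + v = 1" "a \<in> A" "b \<in> B"
      "(x, t) = u *\<^sub>R (2 *\<^sub>R a, 1) + v *\<^sub>R ((-2) *\<^sub>R b, -1)"
      unfolding eq by auto
    then have "t = u - v" and "x = (2 * u) *\<^sub>R a - (2 * v) *\<^sub>R b"
      by (auto simp: algebra_simps)
    moreover have "2 * u = 1 + t" "2 * v = 1 - t" using h(3) \<open>t = u - v\<close> by auto
    ultimately show ?rhs using h by (intro conjI bexI[OF _ h(4)] bexI[OF _ h(5)]) auto
  next
    assume ?rhs
    then obtain a b where h: "-1 \<le> t" "t \<le> 1" "a \<in> A" "b \<in> B" "x = (1 + t) *\<^sub>R a - (1 - t) *\<^sub>R b" by blast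
    define u v where "u = (1 + t) / 2" and "v = (1 - t) / 2"
    have "0 \<le> u" "0 \<le> v" "u + v = 1" using h by (auto simp: u_def v_def field_simps)
    moreover have "(x, t) = u *\<^sub>R (2 *\<^sub>R a, 1) + v *\<^sub>R ((-2) *\<^sub>R b, -1)"
    proof -
      have "u *\<^sub>R 2 *\<^sub>R a = (1 + t) *\<^sub>R a" "v *\<^sub>R (-2) *\<^sub>R b = - ((1 - t) *\<^sub>R b)" "u - v = t"
        by (simp_all add: u_def v_def diff_divide_distrib[symmetric])
      then show ?thesis using h(5) by (simp only: scaleR_Pair add_Pair) simp
    qed
    ultimately show ?lhs unfolding eq using h(3,4) by blast
  qed
qed

lemma monotone_upto_scale:
  assumes "partial_order_on UNIV r" "0 \<le> s"
  shows "monotone_upto r s F \<longleftrightarrow> (\<exists>f\<in>order_polytope r. F = s *\<^sub>R f)"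
proof
  have rf: "(x, x) \<in> r" for x
    using assms(1) by (simp add: partial_order_on_def preorder_on_def refl_on_def)
  assume F: "monotone_upto r s F"
  show "\<exists>f\<in>order_polytope r. F = s *\<^sub>R f"
  proof (cases "s = 0")
    case True
    have "F $ a = 0" for a using F True rf[of a] by (force simp: monotone_upto_def)
    then have "F = s *\<^sub>R 0" by (simp add: vec_eq_iff)
    moreover have "0 \<in> order_polytope r" by (simp add: order_polytope_def)
    ultimately show ?thesis by blast
  next
    case False
    then have "s > 0" using assms by simp
    then have "(1 / s) *\<^sub>R F \<in> order_polytope r"
      using F by (auto simp: order_polytope_def monotone_upto_def divide_right_mono)
    moreover have "F = s *\<^sub>R ((1 / s) *\<^sub>R F)" using False by simp
    ultimately show ?thesis by blast
  qed
next
  assume "\<exists>f\<in>order_polytope r. F = s *\<^sub>R f"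
  then obtain f where f: "f \<in> order_polytope r" "F = s *\<^sub>R f" by blast
  show "monotone_upto r s F"
    unfolding monotone_upto_def f(2)
    using f(1) assms(2) by (auto simp: order_polytope_def mult_left_mono mult_left_le)
qed

lemma convex_order_polytope: "convex (order_polytope r)"
proof -
  have "order_polytope r = (\<Inter>(a, b)\<in>r. {f. 0 \<le> f $ a} \<inter> {f. f $ a - f $ b \<le> 0} \<inter> {f. f $ b \<le> 1})"
    by (auto simp: order_polytope_def)
  moreover have "convex {f :: real ^ 'a. 0 \<le> f $ a}" "convex {f :: real ^ 'a. f $ a - f $ b \<le> 0}"
    "convex {f :: real ^ 'a. f $ b \<le> 1}" for a b
    by (auto simp: convex_def algebra_simps intro: convex_bound_le)
       (smt (verit, ccfv_SIG) mult_left_mono distrib_left)+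
  ultimately show ?thesis by (auto intro!: convex_INT convex_Int)
qed

lemma convex_chain_polytope: "convex (chain_polytope r)"
  unfolding convex_def chain_polytope_def
proof (clarify, intro conjI allI ballI)
  fix f g :: "real ^ 'a" and u v :: real
  assume f: "\<forall>a. 0 \<le> f $ a" "\<forall>C\<in>Chains r. (\<Sum>a\<in>C. f $ a) \<le> 1"
    and g: "\<forall>a. 0 \<le> g $ a" "\<forall>C\<in>Chains r. (\<Sum>a\<in>C. g $ a) \<le> 1"
    and uv: "0 \<le> u" "0 \<le> v" "u + v = 1"
  show "0 \<le> (u *\<^sub>R f + v *\<^sub>R g) $ a" for a using f g uv by simp
  fix C assume "C \<in> Chains r"
  then have "u * (\<Sum>a\<in>C. f $ a) + v * (\<Sum>a\<in>C. g $ a) \<le> 1"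
    using f(2) g(2) uv by (intro convex_bound_le) auto
  then show "(\<Sum>a\<in>C. (u *\<^sub>R f + v *\<^sub>R g) $ a) \<le> 1"
    by (simp add: sum.distrib sum_distrib_left)
qed

lemma double_order_polytope_iff:
  assumes "partial_order_on UNIV rp" "partial_order_on UNIV rm"
  shows "(x, t) \<in> double_order_polytope rp rm \<longleftrightarrow> -1 \<le> t \<and> t \<le> 1 \<and>
    (\<exists>F1 F2. x = F1 - F2 \<and> monotone_upto rp (1 + t) F1 \<and> monotone_upto rm (1 - t) F2)"
proof -
  have "0 \<in> order_polytope r" for r :: "'a rel" by (simp add: order_polytope_def)
  then have ne: "order_polytope r \<noteq> {}" for r :: "'a rel" by blast
  have "(\<exists>F1 F2. x = F1 - F2 \<and> monotone_upto rp (1 + t) F1 \<and> monotone_upto rm (1 - t) F2) \<longleftrightarrow>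
    (\<exists>a\<in>order_polytope rp. \<exists>b\<in>order_polytope rm. x = (1 + t) *\<^sub>R a - (1 - t) *\<^sub>R b)"
    if "-1 \<le> t" "t \<le> 1"
    using monotone_upto_scale[OF assms(1), of "1 + t"] monotone_upto_scale[OF assms(2), of "1 - t"] that by auto
  then show ?thesis
    unfolding double_order_polytope_def double_hull_iff[OF convex_order_polytope ne convex_order_polytope ne] by blast
qed

text \<open>Discarding the nonpositive entries of a chain leaves a chain whose sum is that of the
  positive parts; if nonempty, it has a top and is therefore counted by \<open>nabla\<close>
  there.\<close>

lemma nabla_le_iff:
  assumes "partial_order_on UNIV r" "0 \<le> s"
  shows "(\<forall>b. nabla r g $ b \<le> s) \<longleftrightarrow> (\<forall>C\<in>Chains r. (\<Sum>a\<in>C. max 0 (g $ a)) \<le> s)"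
proof
  assume R: "\<forall>C\<in>Chains r. (\<Sum>a\<in>C. max 0 (g $ a)) \<le> s"
  show "\<forall>b. nabla r g $ b \<le> s"
  proof
    fix b
    obtain C where C: "C \<in> down_chains r b" "nabla r g $ b = (\<Sum>a\<in>C. g $ a)" by (rule nabla_attained)
    have "(\<Sum>a\<in>C. g $ a) \<le> (\<Sum>a\<in>C. max 0 (g $ a))" by (rule sum_mono) simp
    also have "\<dots> \<le> s" using C R by (simp add: down_chains_def)
    finally show "nabla r g $ b \<le> s" using C by simp
  qed
next
  assume N: "\<forall>b. nabla r g $ b \<le> s"
  show "\<forall>C\<in>Chains r. (\<Sum>a\<in>C. max 0 (g $ a)) \<le> s"
  proof
    fix C assume C: "C \<in> Chains r"
    define C' where "C' = {a \<in> C. 0 < g $ a}"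
    have eq: "(\<Sum>a\<in>C. max 0 (g $ a)) = (\<Sum>a\<in>C'. g $ a)"
      by (rule sum.mono_neutral_cong_right) (auto simp: C'_def)
    have C': "C' \<in> Chains r" using C by (auto simp: C'_def Chains_def)
    show "(\<Sum>a\<in>C. max 0 (g $ a)) \<le> s"
    proof (cases "C' = {}")
      case True
      then show ?thesis using assms(2) eq by simp
    next
      case False
      then obtain m where "m \<in> C'" "\<forall>a\<in>C'. (a, m) \<in> r" using chain_has_top[OF assms(1) _ False C'] by auto
      then have "C' \<in> down_chains r m" using C' by (simp add: down_chains_def)
      from chain_sum_le_nabla[OF this, of g] N show ?thesis using eq by (metis order_trans)
    qed
  qed
qed

lemma chain_polytope_scale:
  assumes "0 \<le> s" "\<And>a. 0 \<le> G $ a" "\<And>C. C \<in> Chains r \<Longrightarrow> (\<Sum>a\<in>C. G $ a) \<le> s" "partial_order_on UNIV r"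
  shows "\<exists>g\<in>chain_polytope r. G = s *\<^sub>R g"
proof (cases "s = 0")
  case True
  have "(a, a) \<in> r" for a using assms(4) by (simp add: partial_order_on_def preorder_on_def refl_on_def)
  then have "{a} \<in> Chains r" for a by (simp add: Chains_def)
  then have "G $ a \<le> 0" for a using assms(3)[of "{a}"] True by simp
  then have "G = s *\<^sub>R 0" using assms(2) by (simp add: vec_eq_iff eq_iff)
  moreover have "0 \<in> chain_polytope r" by (simp add: chain_polytope_def)
  ultimately show ?thesis by blast
next
  case False
  then have "s > 0" using assms by simp
  then have "(1 / s) *\<^sub>R G \<in> chain_polytope r"
    using assms by (auto simp: chain_polytope_def sum_divide_distrib[symmetric])
  moreover have "G = s *\<^sub>R ((1 / s) *\<^sub>R G)" using False by simp
  ultimately show ?thesis by blast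
qed

text \<open>Chain inequalities survive lowering nonnegative coordinates. In any decomposition of
  \<open>g\<close> the two terms dominate the positive and negative part of \<open>g\<close>, so
  these parts may be taken as the decomposition.\<close>

lemma double_chain_polytope_iff:
  assumes "partial_order_on UNIV rp" "partial_order_on UNIV rm"
  shows "(g, t) \<in> double_chain_polytope rp rm \<longleftrightarrow> -1 \<le> t \<and> t \<le> 1 \<and>
    (\<forall>b. nabla rp g $ b \<le> 1 + t) \<and> (\<forall>b. nabla rm (- g) $ b \<le> 1 - t)"
proof -
  have "0 \<in> chain_polytope r" for r :: "'a rel" by (simp add: chain_polytope_def)
  then have ne: "chain_polytope r \<noteq> {}" for r :: "'a rel" by blast
  have "(\<exists>a\<in>chain_polytope rp. \<exists>b\<in>chain_polytope rm. g = (1 + t) *\<^sub>R a - (1 - t) *\<^sub>R b) \<longleftrightarrow>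
    (\<forall>b. nabla rp g $ b \<le> 1 + t) \<and> (\<forall>b. nabla rm (- g) $ b \<le> 1 - t)" (is "?l \<longleftrightarrow> ?r")
    if t: "-1 \<le> t" "t \<le> 1"
  proof -
    have s: "0 \<le> 1 + t" "0 \<le> 1 - t" using t by auto
    have r: "?r \<longleftrightarrow> (\<forall>C\<in>Chains rp. (\<Sum>a\<in>C. max 0 (g $ a)) \<le> 1 + t) \<and> (\<forall>C\<in>Chains rm. (\<Sum>a\<in>C. max 0 (- g $ a)) \<le> 1 - t)"
      using nabla_le_iff[OF assms(1) s(1), of g] nabla_le_iff[OF assms(2) s(2), of "- g"] by simp
    show ?thesis
    proof
      assume ?l
      then obtain a b where ab: "a \<in> chain_polytope rp" "b \<in> chain_polytope rm" "g = (1 + t) *\<^sub>R a - (1 - t) *\<^sub>R b" by blast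
      have nn: "0 \<le> a $ c" "0 \<le> b $ c" for c using ab by (auto simp: chain_polytope_def)
      have gc: "g $ c = (1 + t) * a $ c - (1 - t) * b $ c" for c using ab(3) by simp
      have nn': "0 \<le> (1 + t) * a $ c" "0 \<le> (1 - t) * b $ c" for c
        using nn s by auto
      have bd: "max 0 (g $ c) \<le> (1 + t) * a $ c" "max 0 (- g $ c) \<le> (1 - t) * b $ c" for c
        using nn'[of c] gc[of c] by auto
      have "(\<Sum>c\<in>C. max 0 (g $ c)) \<le> 1 + t" if "C \<in> Chains rp" for C
      proof -
        have "(\<Sum>c\<in>C. max 0 (g $ c)) \<le> (\<Sum>c\<in>C. (1 + t) * a $ c)" by (intro sum_mono bd)
        also have "\<dots> = (1 + t) * (\<Sum>c\<in>C. a $ c)" by (simp add: sum_distrib_left)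
        also have "\<dots> \<le> 1 + t" using that ab(1) s by (intro mult_left_le) (auto simp: chain_polytope_def)
        finally show ?thesis .
      qed
      moreover have "(\<Sum>c\<in>C. max 0 (- g $ c)) \<le> 1 - t" if "C \<in> Chains rm" for C
      proof -
        have "(\<Sum>c\<in>C. max 0 (- g $ c)) \<le> (\<Sum>c\<in>C. (1 - t) * b $ c)" by (intro sum_mono bd)
        also have "\<dots> = (1 - t) * (\<Sum>c\<in>C. b $ c)" by (simp add: sum_distrib_left)
        also have "\<dots> \<le> 1 - t" using that ab(2) s by (intro mult_left_le) (auto simp: chain_polytope_def)
        finally show ?thesis .
      qed
      ultimately show ?r unfolding r by blast
    next
      assume ?r
      then have R: "\<And>C. C \<in> Chains rp \<Longrightarrow> (\<Sum>a\<in>C. max 0 (g $ a)) \<le> 1 + t"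
        "\<And>C. C \<in> Chains rm \<Longrightarrow> (\<Sum>a\<in>C. max 0 (- g $ a)) \<le> 1 - t" unfolding r by auto
      obtain a where a: "a \<in> chain_polytope rp" "(\<chi> c. max 0 (g $ c)) = (1 + t) *\<^sub>R a"
        using chain_polytope_scale[OF s(1), of "\<chi> c. max 0 (g $ c)" rp] R(1) assms(1) by auto
      obtain b where b: "b \<in> chain_polytope rm" "(\<chi> c. max 0 (- g $ c)) = (1 - t) *\<^sub>R b"
        using chain_polytope_scale[OF s(2), of "\<chi> c. max 0 (- g $ c)" rm] R(2) assms(2) by auto
      have "g = (\<chi> c. max 0 (g $ c)) - (\<chi> c. max 0 (- g $ c))" by (simp add: vec_eq_iff max_def)
      then have "g = (1 + t) *\<^sub>R a - (1 - t) *\<^sub>R b" using a b by simp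
      then show ?l using a(1) b(1) by blast
    qed
  qed
  then show ?thesis
    unfolding double_chain_polytope_def double_hull_iff[OF convex_chain_polytope ne convex_chain_polytope ne] by blast
qed

section \<open>Least decompositions and the correspondence of the two polytopes\<close>

context compatible_posets
begin

text \<open>Induction along \<open>L\<close>: the function that is tight at \<open>b\<close> is
  bounded by its competitor, which is monotone and by induction already dominates at the
  predecessors. Since the differences agree, the bound passes to the other function at
  \<open>b\<close>.\<close>

lemma tight_decomposition_least:
  assumes diff: "h1 - h2 = F1 - F2"
    and F: "\<And>a b. (a, b) \<in> rp \<Longrightarrow> 0 \<le> F1 $ a \<and> F1 $ a \<le> F1 $ b"
      "\<And>a b. (a, b) \<in> rm \<Longrightarrow> 0 \<le> F2 $ a \<and> F2 $ a \<le> F2 $ b"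
    and tight: "\<And>b. h1 $ b = pred_max rp h1 b \<or> h2 $ b = pred_max rm h2 b"
  shows "h1 $ b \<le> F1 $ b \<and> h2 $ b \<le> F2 $ b"
proof (induction b rule: L_induct)
  case (less b)
  have rf: "(b, b) \<in> rp" "(b, b) \<in> rm"
    using po_p po_m by (auto simp: partial_order_on_def preorder_on_def refl_on_def)
  have d: "h1 $ b - h2 $ b = F1 $ b - F2 $ b"
    using diff by (metis vector_minus_component)
  from tight[of b] show ?case
  proof
    assume h: "h1 $ b = pred_max rp h1 b"
    have "pred_max rp h1 b \<le> F1 $ b"
    proof (rule pred_max_le)
      show "0 \<le> F1 $ b" using F(1)[OF rf(1)] by simp
      fix a assume "(a, b) \<in> rp" "a \<noteq> b"
      then show "h1 $ a \<le> F1 $ b" using less[of a] F(1)[of a b] sub_p by fastforce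
    qed
    then show ?thesis using d h by simp
  next
    assume h: "h2 $ b = pred_max rm h2 b"
    have "pred_max rm h2 b \<le> F2 $ b"
    proof (rule pred_max_le)
      show "0 \<le> F2 $ b" using F(2)[OF rf(2)] by simp
      fix a assume "(a, b) \<in> rm" "a \<noteq> b"
      then show "h2 $ a \<le> F2 $ b" using less[of a] F(2)[of a b] sub_m by fastforce
    qed
    then show ?thesis using d h by simp
  qed
qed

text \<open>At most one of \<open>g $ b\<close> and \<open>- g $ b\<close> is positive, so one of
  the two summands \<open>max 0\<close> in \<open>nabla_rec\<close> vanishes.\<close>

lemma nabla_tight: "dn_p g $ b = pred_max rp (dn_p g) b \<or> dn_m g $ b = pred_max rm (dn_m g) b"
  using nabla_rec[OF po_p, of g b] nabla_rec[OF po_m, of "- g" b] by (cases "0 \<le> g $ b") auto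

text \<open>The two chain maxima are a decomposition of \<open>\<Psi> g\<close> into monotone
  functions. Being the least one, they satisfy the upper bounds as soon as any decomposition
  does.\<close>

lemma transfer_map_polytope_iff:
  "(g, t) \<in> double_chain_polytope rp rm \<longleftrightarrow> (\<Psi> g, t) \<in> double_order_polytope rp rm"
proof
  assume "(g, t) \<in> double_chain_polytope rp rm"
  then have g: "-1 \<le> t" "t \<le> 1" "\<forall>b. dn_p g $ b \<le> 1 + t" "\<forall>b. dn_m g $ b \<le> 1 - t"
    unfolding double_chain_polytope_iff[OF po_p po_m] by auto
  have "monotone_upto rp (1 + t) (dn_p g)" "monotone_upto rm (1 - t) (dn_m g)"
    using g(3,4) nabla_nonneg nabla_mono[OF po_p] nabla_mono[OF po_m] by (auto simp: monotone_upto_def)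
  then show "(\<Psi> g, t) \<in> double_order_polytope rp rm"
    unfolding double_order_polytope_iff[OF po_p po_m] Psi_def using g(1,2) by blast
next
  assume "(\<Psi> g, t) \<in> double_order_polytope rp rm"
  then obtain F1 F2 where F: "-1 \<le> t" "t \<le> 1" "\<Psi> g = F1 - F2" "monotone_upto rp (1 + t) F1"
    "monotone_upto rm (1 - t) F2"
    unfolding double_order_polytope_iff[OF po_p po_m] by blast
  have le: "dn_p g $ b \<le> F1 $ b \<and> dn_m g $ b \<le> F2 $ b" for b
    by (rule tight_decomposition_least)
      (use F nabla_tight in \<open>auto simp: Psi_def monotone_upto_def\<close>)
  have rf: "(b, b) \<in> rp" "(b, b) \<in> rm" for b
    using po_p po_m by (auto simp: partial_order_on_def preorder_on_def refl_on_def)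
  have "F1 $ b \<le> 1 + t" "F2 $ b \<le> 1 - t" for b
    using F(4,5) rf[of b] unfolding monotone_upto_def by blast+
  then show "(g, t) \<in> double_chain_polytope rp rm"
    unfolding double_chain_polytope_iff[OF po_p po_m] using F(1,2) le by (meson order_trans)
qed

lemma transfer_map_polytope:
  "transfer_map rp rm ` double_chain_polytope rp rm = double_order_polytope rp rm"
proof
  show "transfer_map rp rm ` double_chain_polytope rp rm \<subseteq> double_order_polytope rp rm"
    using transfer_map_polytope_iff by (auto simp: transfer_map_def)
  show "double_order_polytope rp rm \<subseteq> transfer_map rp rm ` double_chain_polytope rp rm"
  proof
    fix p assume p: "p \<in> double_order_polytope rp rm"
    obtain g where g: "\<Psi> g = fst p" using Psi_surj_Ints by blast
    then have "(g, snd p) \<in> double_chain_polytope rp rm" using p transfer_map_polytope_iff[of g "snd p"] by simp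
    moreover have "p = transfer_map rp rm (g, snd p)" using g by (simp add: transfer_map_eq)
    ultimately show "p \<in> transfer_map rp rm ` double_chain_polytope rp rm" by blast
  qed
qed

end

section \<open>Non-interfering chains of filters\<close>

text \<open>The functions \<open>x\<^sup>2\<close> and \<open>2 x - x\<^sup>2\<close> are monotone on \<open>[0, 1]\<close> with mean \<open>x\<close>, so an extreme point of
  the order polytope takes only the values \<open>0\<close> and \<open>1\<close>.\<close>

lemma extreme_point_order_polytope:
  assumes po: "partial_order_on UNIV r" and f: "f extreme_point_of order_polytope r"
  shows "f \<in> indicator_vec ` poset_filters r"
proof -
  have rf: "(x, x) \<in> r" for x
    using po by (simp add: partial_order_on_def preorder_on_def refl_on_def)
  have fO: "f \<in> order_polytope r" using f by (simp add: extreme_point_of_def)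
  then have mono: "f $ a \<le> f $ b" if "(a, b) \<in> r" for a b using that by (simp add: order_polytope_def)
  have bd: "0 \<le> f $ a" "f $ a \<le> 1" for a using fO rf[of a] by (auto simp: order_polytope_def)
  define p q where "p = (\<chi> a. (f $ a)\<^sup>2)" and "q = (\<chi> a. 2 * f $ a - (f $ a)\<^sup>2)"
  have "p \<in> order_polytope r"
    using mono bd by (auto simp: order_polytope_def p_def power_mono power_le_one)
  moreover have "q \<in> order_polytope r"
    unfolding order_polytope_def
  proof (clarify, intro conjI)
    fix a b assume ab: "(a, b) \<in> r"
    have "q $ a = 1 - (1 - f $ a)\<^sup>2" for a by (simp add: q_def power2_eq_square algebra_simps)
    moreover have "(1 - f $ b)\<^sup>2 \<le> (1 - f $ a)\<^sup>2" using mono[OF ab] bd[of b] by (intro power_mono) auto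
    moreover have "(1 - f $ a)\<^sup>2 \<le> 1" using bd[of a] by (intro power_le_one) auto
    ultimately show "0 \<le> q $ a" "q $ a \<le> q $ b" "q $ b \<le> 1" by auto
  qed
  moreover have "f = midpoint p q" by (simp add: midpoint_def p_def q_def vec_eq_iff)
  ultimately have "p = q"
    using f by (metis extreme_point_of_def midpoint_in_open_segment)
  then have "(f $ a)\<^sup>2 = 2 * f $ a - (f $ a)\<^sup>2" for a by (simp add: p_def q_def vec_eq_iff)
  then have "f $ a * (f $ a - 1) = 0" for a by (simp add: power2_eq_square algebra_simps)
  then have 01: "f $ a = 0 \<or> f $ a = 1" for a by (metis eq_iff_diff_eq_0 mult_eq_0_iff)
  define \<Phi> where "\<Phi> = {a. f $ a = 1}"
  have "f = indicator_vec \<Phi>" using 01 by (auto simp: vec_eq_iff indicator_vec_def \<Phi>_def indicator_def)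
  moreover have "\<Phi> \<in> poset_filters r"
    unfolding poset_filters_def \<Phi>_def
  proof clarify
    fix a b assume "f $ a = 1" "(a, b) \<in> r"
    then show "f $ b = 1" using mono[of a b] bd(2)[of b] by simp
  qed
  ultimately show ?thesis by blast
qed

lemma order_polytope_hull:
  assumes po: "partial_order_on UNIV r"
  shows "order_polytope r \<subseteq> convex hull (indicator_vec ` poset_filters r)"
proof -
  have rf: "(x, x) \<in> r" for x
    using po by (simp add: partial_order_on_def preorder_on_def refl_on_def)
  have eq: "order_polytope r = (\<Inter>(a, b)\<in>r. {f. 0 \<le> f $ a} \<inter> {f. f $ a \<le> f $ b} \<inter> {f. f $ b \<le> 1})"
    by (auto simp: order_polytope_def)
  have "closed (order_polytope r)"
    unfolding eq by (auto intro!: closed_INT closed_Int closed_Collect_le continuous_intros)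
  moreover have "bounded (order_polytope r)"
  proof (rule bounded_subset)
    show "order_polytope r \<subseteq> cbox 0 1" using rf unfolding order_polytope_def by (force simp: mem_box_cart)
  qed (rule bounded_cbox)
  ultimately have "compact (order_polytope r)" by (simp add: compact_eq_bounded_closed)
  then have "order_polytope r = convex hull {f. f extreme_point_of order_polytope r}"
    using convex_order_polytope by (rule Krein_Milman_Minkowski)
  also have "\<dots> \<subseteq> convex hull (indicator_vec ` poset_filters r)"
    using extreme_point_order_polytope[OF po] by (intro hull_mono) auto
  finally show ?thesis .
qed

text \<open>The combination of the indicator vectors of the filters with coefficients
  \<open>w\<close>, read coordinatewise; \<open>sum_indicator_vec\<close> states this.\<close>

definition level_function :: "'a::finite rel \<Rightarrow> ('a set \<Rightarrow> real) \<Rightarrow> real ^ 'a" where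
  "level_function r w = (\<chi> a. sum w {\<Phi> \<in> poset_filters r. a \<in> \<Phi>})"

lemma finite_chain_greatest:
  assumes "finite \<A>" "\<A> \<noteq> {}" "\<And>X Y. X \<in> \<A> \<Longrightarrow> Y \<in> \<A> \<Longrightarrow> X \<subseteq> Y \<or> Y \<subseteq> X"
  shows "\<exists>X\<in>\<A>. \<forall>Y\<in>\<A>. Y \<subseteq> X"
proof -
  obtain X where "X \<in> \<A>" "\<forall>Y\<in>\<A>. X \<subseteq> Y \<longrightarrow> X = Y"
    using finite_has_maximal[OF assms(1,2)] by blast
  then show ?thesis using assms(3) by blast
qed

lemma finite_chain_least:
  assumes "finite \<A>" "\<A> \<noteq> {}" "\<And>X Y. X \<in> \<A> \<Longrightarrow> Y \<in> \<A> \<Longrightarrow> X \<subseteq> Y \<or> Y \<subseteq> X"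
  shows "\<exists>X\<in>\<A>. \<forall>Y\<in>\<A>. X \<subseteq> Y"
proof -
  obtain X where "X \<in> \<A>" "\<forall>Y\<in>\<A>. Y \<subseteq> X \<longrightarrow> X = Y"
    using finite_has_minimal[OF assms(1,2)] by blast
  then show ?thesis using assms(3) by blast
qed

text \<open>For weights supported on a chain, the total weight of the sets containing \<open>A\<close> is the minimum over
  \<open>a \<in> A\<close> of the total weight of the sets containing \<open>a\<close>.\<close>

lemma chain_weight_attained:
  fixes w :: "'a::finite set \<Rightarrow> real"
  assumes nonneg: "\<And>\<Phi>. \<Phi> \<in> \<F> \<Longrightarrow> 0 \<le> w \<Phi>"
    and chain: "\<And>\<Phi> \<Phi>'. \<lbrakk>\<Phi> \<in> \<F>; \<Phi>' \<in> \<F>; w \<Phi> > 0; w \<Phi>' > 0\<rbrakk> \<Longrightarrow> \<Phi> \<subseteq> \<Phi>' \<or> \<Phi>' \<subseteq> \<Phi>"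
    and "A \<noteq> {}"
  shows "\<exists>a\<in>A. sum w {\<Phi> \<in> \<F>. a \<in> \<Phi>} = sum w {\<Phi> \<in> \<F>. A \<subseteq> \<Phi>}"
proof -
  let ?B = "{\<Phi> \<in> \<F>. w \<Phi> > 0 \<and> \<not> A \<subseteq> \<Phi>}"
  \<comment> \<open>Among the sets of positive weight that do not contain \<open>A\<close> there is
    a largest one, and an element of \<open>A\<close> outside it lies in none of them.\<close>
  have "\<exists>a\<in>A. \<forall>\<Phi>\<in>?B. a \<notin> \<Phi>"
  proof (cases "?B = {}")
    case True
    then show ?thesis using assms(3) by blast
  next
    case False
    then obtain \<Gamma> where "\<Gamma> \<in> ?B" "\<forall>\<Phi>\<in>?B. \<Phi> \<subseteq> \<Gamma>"
      using finite_chain_greatest[of ?B] chain by auto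
    then show ?thesis by blast
  qed
  then obtain a where a: "a \<in> A" "\<forall>\<Phi>\<in>?B. a \<notin> \<Phi>" by blast
  have "sum w {\<Phi> \<in> \<F>. a \<in> \<Phi>} = sum w {\<Phi> \<in> \<F>. A \<subseteq> \<Phi>}"
  proof (rule sum.mono_neutral_right)
    show "\<forall>\<Phi>\<in>{\<Phi> \<in> \<F>. a \<in> \<Phi>} - {\<Phi> \<in> \<F>. A \<subseteq> \<Phi>}. w \<Phi> = 0"
    proof
      fix \<Phi> assume p: "\<Phi> \<in> {\<Phi> \<in> \<F>. a \<in> \<Phi>} - {\<Phi> \<in> \<F>. A \<subseteq> \<Phi>}"
      then have "\<not> w \<Phi> > 0" using a(2) by blast
      then show "w \<Phi> = 0" using nonneg[of \<Phi>] p by auto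
    qed
  qed (use a in auto)
  then show ?thesis using a(1) by blast
qed

text \<open>The levels and the total weight determine the weight of all sets containing any given
  \<open>A\<close>, by \<open>chain_weight_attained\<close>. Single weights are recovered from these
  upper sums by induction, larger sets first.\<close>

lemma chain_weights_unique:
  fixes w w' :: "'a::finite set \<Rightarrow> real"
  assumes nonneg: "\<And>\<Phi>. \<Phi> \<in> \<F> \<Longrightarrow> 0 \<le> w \<Phi>" "\<And>\<Phi>. \<Phi> \<in> \<F> \<Longrightarrow> 0 \<le> w' \<Phi>"
    and chain: "\<And>\<Phi> \<Phi>'. \<lbrakk>\<Phi> \<in> \<F>; \<Phi>' \<in> \<F>; w \<Phi> > 0; w \<Phi>' > 0\<rbrakk> \<Longrightarrow> \<Phi> \<subseteq> \<Phi>' \<or> \<Phi>' \<subseteq> \<Phi>"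
      "\<And>\<Phi> \<Phi>'. \<lbrakk>\<Phi> \<in> \<F>; \<Phi>' \<in> \<F>; w' \<Phi> > 0; w' \<Phi>' > 0\<rbrakk> \<Longrightarrow> \<Phi> \<subseteq> \<Phi>' \<or> \<Phi>' \<subseteq> \<Phi>"
    and total: "sum w \<F> = sum w' \<F>"
    and levels: "\<And>a. sum w {\<Phi> \<in> \<F>. a \<in> \<Phi>} = sum w' {\<Phi> \<in> \<F>. a \<in> \<Phi>}"
  shows "\<Phi> \<in> \<F> \<Longrightarrow> w \<Phi> = w' \<Phi>"
proof -
  have le: "sum w {\<Phi> \<in> \<F>. A \<subseteq> \<Phi>} \<le> sum w {\<Phi> \<in> \<F>. a \<in> \<Phi>}"
    "sum w' {\<Phi> \<in> \<F>. A \<subseteq> \<Phi>} \<le> sum w' {\<Phi> \<in> \<F>. a \<in> \<Phi>}" if "a \<in> A" for a A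
    using that nonneg by (auto intro!: sum_mono2)
  have N: "sum w {\<Phi> \<in> \<F>. A \<subseteq> \<Phi>} = sum w' {\<Phi> \<in> \<F>. A \<subseteq> \<Phi>}" for A
  proof (cases "A = {}")
    case True
    then show ?thesis using total by simp
  next
    case False
    obtain a where a: "a \<in> A" "sum w {\<Phi> \<in> \<F>. a \<in> \<Phi>} = sum w {\<Phi> \<in> \<F>. A \<subseteq> \<Phi>}"
      using chain_weight_attained[of \<F> w A] nonneg(1) chain(1) False by blast
    obtain a' where a': "a' \<in> A" "sum w' {\<Phi> \<in> \<F>. a' \<in> \<Phi>} = sum w' {\<Phi> \<in> \<F>. A \<subseteq> \<Phi>}"
      using chain_weight_attained[of \<F> w' A] nonneg(2) chain(2) False by blast
    show ?thesis using le(1)[OF a'(1)] le(2)[OF a(1)] a(2) a'(2) levels[of a] levels[of a'] by linarith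
  qed
  show "w \<Phi> = w' \<Phi>" if "\<Phi> \<in> \<F>" for \<Phi>
    using that
  proof (induction "card (- \<Phi>)" arbitrary: \<Phi> rule: less_induct)
    case less
    have split: "{\<Gamma> \<in> \<F>. \<Phi> \<subseteq> \<Gamma>} = insert \<Phi> {\<Gamma> \<in> \<F>. \<Phi> \<subset> \<Gamma>}" using less.prems by auto
    have "w \<Gamma> = w' \<Gamma>" if "\<Gamma> \<in> \<F>" "\<Phi> \<subset> \<Gamma>" for \<Gamma>
      using that by (intro less.hyps psubset_card_mono) auto
    then have "sum w {\<Gamma> \<in> \<F>. \<Phi> \<subset> \<Gamma>} = sum w' {\<Gamma> \<in> \<F>. \<Phi> \<subset> \<Gamma>}" by (intro sum.cong) auto
    then show ?case using N[of \<Phi>] unfolding split by simp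
  qed
qed

lemma level_function_mono:
  assumes "\<And>\<Phi>. \<Phi> \<in> poset_filters r \<Longrightarrow> 0 \<le> w \<Phi>" "(a, b) \<in> r"
  shows "0 \<le> level_function r w $ a \<and> level_function r w $ a \<le> level_function r w $ b"
  using assms by (auto simp: level_function_def poset_filters_def intro!: sum_nonneg sum_mono2)

text \<open>The smallest filter of positive weight containing \<open>b\<close> also contains some
  strict predecessor \<open>a\<close> of \<open>b\<close>. Every other such filter contains it, so
  the level at \<open>a\<close> is at least the level at \<open>b\<close>.\<close>

lemma level_function_tight:
  assumes nonneg: "\<And>\<Phi>. \<Phi> \<in> poset_filters r \<Longrightarrow> 0 \<le> w \<Phi>"
    and chain: "\<And>\<Phi> \<Phi>'. \<lbrakk>\<Phi> \<in> poset_filters r; \<Phi>' \<in> poset_filters r; w \<Phi> > 0; w \<Phi>' > 0\<rbrakk> \<Longrightarrow> \<Phi> \<subseteq> \<Phi>' \<or> \<Phi>' \<subseteq> \<Phi>"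
    and not_min: "\<And>\<Phi>. \<lbrakk>\<Phi> \<in> poset_filters r; w \<Phi> > 0\<rbrakk> \<Longrightarrow> b \<notin> min_elements r \<Phi>"
    and rf: "(b, b) \<in> r"
  shows "level_function r w $ b = pred_max r (level_function r w) b"
proof (rule antisym)
  let ?h = "level_function r w"
  show "pred_max r ?h b \<le> ?h $ b"
    using level_function_mono[of r w, OF nonneg] rf by (intro pred_max_le) auto
  let ?B = "{\<Phi> \<in> poset_filters r. w \<Phi> > 0 \<and> b \<in> \<Phi>}"
  have hb: "?h $ b = sum w ?B"
    unfolding level_function_def by (simp, rule sum.mono_neutral_right) (use nonneg in \<open>auto simp: order_le_less\<close>)
  show "?h $ b \<le> pred_max r ?h b"
  proof (cases "?B = {}")
    case True
    then show ?thesis unfolding hb True by (simp add: pred_max_nonneg)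
  next
    case False
    then obtain \<Gamma> where \<Gamma>: "\<Gamma> \<in> ?B" "\<forall>\<Phi>\<in>?B. \<Gamma> \<subseteq> \<Phi>"
      using finite_chain_least[of ?B] chain by auto
    then have "b \<notin> min_elements r \<Gamma>" using not_min by auto
    then obtain a where a: "a \<in> \<Gamma>" "(a, b) \<in> r" "a \<noteq> b" using \<Gamma>(1) by (auto simp: min_elements_def)
    have "?B \<subseteq> {\<Phi> \<in> poset_filters r. a \<in> \<Phi>}" using \<Gamma>(2) a(1) by blast
    then have "sum w ?B \<le> sum w {\<Phi> \<in> poset_filters r. a \<in> \<Phi>}" using nonneg by (intro sum_mono2) auto
    then have "?h $ b \<le> ?h $ a" unfolding hb by (simp add: level_function_def)
    also have "\<dots> \<le> pred_max r ?h b" using a by (intro pred_max_ge)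
    finally show ?thesis .
  qed
qed

text \<open>The right side exceeds the left by twice the product of the cardinalities of the two set
  differences.\<close>

lemma card_Un_Int_square:
  assumes "finite A" "finite B" "\<not> A \<subseteq> B" "\<not> B \<subseteq> A"
  shows "(real (card A))\<^sup>2 + (real (card B))\<^sup>2 < (real (card (A \<union> B)))\<^sup>2 + (real (card (A \<inter> B)))\<^sup>2"
proof -
  have "card (A \<inter> B) < card A" "card (A \<inter> B) < card B"
    using assms by (auto intro!: psubset_card_mono)
  then have "0 < (real (card A) - card (A \<inter> B)) * (real (card B) - card (A \<inter> B))" by simp
  moreover have un: "real (card (A \<union> B)) = real (card A) + card B - card (A \<inter> B)"
    using card_Un_Int[OF assms(1,2)] by simp
  ultimately show ?thesis unfolding un by (simp only: power2_eq_square) (simp add: algebra_simps)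
qed

section \<open>Vertices of the double order polytope and their exchanges\<close>

definition vert_p :: "'a::finite set \<Rightarrow> (real ^ 'a) \<times> real" where
  "vert_p \<Phi> = (2 *\<^sub>R indicator_vec \<Phi>, 1)"

definition vert_m :: "'a::finite set \<Rightarrow> (real ^ 'a) \<times> real" where
  "vert_m \<Phi> = ((-2) *\<^sub>R indicator_vec \<Phi>, -1)"

text \<open>The zero set of the first component is the complement of the filter on either side, so
  one formula serves \<open>vert_p\<close> and \<open>vert_m\<close>.\<close>

definition vert_height :: "(real ^ 'a::finite) \<times> real \<Rightarrow> real" where
  "vert_height p = - (real (card {a. fst p $ a = 0}))\<^sup>2"

lemma indicator_vec_inj: "indicator_vec \<Phi> = indicator_vec \<Gamma> \<longleftrightarrow> \<Phi> = \<Gamma>"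
  by (auto simp: indicator_vec_def vec_eq_iff indicator_def split: if_splits)

lemma vert_inj [simp]: "vert_p \<Phi> = vert_p \<Gamma> \<longleftrightarrow> \<Phi> = \<Gamma>" "vert_m \<Phi> = vert_m \<Gamma> \<longleftrightarrow> \<Phi> = \<Gamma>"
  "vert_p \<Phi> \<noteq> vert_m \<Gamma>" "vert_m \<Gamma> \<noteq> vert_p \<Phi>"
  by (auto simp: vert_p_def vert_m_def indicator_vec_inj)

lemma vert_height [simp]: "vert_height (vert_p \<Phi>) = - (real (card (- \<Phi>)))\<^sup>2"
  "vert_height (vert_m \<Phi>) = - (real (card (- \<Phi>)))\<^sup>2"
proof -
  have "{a. fst (vert_p \<Phi>) $ a = 0} = - \<Phi>" "{a. fst (vert_m \<Phi>) $ a = 0} = - \<Phi>"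
    by (auto simp: vert_p_def vert_m_def indicator_vec_def indicator_def)
  then show "vert_height (vert_p \<Phi>) = - (real (card (- \<Phi>)))\<^sup>2"
    "vert_height (vert_m \<Phi>) = - (real (card (- \<Phi>)))\<^sup>2" by (simp_all add: vert_height_def)
qed

lemma vert_Un_Int: "vert_p (\<Phi> \<inter> \<Gamma>) + vert_p (\<Phi> \<union> \<Gamma>) = vert_p \<Phi> + vert_p \<Gamma>"
  "vert_m (\<Phi> \<inter> \<Gamma>) + vert_m (\<Phi> \<union> \<Gamma>) = vert_m \<Phi> + vert_m \<Gamma>"
  by (auto simp: vert_p_def vert_m_def vec_eq_iff indicator_vec_def indicator_def)

lemma vert_remove:
  assumes "b \<in> \<Phi>" "b \<in> \<Gamma>"
  shows "vert_p (\<Phi> - {b}) + vert_m (\<Gamma> - {b}) = vert_p \<Phi> + vert_m \<Gamma>"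
proof -
  have "indicator_vec (\<Phi> - {b}) - indicator_vec (\<Gamma> - {b}) = indicator_vec \<Phi> - indicator_vec \<Gamma>"
    using assms by (auto simp: vec_eq_iff indicator_vec_def indicator_def)
  then show ?thesis by (simp add: vert_p_def vert_m_def flip: scaleR_diff_right)
qed

lemma filter_Un_Int:
  assumes "\<Phi> \<in> poset_filters r" "\<Gamma> \<in> poset_filters r"
  shows "\<Phi> \<inter> \<Gamma> \<in> poset_filters r" "\<Phi> \<union> \<Gamma> \<in> poset_filters r"
  using assms by (auto simp: poset_filters_def)

lemma filter_remove_min:
  assumes "\<Phi> \<in> poset_filters r" "b \<in> min_elements r \<Phi>"
  shows "\<Phi> - {b} \<in> poset_filters r"
  using assms by (auto simp: poset_filters_def min_elements_def)

section \<open>Non-interfering pairs of chains as cliques\<close>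

context compatible_posets
begin

definition verts :: "((real ^ 'a) \<times> real) set" where
  "verts = vert_p ` poset_filters rp \<union> vert_m ` poset_filters rm"

text \<open>Defined on all points by quantifying over their presentations as vertices, so that
  reflexivity holds everywhere, as \<open>flag_rewriting\<close> demands. The doubleton covers both
  orders of a mixed pair.\<close>

definition compat :: "(real ^ 'a) \<times> real \<Rightarrow> (real ^ 'a) \<times> real \<Rightarrow> bool" where
  "compat v w \<longleftrightarrow>
    (\<forall>\<Phi> \<Gamma>. v = vert_p \<Phi> \<longrightarrow> w = vert_p \<Gamma> \<longrightarrow> \<Phi> \<subseteq> \<Gamma> \<or> \<Gamma> \<subseteq> \<Phi>) \<and>
    (\<forall>\<Phi> \<Gamma>. v = vert_m \<Phi> \<longrightarrow> w = vert_m \<Gamma> \<longrightarrow> \<Phi> \<subseteq> \<Gamma> \<or> \<Gamma> \<subseteq> \<Phi>) \<and>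
    (\<forall>\<Phi> \<Gamma>. {v, w} = {vert_p \<Phi>, vert_m \<Gamma>} \<longrightarrow> min_elements rp \<Phi> \<inter> min_elements rm \<Gamma> = {})"

lemma compat_iff [simp]:
  "compat (vert_p \<Phi>) (vert_p \<Phi>') \<longleftrightarrow> \<Phi> \<subseteq> \<Phi>' \<or> \<Phi>' \<subseteq> \<Phi>"
  "compat (vert_m \<Gamma>) (vert_m \<Gamma>') \<longleftrightarrow> \<Gamma> \<subseteq> \<Gamma>' \<or> \<Gamma>' \<subseteq> \<Gamma>"
  "compat (vert_p \<Phi>) (vert_m \<Gamma>) \<longleftrightarrow> min_elements rp \<Phi> \<inter> min_elements rm \<Gamma> = {}"
  "compat (vert_m \<Gamma>) (vert_p \<Phi>) \<longleftrightarrow> min_elements rp \<Phi> \<inter> min_elements rm \<Gamma> = {}"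
  by (simp_all add: compat_def doubleton_eq_iff)

lemma sum_verts: "sum f verts = (\<Sum>\<Phi>\<in>poset_filters rp. f (vert_p \<Phi>)) + (\<Sum>\<Gamma>\<in>poset_filters rm. f (vert_m \<Gamma>))"
proof -
  have "inj_on vert_p A" "inj_on vert_m A" for A :: "'a set set" by (auto simp: inj_on_def)
  moreover have "vert_p ` poset_filters rp \<inter> vert_m ` poset_filters rm = {}" by auto
  ultimately show ?thesis unfolding verts_def by (simp add: sum.union_disjoint sum.reindex)
qed

abbreviation "lev_p u \<equiv> level_function rp (\<lambda>\<Phi>. u (vert_p \<Phi>))"
abbreviation "lev_m u \<equiv> level_function rm (\<lambda>\<Gamma>. u (vert_m \<Gamma>))"

lemma sum_indicator_vec: "(\<Sum>\<Phi>\<in>poset_filters r. w \<Phi> *\<^sub>R indicator_vec \<Phi>) = level_function r w"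
proof -
  have "(\<Sum>\<Phi>\<in>poset_filters r. w \<Phi> * indicator \<Phi> a) = (\<Sum>\<Phi>\<in>poset_filters r. if a \<in> \<Phi> then w \<Phi> else 0)" for a
    by (intro sum.cong) (auto simp: indicator_def)
  then have "(\<Sum>\<Phi>\<in>poset_filters r. w \<Phi> * indicator \<Phi> a) = sum w {\<Phi> \<in> poset_filters r. a \<in> \<Phi>}" for a
    by (simp add: sum.inter_filter)
  then show ?thesis by (simp add: vec_eq_iff level_function_def indicator_vec_def)
qed

lemma point_verts: "(\<Sum>v\<in>verts. u v *\<^sub>R v) =
  (2 *\<^sub>R (lev_p u - lev_m u), (\<Sum>\<Phi>\<in>poset_filters rp. u (vert_p \<Phi>)) - (\<Sum>\<Gamma>\<in>poset_filters rm. u (vert_m \<Gamma>)))"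
proof -
  have "(\<Sum>\<Phi>\<in>poset_filters rp. u (vert_p \<Phi>) *\<^sub>R vert_p \<Phi>) = (2 *\<^sub>R lev_p u, \<Sum>\<Phi>\<in>poset_filters rp. u (vert_p \<Phi>))"
    by (simp add: prod_eq_iff fst_sum snd_sum vert_p_def sum_indicator_vec[symmetric] scaleR_sum_right mult.commute)
  moreover have "(\<Sum>\<Gamma>\<in>poset_filters rm. u (vert_m \<Gamma>) *\<^sub>R vert_m \<Gamma>) = (- (2 *\<^sub>R lev_m u), - (\<Sum>\<Gamma>\<in>poset_filters rm. u (vert_m \<Gamma>)))"
    by (simp add: prod_eq_iff fst_sum snd_sum vert_m_def sum_indicator_vec[symmetric] scaleR_sum_right mult.commute sum_negf)
  ultimately show ?thesis by (simp add: sum_verts scaleR_diff_right)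
qed

lemma vert_in_verts:
  "\<Phi> \<in> poset_filters rp \<Longrightarrow> vert_p \<Phi> \<in> verts" "\<Gamma> \<in> poset_filters rm \<Longrightarrow> vert_m \<Gamma> \<in> verts"
  by (auto simp: verts_def)

lemma compat_chains:
  assumes "\<And>v w. \<lbrakk>v \<in> verts; w \<in> verts; u v > 0; u w > 0\<rbrakk> \<Longrightarrow> compat v w"
  shows "\<lbrakk>\<Phi> \<in> poset_filters rp; \<Phi>' \<in> poset_filters rp; u (vert_p \<Phi>) > 0; u (vert_p \<Phi>') > 0\<rbrakk> \<Longrightarrow> \<Phi> \<subseteq> \<Phi>' \<or> \<Phi>' \<subseteq> \<Phi>"
    and "\<lbrakk>\<Gamma> \<in> poset_filters rm; \<Gamma>' \<in> poset_filters rm; u (vert_m \<Gamma>) > 0; u (vert_m \<Gamma>') > 0\<rbrakk> \<Longrightarrow> \<Gamma> \<subseteq> \<Gamma>' \<or> \<Gamma>' \<subseteq> \<Gamma>"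
  using assms[of "vert_p \<Phi>" "vert_p \<Phi>'"] assms[of "vert_m \<Gamma>" "vert_m \<Gamma>'"] by (auto simp: vert_in_verts)

text \<open>If \<open>b\<close> is minimal in some filter of positive weight on the plus side,
  non-interference keeps it from being minimal in any on the minus side, and \<open>lev_m\<close> is
  tight at \<open>b\<close>; otherwise \<open>lev_p\<close> is.\<close>

lemma levels_tight:
  assumes nonneg: "\<And>v. v \<in> verts \<Longrightarrow> 0 \<le> u v"
    and supp: "\<And>v w. \<lbrakk>v \<in> verts; w \<in> verts; u v > 0; u w > 0\<rbrakk> \<Longrightarrow> compat v w"
  shows "lev_p u $ b = pred_max rp (lev_p u) b \<or> lev_m u $ b = pred_max rm (lev_m u) b"
proof -
  have rf: "(b, b) \<in> rp" "(b, b) \<in> rm"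
    using po_p po_m by (auto simp: partial_order_on_def preorder_on_def refl_on_def)
  show ?thesis
  proof (cases "\<exists>\<Phi>\<in>poset_filters rp. u (vert_p \<Phi>) > 0 \<and> b \<in> min_elements rp \<Phi>")
    case True
    then obtain \<Phi> where \<Phi>: "\<Phi> \<in> poset_filters rp" "u (vert_p \<Phi>) > 0" "b \<in> min_elements rp \<Phi>" by blast
    have not_min: "b \<notin> min_elements rm \<Gamma>" if "\<Gamma> \<in> poset_filters rm" "u (vert_m \<Gamma>) > 0" for \<Gamma>
      using supp[of "vert_p \<Phi>" "vert_m \<Gamma>"] \<Phi> that by (auto simp: vert_in_verts)
    show ?thesis
      by (rule disjI2, rule level_function_tight[OF _ compat_chains(2)[of u, OF supp] not_min rf(2)])
        (simp_all add: nonneg vert_in_verts)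
  next
    case False
    then have not_min: "b \<notin> min_elements rp \<Phi>" if "\<Phi> \<in> poset_filters rp" "u (vert_p \<Phi>) > 0" for \<Phi>
      using that by blast
    show ?thesis
      by (rule disjI1, rule level_function_tight[OF _ compat_chains(1)[of u, OF supp] not_min rf(1)])
        (simp_all add: nonneg vert_in_verts)
  qed
qed

text \<open>Both pairs of level functions are tight decompositions of the same vector, hence each is
  below the other. The last coordinate and the total weight fix the mass on each side, and then the
  weights on each chain follow.\<close>

lemma verts_weights_unique:
  assumes nonneg: "\<And>v. v \<in> verts \<Longrightarrow> 0 \<le> u v" "\<And>v. v \<in> verts \<Longrightarrow> 0 \<le> u' v"
    and total: "sum u verts = 1" "sum u' verts = 1"
    and point: "(\<Sum>v\<in>verts. u v *\<^sub>R v) = (\<Sum>v\<in>verts. u' v *\<^sub>R v)"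
    and supp: "\<And>v w. \<lbrakk>v \<in> verts; w \<in> verts; u v > 0; u w > 0\<rbrakk> \<Longrightarrow> compat v w"
      "\<And>v w. \<lbrakk>v \<in> verts; w \<in> verts; u' v > 0; u' w > 0\<rbrakk> \<Longrightarrow> compat v w"
    and "z \<in> verts"
  shows "u z = u' z"
proof -
  have diff: "lev_p u - lev_m u = lev_p u' - lev_m u'" using point by (simp add: point_verts)
  have sums: "(\<Sum>\<Phi>\<in>poset_filters rp. u (vert_p \<Phi>)) = (\<Sum>\<Phi>\<in>poset_filters rp. u' (vert_p \<Phi>))"
    "(\<Sum>\<Phi>\<in>poset_filters rm. u (vert_m \<Phi>)) = (\<Sum>\<Phi>\<in>poset_filters rm. u' (vert_m \<Phi>))"
    using point total by (auto simp: point_verts sum_verts)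
  have mono: "0 \<le> lev_p x $ a \<and> lev_p x $ a \<le> lev_p x $ b" if "(a, b) \<in> rp" "\<And>v. v \<in> verts \<Longrightarrow> 0 \<le> x v" for a b x
    using that by (intro level_function_mono) (auto simp: vert_in_verts)
  have mono': "0 \<le> lev_m x $ a \<and> lev_m x $ a \<le> lev_m x $ b" if "(a, b) \<in> rm" "\<And>v. v \<in> verts \<Longrightarrow> 0 \<le> x v" for a b x
    using that by (intro level_function_mono) (auto simp: vert_in_verts)
  have "lev_p u $ b \<le> lev_p u' $ b \<and> lev_m u $ b \<le> lev_m u' $ b" for b
    by (rule tight_decomposition_least[OF diff]) (use mono mono' nonneg levels_tight[of u] supp in auto)
  moreover have "lev_p u' $ b \<le> lev_p u $ b \<and> lev_m u' $ b \<le> lev_m u $ b" for b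
    by (rule tight_decomposition_least[OF diff[symmetric]]) (use mono mono' nonneg levels_tight[of u'] supp in auto)
  ultimately have lev: "lev_p u $ b = lev_p u' $ b" "lev_m u $ b = lev_m u' $ b" for b
    by (meson order_antisym)+
  have levels: "sum (\<lambda>\<Phi>. u (vert_p \<Phi>)) {\<Phi> \<in> poset_filters rp. b \<in> \<Phi>} = sum (\<lambda>\<Phi>. u' (vert_p \<Phi>)) {\<Phi> \<in> poset_filters rp. b \<in> \<Phi>}"
    "sum (\<lambda>\<Phi>. u (vert_m \<Phi>)) {\<Phi> \<in> poset_filters rm. b \<in> \<Phi>} = sum (\<lambda>\<Phi>. u' (vert_m \<Phi>)) {\<Phi> \<in> poset_filters rm. b \<in> \<Phi>}" for b
    using lev[of b] by (simp_all add: level_function_def)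
  have "u (vert_p \<Phi>) = u' (vert_p \<Phi>)" if "\<Phi> \<in> poset_filters rp" for \<Phi>
    by (rule chain_weights_unique[OF _ _ compat_chains(1)[of u, OF supp(1)] compat_chains(1)[of u', OF supp(2)] sums(1) levels(1) that])
      (simp_all add: nonneg vert_in_verts)
  moreover have "u (vert_m \<Phi>) = u' (vert_m \<Phi>)" if "\<Phi> \<in> poset_filters rm" for \<Phi>
    by (rule chain_weights_unique[OF _ _ compat_chains(2)[of u, OF supp(1)] compat_chains(2)[of u', OF supp(2)] sums(2) levels(2) that])
      (simp_all add: nonneg vert_in_verts)
  ultimately show ?thesis using \<open>z \<in> verts\<close> by (auto simp: verts_def)
qed

lemma verts_rewrite:
  assumes "v \<in> verts" "w \<in> verts" "\<not> compat v w"
  shows "\<exists>v'\<in>verts. \<exists>w'\<in>verts. v' + w' = v + w \<and> vert_height v' + vert_height w' < vert_height v + vert_height w"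
proof -
  have chain: "- (real (card (- (\<Phi> \<inter> \<Gamma>))))\<^sup>2 + - (real (card (- (\<Phi> \<union> \<Gamma>))))\<^sup>2
      < - (real (card (- \<Phi>)))\<^sup>2 + - (real (card (- \<Gamma>)))\<^sup>2"
    if "\<not> \<Phi> \<subseteq> \<Gamma>" "\<not> \<Gamma> \<subseteq> \<Phi>" for \<Phi> \<Gamma> :: "'a set"
    using card_Un_Int_square[of "- \<Phi>" "- \<Gamma>"] that by (simp add: Compl_Int Compl_Un)
  have interfering: "\<exists>v'\<in>verts. \<exists>w'\<in>verts. v' + w' = vert_p \<Phi> + vert_m \<Gamma> \<and>
      vert_height v' + vert_height w' < - (real (card (- \<Phi>)))\<^sup>2 - (real (card (- \<Gamma>)))\<^sup>2"
    if "\<Phi> \<in> poset_filters rp" "\<Gamma> \<in> poset_filters rm" "b \<in> min_elements rp \<Phi>" "b \<in> min_elements rm \<Gamma>" for \<Phi> \<Gamma> b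
  proof (rule bexI[of _ "vert_p (\<Phi> - {b})"], rule bexI[of _ "vert_m (\<Gamma> - {b})"], rule conjI)
    show "vert_p (\<Phi> - {b}) \<in> verts" "vert_m (\<Gamma> - {b}) \<in> verts"
      using filter_remove_min[OF that(1,3)] filter_remove_min[OF that(2,4)] by (auto simp: verts_def)
    have b: "b \<in> \<Phi>" "b \<in> \<Gamma>" using that by (auto simp: min_elements_def)
    then show "vert_p (\<Phi> - {b}) + vert_m (\<Gamma> - {b}) = vert_p \<Phi> + vert_m \<Gamma>" by (rule vert_remove)
    have "card (- (X - {b})) = card (- X) + 1" if "b \<in> X" for X
    proof -
      have "- (X - {b}) = insert b (- X)" by auto
      then show ?thesis using that by simp
    qed
    then show "vert_height (vert_p (\<Phi> - {b})) + vert_height (vert_m (\<Gamma> - {b}))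
        < - (real (card (- \<Phi>)))\<^sup>2 - (real (card (- \<Gamma>)))\<^sup>2"
      using b by (simp add: power2_eq_square algebra_simps)
  qed
  consider (pp) \<Phi> \<Gamma> where "\<Phi> \<in> poset_filters rp" "\<Gamma> \<in> poset_filters rp" "v = vert_p \<Phi>" "w = vert_p \<Gamma>"
    | (mm) \<Phi> \<Gamma> where "\<Phi> \<in> poset_filters rm" "\<Gamma> \<in> poset_filters rm" "v = vert_m \<Phi>" "w = vert_m \<Gamma>"
    | (pm) \<Phi> \<Gamma> where "\<Phi> \<in> poset_filters rp" "\<Gamma> \<in> poset_filters rm" "v = vert_p \<Phi>" "w = vert_m \<Gamma>"
    | (mp) \<Phi> \<Gamma> where "\<Phi> \<in> poset_filters rp" "\<Gamma> \<in> poset_filters rm" "w = vert_p \<Phi>" "v = vert_m \<Gamma>"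
    using assms(1,2) by (auto simp: verts_def)
  then show ?thesis
  proof cases
    case pp
    then show ?thesis
      using assms(3) chain[of \<Phi> \<Gamma>] vert_Un_Int(1)[of \<Phi> \<Gamma>] filter_Un_Int[of \<Phi> rp \<Gamma>]
      by (intro bexI[of _ "vert_p (\<Phi> \<inter> \<Gamma>)"] bexI[of _ "vert_p (\<Phi> \<union> \<Gamma>)"]) (auto simp: verts_def)
  next
    case mm
    then show ?thesis
      using assms(3) chain[of \<Phi> \<Gamma>] vert_Un_Int(2)[of \<Phi> \<Gamma>] filter_Un_Int[of \<Phi> rm \<Gamma>]
      by (intro bexI[of _ "vert_m (\<Phi> \<inter> \<Gamma>)"] bexI[of _ "vert_m (\<Phi> \<union> \<Gamma>)"]) (auto simp: verts_def)
  next
    case pm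
    then obtain b where "b \<in> min_elements rp \<Phi>" "b \<in> min_elements rm \<Gamma>" using assms(3) by auto
    then show ?thesis using interfering[OF pm(1,2)] pm by simp
  next
    case mp
    then obtain b where "b \<in> min_elements rp \<Phi>" "b \<in> min_elements rm \<Gamma>" using assms(3) by auto
    then have "\<exists>v'\<in>verts. \<exists>w'\<in>verts. v' + w' = w + v \<and> vert_height v' + vert_height w' < vert_height w + vert_height v"
      using interfering[OF mp(1,2)] mp by simp
    then show ?thesis by (simp only: add.commute[of w v] add.commute[of "vert_height w" "vert_height v"])
  qed
qed

sublocale flag_rewriting verts compat vert_height
proof
  show "finite verts" by (simp add: verts_def)
  have "UNIV \<in> poset_filters rp" by (simp add: poset_filters_def)
  then show "verts \<noteq> {}" by (auto simp: verts_def)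
  show "compat v v" for v unfolding compat_def by auto
qed (fact verts_rewrite verts_weights_unique)+

lemma hull_verts: "convex hull verts = double_order_polytope rp rm"
proof
  have ind: "indicator_vec \<Phi> \<in> order_polytope r" if "\<Phi> \<in> poset_filters r" for r :: "'a rel" and \<Phi>
    using that by (auto simp: order_polytope_def indicator_vec_def poset_filters_def indicator_def)
  have "verts \<subseteq> double_order_polytope rp rm"
    unfolding double_order_polytope_def
    by (rule order_trans[OF _ hull_subset]) (auto simp: verts_def vert_p_def vert_m_def intro!: imageI ind)
  then show "convex hull verts \<subseteq> double_order_polytope rp rm"
    by (simp add: double_order_polytope_def subset_hull)
  \<comment> \<open>The map taking \<open>f\<close> to \<open>(s *\<^sub>R f, t)\<close> is only
    affine, so it is split into a linear map and a translation to commute with hulls.\<close>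
  have hull: "(s *\<^sub>R f, t) \<in> convex hull ((\<lambda>\<Phi>. (s *\<^sub>R indicator_vec \<Phi>, t)) ` poset_filters r)"
    if "f \<in> order_polytope r" "partial_order_on UNIV r" for f s and t :: real and r :: "'a rel"
  proof -
    have lin: "linear (\<lambda>f :: real ^ 'a. (s *\<^sub>R f, 0 :: real))" by (intro linearI) (auto simp: algebra_simps)
    have "(s *\<^sub>R f, 0) \<in> (\<lambda>f. (s *\<^sub>R f, 0 :: real)) ` (convex hull (indicator_vec ` poset_filters r))"
      using order_polytope_hull[OF that(2)] that(1) by blast
    then have "(s *\<^sub>R f, 0) \<in> convex hull ((\<lambda>f. (s *\<^sub>R f, 0 :: real)) ` indicator_vec ` poset_filters r)"
      by (simp add: convex_hull_linear_image[OF lin])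
    then have "(0, t) + (s *\<^sub>R f, 0) \<in> convex hull ((\<lambda>x. (0, t) + x) ` (\<lambda>f. (s *\<^sub>R f, 0 :: real)) ` indicator_vec ` poset_filters r)"
      by (subst convex_hull_translation) (rule imageI)
    then show ?thesis by (simp add: image_image)
  qed
  have "(2 *\<^sub>R f, 1) \<in> convex hull verts" if "f \<in> order_polytope rp" for f
    using hull[OF that po_p, of 2 1] hull_mono[of "vert_p ` poset_filters rp" verts convex]
    unfolding verts_def vert_p_def by blast
  moreover have "((-2) *\<^sub>R f, -1) \<in> convex hull verts" if "f \<in> order_polytope rm" for f
    using hull[OF that po_m, of "-2" "-1"] hull_mono[of "vert_m ` poset_filters rm" verts convex]
    unfolding verts_def vert_m_def by blast
  ultimately show "double_order_polytope rp rm \<subseteq> convex hull verts"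
    unfolding double_order_polytope_def by (intro hull_minimal) auto
qed

lemma cliques_iff: "S \<in> cliques \<longleftrightarrow>
  (\<exists>Cp Cm. filter_chain rp Cp \<and> filter_chain rm Cm \<and> non_interfering rp rm Cp Cm \<and> S = vert_p ` Cp \<union> vert_m ` Cm)"
proof
  assume S: "S \<in> cliques"
  then have sub: "S \<subseteq> verts" and comp: "\<And>v w. v \<in> S \<Longrightarrow> w \<in> S \<Longrightarrow> compat v w" by (auto simp: cliques_def)
  define Cp Cm where "Cp = {\<Phi>. vert_p \<Phi> \<in> S}" and "Cm = {\<Gamma>. vert_m \<Gamma> \<in> S}"
  have "S = vert_p ` Cp \<union> vert_m ` Cm" using sub by (auto simp: Cp_def Cm_def verts_def)
  moreover have "filter_chain rp Cp"
    using sub comp[of "vert_p _" "vert_p _"] by (auto simp: filter_chain_def Cp_def verts_def chain_subset_def)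
  moreover have "filter_chain rm Cm"
    using sub comp[of "vert_m _" "vert_m _"] by (auto simp: filter_chain_def Cm_def verts_def chain_subset_def)
  moreover have "non_interfering rp rm Cp Cm"
    using comp[of "vert_p _" "vert_m _"] by (auto simp: non_interfering_def Cp_def Cm_def)
  ultimately show "\<exists>Cp Cm. filter_chain rp Cp \<and> filter_chain rm Cm \<and> non_interfering rp rm Cp Cm \<and> S = vert_p ` Cp \<union> vert_m ` Cm"
    by blast
next
  assume "\<exists>Cp Cm. filter_chain rp Cp \<and> filter_chain rm Cm \<and> non_interfering rp rm Cp Cm \<and> S = vert_p ` Cp \<union> vert_m ` Cm"
  then obtain Cp Cm where C: "filter_chain rp Cp" "filter_chain rm Cm" "non_interfering rp rm Cp Cm"
    "S = vert_p ` Cp \<union> vert_m ` Cm" by blast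
  have "S \<subseteq> verts" using C by (auto simp: filter_chain_def verts_def)
  moreover have "\<forall>v\<in>S. \<forall>w\<in>S. compat v w"
    using C by (fastforce simp: filter_chain_def non_interfering_def chain_subset_def)
  ultimately show "S \<in> cliques" unfolding cliques_def by blast
qed

lemma non_interfering_simplices_eq: "non_interfering_simplices rp rm = clique_complex"
proof -
  have "pair_simplex Cp Cm = convex hull (vert_p ` Cp \<union> vert_m ` Cm)" for Cp Cm :: "'a set set"
    unfolding pair_simplex_def vert_p_def vert_m_def ..
  then have "T \<in> non_interfering_simplices rp rm \<longleftrightarrow> (\<exists>S. S \<in> cliques \<and> T = convex hull S)" for T
    unfolding non_interfering_simplices_def cliques_iff by (simp, blast)
  then show ?thesis unfolding clique_complex_def by blast
qed

end

section \<open>Unimodularity\<close>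

text \<open>\<open>lborel\<close> is the image of the product measure on coordinates, so Fubini's
  theorem allows integrating along the direction \<open>b\<close> first.\<close>

lemma nn_integral_lborel_slices:
  fixes b :: "'b::euclidean_space"
  assumes b: "b \<in> Basis" and f: "f \<in> borel_measurable borel"
  shows "(\<integral>\<^sup>+x. f x \<partial>lborel) =
    (\<integral>\<^sup>+y. (\<integral>\<^sup>+s. f ((\<Sum>j\<in>Basis - {b}. y j *\<^sub>R j) + s *\<^sub>R b) \<partial>lborel) \<partial>(\<Pi>\<^sub>M j\<in>Basis - {b}. lborel))"
proof -
  interpret product_sigma_finite "\<lambda>_ :: 'b. lborel :: real measure" by standard
  let ?E = "\<lambda>y :: 'b \<Rightarrow> real. \<Sum>j\<in>Basis. y j *\<^sub>R j"
  have E: "?E \<in> borel_measurable (\<Pi>\<^sub>M j\<in>Basis. lborel)" by measurable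
  have ins: "insert b (Basis - {b}) = Basis" using b by auto
  have upd: "?E (y(b := s)) = (\<Sum>j\<in>Basis - {b}. y j *\<^sub>R j) + s *\<^sub>R b" for y s
    using b by (simp add: sum.remove[of Basis b] add.commute)
  have "(\<integral>\<^sup>+x. f x \<partial>lborel) = (\<integral>\<^sup>+y. f (?E y) \<partial>(\<Pi>\<^sub>M j\<in>Basis. lborel))"
    using nn_integral_distr[of ?E "\<Pi>\<^sub>M j\<in>Basis. lborel" borel f] E f
    by (simp add: lborel_eq[where 'a = 'b, symmetric])
  also have "\<dots> = (\<integral>\<^sup>+y. (\<integral>\<^sup>+s. f (?E (y(b := s))) \<partial>lborel) \<partial>(\<Pi>\<^sub>M j\<in>Basis - {b}. lborel))"
    using product_nn_integral_insert[of "Basis - {b}" b "\<lambda>y. f (?E y)"] measurable_compose[OF E f]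
    unfolding ins by simp
  finally show ?thesis unfolding upd .
qed

text \<open>On every line in direction \<open>b\<close> the function \<phi> is constant, so the
  shear acts there as a translation.\<close>

lemma lborel_distr_shear:
  fixes b :: "'b::euclidean_space"
  assumes b: "b \<in> Basis" and [measurable]: "\<phi> \<in> borel_measurable borel"
    and \<phi>: "\<And>x s. \<phi> (x + s *\<^sub>R b) = \<phi> x"
  shows "distr lborel borel (\<lambda>x. x + \<phi> x *\<^sub>R b) = lborel"
proof (rule measure_eqI)
  fix A assume "A \<in> sets (distr lborel borel (\<lambda>x. x + \<phi> x *\<^sub>R b))"
  then have [measurable]: "A \<in> sets borel" by simp
  have "emeasure (distr lborel borel (\<lambda>x. x + \<phi> x *\<^sub>R b)) A
      = (\<integral>\<^sup>+x. indicator A x \<partial>distr lborel borel (\<lambda>x. x + \<phi> x *\<^sub>R b))" by simp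
  also have "\<dots> = (\<integral>\<^sup>+x. indicator A (x + \<phi> x *\<^sub>R b) \<partial>lborel)"
    by (rule nn_integral_distr) auto
  also have "\<dots> = (\<integral>\<^sup>+y. (\<integral>\<^sup>+s. indicator A ((\<Sum>j\<in>Basis - {b}. y j *\<^sub>R j) + s *\<^sub>R b
      + \<phi> ((\<Sum>j\<in>Basis - {b}. y j *\<^sub>R j) + s *\<^sub>R b) *\<^sub>R b) \<partial>lborel) \<partial>(\<Pi>\<^sub>M j\<in>Basis - {b}. lborel))"
    by (rule nn_integral_lborel_slices[OF b]) measurable
  also have "\<dots> = (\<integral>\<^sup>+y. (\<integral>\<^sup>+s. indicator A ((\<Sum>j\<in>Basis - {b}. y j *\<^sub>R j) + s *\<^sub>R b) \<partial>lborel) \<partial>(\<Pi>\<^sub>M j\<in>Basis - {b}. lborel))"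
  proof (rule nn_integral_cong)
    fix y
    define z where "z = (\<Sum>j\<in>Basis - {b}. y j *\<^sub>R j)"
    have "(\<integral>\<^sup>+s. indicator A (z + s *\<^sub>R b) \<partial>lborel) = (\<integral>\<^sup>+s. indicator A (z + (\<phi> z + 1 * s) *\<^sub>R b) \<partial>lborel :: ennreal)"
      using nn_integral_real_affine[of "\<lambda>s. indicator A (z + s *\<^sub>R b)" 1 "\<phi> z"] by simp
    then show "(\<integral>\<^sup>+s. indicator A (z + s *\<^sub>R b + \<phi> (z + s *\<^sub>R b) *\<^sub>R b) \<partial>lborel) = (\<integral>\<^sup>+s. indicator A (z + s *\<^sub>R b) \<partial>lborel :: ennreal)"
      by (simp add: \<phi> algebra_simps)
  qed
  also have "\<dots> = (\<integral>\<^sup>+x. indicator A x \<partial>lborel)"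
    by (rule nn_integral_lborel_slices[OF b, symmetric]) measurable
  finally show "emeasure (distr lborel borel (\<lambda>x. x + \<phi> x *\<^sub>R b)) A = emeasure lborel A" by simp
qed simp

text \<open>The map is a product of shears. For a direction \<open>a\<close> of least rank in
  \<open>U\<close>, the remaining shears only change coordinates of rank at least
  \<open>r a\<close>, which \<open>\<phi> a\<close> does not see; so the shear in direction
  \<open>a\<close> can be applied last with unchanged argument.\<close>

lemma lborel_distr_unitriangular:
  fixes \<phi> :: "'b::euclidean_space \<Rightarrow> 'b \<Rightarrow> real" and r :: "'b \<Rightarrow> nat"
  assumes meas: "\<And>b. b \<in> Basis \<Longrightarrow> \<phi> b \<in> borel_measurable borel"
    and dep: "\<And>b x y. \<lbrakk>b \<in> Basis; \<And>b'. b' \<in> Basis \<Longrightarrow> r b' < r b \<Longrightarrow> x \<bullet> b' = y \<bullet> b'\<rbrakk> \<Longrightarrow> \<phi> b x = \<phi> b y"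
  shows "distr lborel borel (\<lambda>x. x + (\<Sum>b\<in>Basis. \<phi> b x *\<^sub>R b)) = lborel"
proof -
  have "distr lborel borel (\<lambda>x. x + (\<Sum>b\<in>U. \<phi> b x *\<^sub>R b)) = lborel"
    if "U \<subseteq> Basis" "\<And>b b'. b \<in> U \<Longrightarrow> b' \<in> Basis \<Longrightarrow> r b < r b' \<Longrightarrow> b' \<in> U" for U
    using that
  proof (induction "card U" arbitrary: U rule: less_induct)
    case less
    have fin: "finite U" using less.prems(1) finite_Basis finite_subset by blast
    show ?case
    proof (cases "U = {}")
      case True
      then show ?thesis using distr_id2[of borel lborel] by simp
    next
      case False
      then obtain a where a: "a \<in> U" "\<And>b. b \<in> U \<Longrightarrow> r a \<le> r b"
        using arg_min_if_finite(1)[OF fin False, of r] arg_min_least[OF fin False, of _ r] by blast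
      have aB: "a \<in> Basis" using a less.prems by blast
      define T where "T = (\<lambda>x. x + (\<Sum>b\<in>U - {a}. \<phi> b x *\<^sub>R b))"
      have upset: "b' \<in> U - {a}" if "b \<in> U - {a}" "b' \<in> Basis" "r b < r b'" for b b'
        using that less.prems(2)[of b b'] a(2)[of b] by auto
      have "card (U - {a}) < card U" using a(1) fin by (meson card_Diff1_less)
      then have IH: "distr lborel borel T = lborel"
        unfolding T_def using less.hyps[of "U - {a}"] upset less.prems(1) by blast
      have "\<phi> b \<in> borel_measurable borel" if "b \<in> U - {a}" for b using that meas less.prems(1) by blast
      then have T: "T \<in> borel_measurable borel"
        unfolding T_def by (intro borel_measurable_add borel_measurable_sum borel_measurable_scaleR) auto
      have shear: "distr lborel borel (\<lambda>x. x + \<phi> a x *\<^sub>R a) = lborel"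
      proof (rule lborel_distr_shear[OF aB meas[OF aB]])
        show "\<phi> a (x + s *\<^sub>R a) = \<phi> a x" for x s
        proof (rule dep[OF aB])
          fix b' assume "b' \<in> Basis" "r b' < r a"
          then show "(x + s *\<^sub>R a) \<bullet> b' = x \<bullet> b'"
            using inner_not_same_Basis[of a b'] aB by (auto simp: inner_add_left)
        qed
      qed
      have "\<phi> a (T x) = \<phi> a x" for x
      proof (rule dep[OF aB])
        fix b' assume b': "b' \<in> Basis" "r b' < r a"
        have "(\<phi> b x *\<^sub>R b) \<bullet> b' = 0" if "b \<in> U - {a}" for b
        proof -
          have "b \<noteq> b'" using that a(2)[of b] b'(2) by auto
          then show ?thesis using that less.prems(1) b'(1) inner_not_same_Basis[of b b'] by auto
        qed
        then have "(\<Sum>b\<in>U - {a}. \<phi> b x *\<^sub>R b) \<bullet> b' = 0" unfolding inner_sum_left by (intro sum.neutral) blast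
        then show "T x \<bullet> b' = x \<bullet> b'" by (simp add: T_def inner_add_left)
      qed
      then have comp: "(\<lambda>x. x + (\<Sum>b\<in>U. \<phi> b x *\<^sub>R b)) = (\<lambda>x. x + \<phi> a x *\<^sub>R a) \<circ> T"
        using sum.remove[OF fin a(1)] by (auto simp: fun_eq_iff T_def algebra_simps)
      have "distr lborel borel ((\<lambda>x. x + \<phi> a x *\<^sub>R a) \<circ> T) = distr (distr lborel borel T) borel (\<lambda>x. x + \<phi> a x *\<^sub>R a)"
        using T meas[OF aB] by (intro distr_distr[symmetric]) auto
      then show ?thesis unfolding comp using IH shear by simp
    qed
  qed
  from this[of Basis] show ?thesis by auto
qed

lemma measure_unitriangular_image:
  fixes T :: "'b::euclidean_space \<Rightarrow> 'b" and r :: "'b \<Rightarrow> nat"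
  assumes lin: "linear T"
    and tri: "\<And>b b'. \<lbrakk>b \<in> Basis; b' \<in> Basis; T b \<bullet> b' \<noteq> b \<bullet> b'\<rbrakk> \<Longrightarrow> r b < r b'"
    and A: "compact A"
  shows "measure lborel (T ` A) = measure lborel A"
proof -
  define \<phi> where "\<phi> b' x = (T x - x) \<bullet> b'" for b' x
  have coord: "\<phi> b' x = (\<Sum>b\<in>Basis. (x \<bullet> b) * (T b \<bullet> b' - b \<bullet> b'))" for b' x
  proof -
    have "T x = (\<Sum>b\<in>Basis. (x \<bullet> b) *\<^sub>R T b)"
      by (subst euclidean_representation[symmetric, of x]) (simp only: linear_sum[OF lin] linear_scale[OF lin])
    moreover have "x = (\<Sum>b\<in>Basis. (x \<bullet> b) *\<^sub>R b)" by (simp add: euclidean_representation)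
    ultimately have "T x \<bullet> b' = (\<Sum>b\<in>Basis. (x \<bullet> b) * (T b \<bullet> b'))" "x \<bullet> b' = (\<Sum>b\<in>Basis. (x \<bullet> b) * (b \<bullet> b'))"
      by (simp add: inner_sum_left, metis (no_types, lifting) inner_scaleR_left inner_sum_left sum.cong)
    then show ?thesis by (simp add: \<phi>_def inner_diff_left right_diff_distrib sum_subtractf)
  qed
  have dep: "\<phi> b' x = \<phi> b' y" if "b' \<in> Basis" "\<And>b. b \<in> Basis \<Longrightarrow> r b < r b' \<Longrightarrow> x \<bullet> b = y \<bullet> b" for b' x y
    unfolding coord
  proof (rule sum.cong)
    fix b :: 'b assume b: "b \<in> Basis"
    show "(x \<bullet> b) * (T b \<bullet> b' - b \<bullet> b') = (y \<bullet> b) * (T b \<bullet> b' - b \<bullet> b')"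
      using tri[OF b that(1)] that(2)[OF b] by (cases "T b \<bullet> b' = b \<bullet> b'") auto
  qed simp
  have T: "T x = x + (\<Sum>b\<in>Basis. \<phi> b x *\<^sub>R b)" for x
    using euclidean_representation[of "T x - x"] by (simp add: \<phi>_def)
  have cont: "continuous_on UNIV T" using lin linear_continuous_on linear_conv_bounded_linear by blast
  then have [measurable]: "T \<in> borel_measurable borel" by (rule borel_measurable_continuous_onI)
  have "\<phi> b \<in> borel_measurable borel" for b unfolding \<phi>_def by measurable
  then have "distr lborel borel (\<lambda>x. x + (\<Sum>b\<in>Basis. \<phi> b x *\<^sub>R b)) = lborel"
    using dep by (intro lborel_distr_unitriangular[where r = r]) blast+
  then have distr: "distr lborel borel T = lborel" unfolding T[symmetric] .
  \<comment> \<open>A nonzero coordinate of least rank receives no contribution from the others, so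
    \<open>T\<close> leaves it unchanged and nonzero.\<close>
  have "inj T"
  proof -
    have "\<forall>x. T x = 0 \<longrightarrow> x = 0"
    proof (intro allI impI, rule ccontr)
      fix x assume x: "T x = 0" "x \<noteq> 0"
      let ?B = "{b \<in> Basis. x \<bullet> b \<noteq> 0}"
      have "?B \<noteq> {}" "finite ?B" using x(2) euclidean_all_zero_iff[of x] by auto
      then obtain b where b: "b \<in> ?B" "\<And>b'. b' \<in> ?B \<Longrightarrow> r b \<le> r b'"
        using arg_min_if_finite(1)[of ?B r] arg_min_least[of ?B _ r] by blast
      have "\<phi> b x = \<phi> b 0" using b by (intro dep) force+
      then have "T x \<bullet> b = x \<bullet> b" using linear_0[OF lin] by (simp add: \<phi>_def inner_diff_left)
      then show False using b(1) x(1) by simp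
    qed
    then show ?thesis using linear_injective_0[OF lin] by blast
  qed
  then have vim: "T -` (T ` A) = A" by (rule inj_vimage_image_eq)
  have "compact (T ` A)" using A cont continuous_on_subset by (intro compact_continuous_image) auto
  then have "T ` A \<in> sets borel" by (simp add: borel_compact)
  then have "measure (distr lborel borel T) (T ` A) = measure lborel (T -` (T ` A) \<inter> space lborel)"
    by (intro measure_distr) auto
  then show ?thesis by (simp add: distr vim)
qed

lemma measure_affine_stretch:
  fixes c :: "'b::euclidean_space \<Rightarrow> real"
  assumes c: "\<And>j. j \<in> Basis \<Longrightarrow> c j \<noteq> 0" and A: "compact A"
  shows "measure lborel ((\<lambda>x. t + (\<Sum>j\<in>Basis. (c j * (x \<bullet> j)) *\<^sub>R j)) ` A) = (\<Prod>j\<in>Basis. \<bar>c j\<bar>) * measure lborel A"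
proof -
  define T where "T = (\<lambda>x. t + (\<Sum>j\<in>Basis. (c j * (x \<bullet> j)) *\<^sub>R j))"
  have "inj T"
  proof (rule injI)
    fix x y assume eq: "T x = T y"
    have Tj: "T z \<bullet> j = t \<bullet> j + c j * (z \<bullet> j)" if "j \<in> Basis" for z j
      using that by (simp add: T_def inner_add_left inner_sum_left_Basis)
    show "x = y"
    proof (rule euclidean_eqI)
      fix j :: 'b assume j: "j \<in> Basis"
      have "c j * (x \<bullet> j) = c j * (y \<bullet> j)" using Tj[OF j, of x] Tj[OF j, of y] eq by auto
      then show "x \<bullet> j = y \<bullet> j" using c[OF j] by simp
    qed
  qed
  then have vim: "T -` (T ` A) = A" by (rule inj_vimage_image_eq)
  have cont: "continuous_on UNIV T" unfolding T_def by (intro continuous_intros)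
  then have [measurable]: "T \<in> borel_measurable borel" by (rule borel_measurable_continuous_onI)
  have "compact (T ` A)" using A cont continuous_on_subset by (intro compact_continuous_image) auto
  then have [measurable]: "T ` A \<in> sets borel" by (simp add: borel_compact)
  have "emeasure lborel (T ` A) = emeasure (density (distr lborel borel T) (\<lambda>_. \<Prod>j\<in>Basis. \<bar>c j\<bar>)) (T ` A)"
    using lborel_affine_euclidean[of c t, OF c] unfolding T_def by simp
  also have "\<dots> = (\<Prod>j\<in>Basis. \<bar>c j\<bar>) * emeasure (distr lborel borel T) (T ` A)"
    by (simp add: emeasure_density_const)
  also have "emeasure (distr lborel borel T) (T ` A) = emeasure lborel A"
    by (subst emeasure_distr) (auto simp: vim)
  finally show ?thesis unfolding T_def[symmetric]
    by (simp add: measure_def enn2real_mult prod_nonneg)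
qed

section \<open>Volume of the full-dimensional simplices\<close>

context compatible_posets
begin

text \<open>A device for ranking the basis vectors: its values of interest are \<rho> on the unit
  vectors of the ground set and \<open>k\<close> on the height direction.\<close>

definition coord_rank :: "('a \<Rightarrow> nat) \<Rightarrow> nat \<Rightarrow> (real ^ 'a) \<times> real \<Rightarrow> nat" where
  "coord_rank \<rho> k p = (\<Sum>a\<in>UNIV. if fst p $ a = 1 then \<rho> a else 0) + (if snd p = 1 then k else 0)"

lemma coord_rank [simp]: "coord_rank \<rho> k (axis a 1, 0) = \<rho> a" "coord_rank \<rho> k (0, 1) = k"
proof -
  have "(\<Sum>b\<in>UNIV. if axis a (1::real) $ b = 1 then \<rho> b else 0) = (\<Sum>b\<in>UNIV. if b = a then \<rho> b else 0)"
    by (intro sum.cong) (auto simp: axis_def)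
  then show "coord_rank \<rho> k (axis a 1, 0) = \<rho> a" "coord_rank \<rho> k (0, 1) = k"
    by (simp_all add: coord_rank_def)
qed

lemma Basis_vec_real: "Basis = insert (0, 1) (range (\<lambda>a. (axis a 1, 0)) :: ((real ^ 'a) \<times> real) set)"
  by (auto simp: Basis_prod_def Basis_vec_def)

text \<open>In the proof, \<open>T1\<close> expresses the filters by their successive differences \<open>D\<close>, and \<open>T2\<close> expresses these
  by unit vectors. Each is unitriangular, but with respect to different orders of the coordinates, so that
  the composition \<open>T2 \<circ> T1\<close> need not be triangular for any order.\<close>

lemma measure_layered_simplex:
  fixes fil :: "'a \<Rightarrow> 'a set" and side :: "'a \<Rightarrow> bool" and D :: "'a \<Rightarrow> 'a set"
  assumes self: "\<And>a. a \<in> D a" and least: "\<And>a b. b \<in> D a \<Longrightarrow> (a, b) \<in> L"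
    and inj: "\<And>a c. side a = side c \<Longrightarrow> fil a = fil c \<Longrightarrow> a = c"
    and layers: "\<And>a x. (\<Sum>c | side c = side a \<and> fil c \<subseteq> fil a. indicator (D c) x) = (indicator (fil a) x :: real)"
  shows "measure lborel (convex hull (insert (vert_m {}) (insert (vert_p {})
      (range (\<lambda>a. if side a then vert_p (fil a) else vert_m (fil a)))))) = 2 ^ (CARD('a) + 1) / fact (CARD('a) + 1)"
proof -
  define T1 :: "(real ^ 'a) \<times> real \<Rightarrow> (real ^ 'a) \<times> real" where
    "T1 p = ((\<chi> c. \<Sum>a | side c = side a \<and> fil c \<subseteq> fil a. fst p $ a), snd p + (\<Sum>a | side a. fst p $ a))" for p
  define T2 :: "(real ^ 'a) \<times> real \<Rightarrow> (real ^ 'a) \<times> real" where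
    "T2 p = ((\<chi> b. \<Sum>a | b \<in> D a. fst p $ a), snd p)" for p
  have lin1: "linear T1"
    by (intro linearI) (auto simp: T1_def prod_eq_iff vec_eq_iff sum.distrib sum_distrib_left algebra_simps)
  have lin2: "linear T2"
    by (intro linearI) (auto simp: T2_def prod_eq_iff vec_eq_iff sum.distrib sum_distrib_left algebra_simps)
  have ax: "(\<Sum>a\<in>X. axis c (1::real) $ a) = (if c \<in> X then 1 else 0)" for c :: 'a and X
    by (simp add: axis_def)
  have t1: "T1 (axis a 1, 0) = ((\<chi> c. if side c = side a \<and> fil c \<subseteq> fil a then 1 else 0), if side a then 1 else 0)" for a
    by (simp add: T1_def ax)
  have t2: "T2 (axis a 1, 0) = ((\<chi> b. if b \<in> D a then 1 else 0), 0)" for a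
    by (simp add: T2_def ax)
  have t12': "T1 (0, s) = (0, s)" "T2 (0, s) = (0, s)" for s
    by (simp_all add: T1_def T2_def vec_eq_iff)
  \<comment> \<open>\<open>T1\<close> sends the unit vector of \<open>a\<close> to itself plus unit
    vectors belonging to smaller filters of the same side, so ranks grow as filters shrink. On the
    plus side it also adds to the height, whose rank \<open>CARD('a) + 1\<close> exceeds all
    others.\<close>
  have vol1: "measure lborel (T1 ` A) = measure lborel A" if "compact A" for A
  proof (rule measure_unitriangular_image[OF lin1 _ that, where r = "coord_rank (\<lambda>a. CARD('a) - card (fil a)) (CARD('a) + 1)"])
    fix p q :: "(real ^ 'a) \<times> real"
    assume pq: "p \<in> Basis" "q \<in> Basis" "T1 p \<bullet> q \<noteq> p \<bullet> q"
    then consider a c where "p = (axis a 1, 0)" "q = (axis c 1, 0)" | a where "p = (axis a 1, 0)" "q = (0, 1)"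
      | "p = (0, 1)" unfolding Basis_vec_real by blast
    then show "coord_rank (\<lambda>a. CARD('a) - card (fil a)) (CARD('a) + 1) p < coord_rank (\<lambda>a. CARD('a) - card (fil a)) (CARD('a) + 1) q"
    proof cases
      case (1 a c)
      then have "(if side c = side a \<and> fil c \<subseteq> fil a then 1 else 0) \<noteq> axis a (1::real) $ c"
        using pq(3) by (simp add: t1 inner_axis)
      then have "side c = side a" "fil c \<subseteq> fil a" "c \<noteq> a" by (auto simp: axis_def split: if_splits)
      then have "fil c \<subset> fil a" using inj by blast
      then have "card (fil c) < card (fil a)" by (simp add: psubset_card_mono)
      moreover have "card (fil a) \<le> CARD('a)" by (simp add: card_mono)
      ultimately show ?thesis by (simp add: 1)
    next
      case (2 a)
      then show ?thesis by simp
    next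
      case 3
      then show ?thesis using pq(3) by (simp add: t12')
    qed
  qed
  \<comment> \<open>Here the rank is the position in \<open>L\<close>, since \<open>a\<close> is the
    \<open>L\<close>-least element of \<open>D a\<close>.\<close>
  have vol2: "measure lborel (T2 ` A) = measure lborel A" if "compact A" for A
  proof (rule measure_unitriangular_image[OF lin2 _ that, where r = "coord_rank (\<lambda>a. card {b. (b, a) \<in> L}) 0"])
    fix p q :: "(real ^ 'a) \<times> real"
    assume pq: "p \<in> Basis" "q \<in> Basis" "T2 p \<bullet> q \<noteq> p \<bullet> q"
    then consider a c where "p = (axis a 1, 0)" "q = (axis c 1, 0)" | a where "p = (axis a 1, 0)" "q = (0, 1)"
      | "p = (0, 1)" unfolding Basis_vec_real by blast
    then show "coord_rank (\<lambda>a. card {b. (b, a) \<in> L}) 0 p < coord_rank (\<lambda>a. card {b. (b, a) \<in> L}) 0 q"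
    proof cases
      case (1 a c)
      then have "(if c \<in> D a then 1 else 0) \<noteq> axis a (1::real) $ c"
        using pq(3) by (simp add: t2 inner_axis)
      then have "c \<in> D a" "c \<noteq> a" using self[of a] by (auto simp: axis_def split: if_splits)
      then have "(a, c) \<in> L" "a \<noteq> c" using least by auto
      then have "{b. (b, a) \<in> L} \<subset> {b. (b, c) \<in> L}" using L_trans L_antisym L_refl by blast
      then show ?thesis by (simp add: 1 psubset_card_mono)
    next
      case (2 a)
      then show ?thesis using pq(3) by (simp add: t2)
    next
      case 3
      then show ?thesis using pq(3) by (simp add: t12')
    qed
  qed
  \<comment> \<open>Each filter is the disjoint union of the differences belonging to the filters of
    its side contained in it; this is the hypothesis \<open>layers\<close> after exchanging the two
    conditions on \<open>c\<close>.\<close>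
  have T21: "T2 (T1 (axis a 1, 0)) = (indicator_vec (fil a), if side a then 1 else 0)" for a
  proof -
    have "(\<Sum>c | x \<in> D c. if side c = side a \<and> fil c \<subseteq> fil a then 1 else 0) = (indicator (fil a) x :: real)" for x
    proof -
      have "(\<Sum>c | x \<in> D c. if side c = side a \<and> fil c \<subseteq> fil a then 1 else 0)
          = (\<Sum>c\<in>UNIV. if x \<in> D c then if side c = side a \<and> fil c \<subseteq> fil a then 1 else 0 else 0 :: real)"
        by (simp add: sum.If_cases)
      also have "\<dots> = (\<Sum>c\<in>UNIV. if side c = side a \<and> fil c \<subseteq> fil a then indicator (D c) x else 0)"
        by (intro sum.cong) (auto simp: indicator_def)
      also have "\<dots> = (\<Sum>c | side c = side a \<and> fil c \<subseteq> fil a. indicator (D c) x)"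
        by (simp add: sum.If_cases)
      finally show ?thesis by (simp add: layers)
    qed
    then show ?thesis by (simp add: t1 T2_def indicator_vec_def)
  qed
  \<comment> \<open>With base point \<open>(0, -1)\<close>, which is \<open>vert_m {}\<close>, a
    plus filter needs twice its indicator and a rise of 2 in height, a minus filter only its
    indicator with factor -2. The height direction, scaled by 2, leads to
    \<open>vert_p {}\<close>.\<close>
  define c :: "(real ^ 'a) \<times> real \<Rightarrow> real" where
    "c p = (if \<exists>a. p = (axis a 1, 0) \<and> \<not> side a then -2 else 2)" for p
  define T0 where "T0 = (\<lambda>x. (0, -1) + (\<Sum>j\<in>Basis. (c j * (x \<bullet> j)) *\<^sub>R j))"
  define A where "A = (\<lambda>x. T2 (T1 (\<Sum>j\<in>Basis. (c j * (x \<bullet> j)) *\<^sub>R j)))"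
  have linA: "linear A"
  proof -
    have "linear (\<lambda>x. \<Sum>j\<in>Basis. (c j * (x \<bullet> j)) *\<^sub>R j)"
      by (intro linearI) (auto simp: inner_add_left algebra_simps sum.distrib scaleR_sum_right)
    then have "linear (T2 \<circ> (T1 \<circ> (\<lambda>x. \<Sum>j\<in>Basis. (c j * (x \<bullet> j)) *\<^sub>R j)))"
      using lin1 lin2 by (intro linear_compose)
    then show ?thesis by (simp add: A_def o_def)
  qed
  have comp: "T2 (T1 (T0 x)) = (0, -1) + A x" for x
    by (simp only: T0_def A_def linear_add[OF lin1] linear_add[OF lin2] t12')
  have AB: "A j = c j *\<^sub>R T2 (T1 j)" if "j \<in> Basis" for j
  proof -
    have "(\<Sum>i\<in>Basis. (c i * (j \<bullet> i)) *\<^sub>R i) = (\<Sum>i\<in>Basis. if i = j then c j *\<^sub>R j else 0)"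
      using that by (intro sum.cong) (auto simp: inner_Basis)
    also have "\<dots> = c j *\<^sub>R j" using that by simp
    finally show ?thesis by (simp add: A_def linear_scale[OF lin1] linear_scale[OF lin2])
  qed
  let ?S = "convex hull (insert 0 Basis) :: ((real ^ 'a) \<times> real) set"
  have v0: "(0, -1) + A 0 = vert_m {}" by (simp add: linear_0[OF linA] vert_m_def vec_eq_iff indicator_vec_def prod_eq_iff)
  have vt: "(0, -1) + A (0, 1) = vert_p {}"
  proof -
    have "A (0, 1) = c (0, 1) *\<^sub>R (0, 1)" using AB[of "(0, 1)"] by (simp add: Basis_vec_real t12')
    moreover have "c (0, 1) = 2" by (simp add: c_def)
    ultimately show ?thesis by (simp add: vert_p_def vec_eq_iff indicator_vec_def prod_eq_iff)
  qed
  have va: "(0, -1) + A (axis a 1, 0) = (if side a then vert_p (fil a) else vert_m (fil a))" for a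
  proof -
    have "A (axis a 1, 0) = c (axis a 1, 0) *\<^sub>R (indicator_vec (fil a), if side a then 1 else 0)"
      using AB[of "(axis a 1, 0)"] by (simp add: Basis_vec_real T21)
    moreover have "c (axis a 1, 0) = (if side a then 2 else -2)" by (auto simp: c_def axis_eq_axis)
    ultimately show ?thesis by (simp add: vert_p_def vert_m_def)
  qed
  have "(\<lambda>x. (0, -1) + A x) ` insert 0 Basis = insert (vert_m {}) (insert (vert_p {})
      (range (\<lambda>a. if side a then vert_p (fil a) else vert_m (fil a))))"
    unfolding Basis_vec_real image_insert v0 vt image_image va ..
  then have "convex hull (insert (vert_m {}) (insert (vert_p {})
      (range (\<lambda>a. if side a then vert_p (fil a) else vert_m (fil a))))) = (\<lambda>x. (0, -1) + A x) ` ?S"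
    unfolding image_image[of "(+) (0, -1)" A, symmetric] convex_hull_linear_image[OF linA]
      convex_hull_translation[symmetric] by (simp only:)
  also have "\<dots> = T2 ` T1 ` T0 ` ?S" by (simp add: image_image comp)
  also have "measure lborel \<dots> = measure lborel (T0 ` ?S)"
  proof -
    have "compact ?S" by (intro compact_convex_hull finite_imp_compact) auto
    moreover have "continuous_on X T0" for X unfolding T0_def by (intro continuous_intros)
    ultimately have 0: "compact (T0 ` ?S)" using compact_continuous_image by blast
    moreover have "continuous_on X T1" for X using lin1 linear_continuous_on linear_conv_bounded_linear by blast
    ultimately have "compact (T1 ` T0 ` ?S)" using compact_continuous_image by blast
    then show ?thesis using vol1[OF 0] vol2 by simp
  qed
  also have "\<dots> = (\<Prod>j\<in>Basis. \<bar>c j\<bar>) * measure lborel ?S"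
    unfolding T0_def
    by (rule measure_affine_stretch) (simp_all add: c_def finite_imp_compact_convex_hull)
  also have "(\<Prod>j\<in>Basis. \<bar>c j\<bar>) = 2 ^ (CARD('a) + 1)"
  proof -
    have "(\<Prod>j\<in>Basis. \<bar>c j\<bar>) = (\<Prod>j\<in>(Basis :: ((real ^ 'a) \<times> real) set). 2)"
      by (intro prod.cong) (auto simp: c_def)
    then show ?thesis by simp
  qed
  finally show ?thesis by (simp add: content_std_simplex)
qed

text \<open>Every nonempty filter of either chain is assigned the \<open>L\<close>-least element of
  its difference from the smaller filters of its chain. These elements are distinct: within a chain
  because the differences are disjoint, across the chains by non-interference. Having
  \<open>CARD('a) + 2\<close> vertices then forces a bijection between nonempty filters and
  elements, which indexes the coordinates.\<close>

lemma measure_full_simplex: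
  assumes Cp: "filter_chain rp Cp" and Cm: "filter_chain rm Cm" and ni: "non_interfering rp rm Cp Cm"
    and card: "card (vert_p ` Cp \<union> vert_m ` Cm) = CARD('a) + 2"
  shows "measure lborel (convex hull (vert_p ` Cp \<union> vert_m ` Cm)) = 2 ^ (CARD('a) + 1) / fact (CARD('a) + 1)"
proof -
  define C where "C s = (if s then Cp else Cm)" for s
  define R where "R s = (if s then rp else rm)" for s
  have chain: "\<Phi> \<subseteq> \<Phi>' \<or> \<Phi>' \<subseteq> \<Phi>" if "\<Phi> \<in> C s" "\<Phi>' \<in> C s" for \<Phi> \<Phi>' s
    using that Cp Cm by (auto simp: C_def filter_chain_def chain_subset_def split: if_splits)
  have filt: "b \<in> \<Phi>" if "\<Phi> \<in> C s" "a \<in> \<Phi>" "(a, b) \<in> R s" for \<Phi> s a b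
    using that Cp Cm by (auto simp: C_def R_def filter_chain_def poset_filters_def split: if_splits)
  define E where "E s \<Phi> = \<Phi> - \<Union>{\<Phi>' \<in> C s. \<Phi>' \<subset> \<Phi>}" for s \<Phi>
  define N where "N = {(s, \<Phi>). \<Phi> \<in> C s \<and> \<Phi> \<noteq> {}}"
  have E_ne: "E s \<Phi> \<noteq> {}" if "\<Phi> \<in> C s" "\<Phi> \<noteq> {}" for s \<Phi>
  proof (cases "{\<Phi>' \<in> C s. \<Phi>' \<subset> \<Phi>} = {}")
    case True
    then show ?thesis using that(2) unfolding E_def True by simp
  next
    case False
    have "\<exists>\<Gamma>\<in>{\<Phi>' \<in> C s. \<Phi>' \<subset> \<Phi>}. \<forall>\<Phi>'\<in>{\<Phi>' \<in> C s. \<Phi>' \<subset> \<Phi>}. \<Phi>' \<subseteq> \<Gamma>"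
      by (rule finite_chain_greatest[OF _ False]) (use chain in auto)
    then show ?thesis unfolding E_def by blast
  qed
  have "\<exists>b. b \<in> E s \<Phi> \<and> (\<forall>a\<in>E s \<Phi>. (b, a) \<in> L)" if "(s, \<Phi>) \<in> N" for s \<Phi>
    using L_least[OF E_ne[of \<Phi> s]] that by (auto simp: N_def)
  then have "\<forall>p\<in>N. \<exists>b. b \<in> E (fst p) (snd p) \<and> (\<forall>a\<in>E (fst p) (snd p). (b, a) \<in> L)" by simp
  then obtain \<beta> where "\<forall>p\<in>N. \<beta> p \<in> E (fst p) (snd p) \<and> (\<forall>a\<in>E (fst p) (snd p). (\<beta> p, a) \<in> L)"
    using bchoice[of N "\<lambda>p b. b \<in> E (fst p) (snd p) \<and> (\<forall>a\<in>E (fst p) (snd p). (b, a) \<in> L)"] by blast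
  then have \<beta>: "\<And>s \<Phi>. (s, \<Phi>) \<in> N \<Longrightarrow> \<beta> (s, \<Phi>) \<in> E s \<Phi>"
    "\<And>s \<Phi> a. (s, \<Phi>) \<in> N \<Longrightarrow> a \<in> E s \<Phi> \<Longrightarrow> (\<beta> (s, \<Phi>), a) \<in> L" by force+
  \<comment> \<open>An element of \<open>\<Phi>\<close> below the chosen one lies in no smaller
    filter of the chain, since that filter would be up-closed and contain the chosen one. So it lies
    in the same difference, where the chosen element is \<open>L\<close>-least.\<close>
  have \<beta>_min: "\<beta> (s, \<Phi>) \<in> min_elements (R s) \<Phi>" if n: "(s, \<Phi>) \<in> N" for s \<Phi>
    unfolding min_elements_def
  proof (safe)
    show "\<beta> (s, \<Phi>) \<in> \<Phi>" using \<beta>(1)[OF n] by (simp add: E_def)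
    fix a assume a: "a \<in> \<Phi>" "(a, \<beta> (s, \<Phi>)) \<in> R s"
    have "a \<notin> \<Phi>'" if "\<Phi>' \<in> C s" "\<Phi>' \<subset> \<Phi>" for \<Phi>'
      using filt[OF that(1) _ a(2)] \<beta>(1)[OF n] that by (auto simp: E_def)
    then have "a \<in> E s \<Phi>" using a(1) by (auto simp: E_def)
    then have "(\<beta> (s, \<Phi>), a) \<in> L" using \<beta>(2)[OF n] by blast
    moreover have "(a, \<beta> (s, \<Phi>)) \<in> L" using a(2) sub_p sub_m by (auto simp: R_def split: if_splits)
    ultimately show "a = \<beta> (s, \<Phi>)" using L_antisym by blast
  qed
  have inj: "inj_on \<beta> N"
  proof (rule inj_onI)
    fix p q assume pq: "p \<in> N" "q \<in> N" "\<beta> p = \<beta> q"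
    obtain s \<Phi> s' \<Phi>' where p: "p = (s, \<Phi>)" and q: "q = (s', \<Phi>')" by (cases p, cases q)
    have mem: "\<beta> p \<in> E s \<Phi>" "\<beta> p \<in> E s' \<Phi>'" using \<beta>(1)[of s \<Phi>] \<beta>(1)[of s' \<Phi>'] pq p q by auto
    have mins: "\<beta> p \<in> min_elements (R s) \<Phi>" "\<beta> p \<in> min_elements (R s') \<Phi>'"
      using \<beta>_min[of s \<Phi>] \<beta>_min[of s' \<Phi>'] pq p q by auto
    have in_C: "\<Phi> \<in> C s" "\<Phi>' \<in> C s'" using pq p q by (auto simp: N_def)
    have "s = s'"
    proof (rule ccontr)
      assume "s \<noteq> s'"
      then have "(s \<and> \<not> s') \<or> (\<not> s \<and> s')" by blast
      then show False using mins in_C ni by (auto simp: C_def R_def non_interfering_def) blast+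
    qed
    moreover have "\<Phi> = \<Phi>'"
    proof (rule ccontr)
      assume "\<Phi> \<noteq> \<Phi>'"
      then have "\<Phi> \<subset> \<Phi>' \<or> \<Phi>' \<subset> \<Phi>" using chain[of \<Phi> s \<Phi>'] in_C \<open>s = s'\<close> by auto
      then show False using mem in_C \<open>s = s'\<close> by (auto simp: E_def)
    qed
    ultimately show "p = q" by (simp add: p q)
  qed
  have card_C: "card Cp + card Cm = CARD('a) + 2"
  proof -
    have "card (vert_p ` Cp \<union> vert_m ` Cm) = card (vert_p ` Cp) + card (vert_m ` Cm)"
      by (intro card_Un_disjoint) auto
    moreover have "card (vert_p ` Cp) = card Cp" "card (vert_m ` Cm) = card Cm"
      by (auto intro!: card_image simp: inj_on_def)
    ultimately show ?thesis using card by simp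
  qed
  have card_N: "card N = card (Cp - {{}}) + card (Cm - {{}})"
  proof -
    have "N = Pair True ` (Cp - {{}}) \<union> Pair False ` (Cm - {{}})"
      by (auto simp: N_def C_def split: if_splits)
    moreover have "card (Pair True ` (Cp - {{}}) \<union> Pair False ` (Cm - {{}})) = card (Pair True ` (Cp - {{}})) + card (Pair False ` (Cm - {{}}))"
      by (intro card_Un_disjoint) auto
    moreover have "card (Pair x ` X) = card X" for x :: bool and X :: "'a set set" by (intro card_image) (auto simp: inj_on_def)
    ultimately show ?thesis by simp
  qed
  have card_le: "card N \<le> CARD('a)" using card_inj_on_le[OF inj, of UNIV] by simp
  \<comment> \<open>At most \<open>CARD('a)\<close> of the \<open>CARD('a) + 2\<close> filters are
    nonempty, and each chain contains the empty filter at most once; so both contain it and the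
    bound is attained.\<close>
  have empty_in: "{} \<in> Cp" "{} \<in> Cm" and card_eq: "card N = CARD('a)"
    using card_C card_N card_le by (auto simp: card_Diff_singleton_if split: if_splits)
  have "\<beta> ` N = UNIV" using card_image[OF inj] card_eq by (intro card_subset_eq) auto
  define g where "g = the_inv_into N \<beta>"
  have gN: "g a \<in> N" "\<beta> (g a) = a" for a
    using the_inv_into_into[OF inj, of a N] f_the_inv_into_f[OF inj, of a] \<open>\<beta> ` N = UNIV\<close> by (auto simp: g_def)
  have g\<beta>: "g (\<beta> p) = p" if "p \<in> N" for p using the_inv_into_f_f[OF inj that] by (simp add: g_def)
  define side fil where "side a = fst (g a)" and "fil a = snd (g a)" for a
  define D where "D a = E (side a) (fil a)" for a
  have sf: "(side a, fil a) = g a" for a by (simp add: side_def fil_def)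
  have filC: "fil a \<in> C (side a)" "fil a \<noteq> {}" for a using gN(1)[of a] by (auto simp: N_def side_def fil_def)
  have inj_fil: "a = c" if "side a = side c" "fil a = fil c" for a c
  proof -
    have "g a = g c" using that sf[of a, symmetric] sf[of c, symmetric] by simp
    then have "\<beta> (g a) = \<beta> (g c)" by (rule arg_cong)
    then show ?thesis unfolding gN(2) .
  qed
  \<comment> \<open>An element of \<open>fil a\<close> lies in exactly one difference of its side,
    that of the least filter in the chain containing it.\<close>
  have layers: "(\<Sum>c | side c = side a \<and> fil c \<subseteq> fil a. indicator (D c) x) = (indicator (fil a) x :: real)" for a x
  proof (cases "x \<in> fil a")
    case False
    then have "indicator (D c) x = (0::real)" if "fil c \<subseteq> fil a" for c
      using that by (auto simp: D_def E_def indicator_def)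
    then show ?thesis using False by simp
  next
    case True
    let ?B = "{\<Phi> \<in> C (side a). x \<in> \<Phi>}"
    have "fil a \<in> ?B" using True filC by blast
    have "\<exists>\<Gamma>\<in>?B. \<forall>\<Phi>\<in>?B. \<Gamma> \<subseteq> \<Phi>"
      by (rule finite_chain_least) (use chain \<open>fil a \<in> ?B\<close> in auto)
    then obtain \<Gamma> where \<Gamma>: "\<Gamma> \<in> ?B" "\<forall>\<Phi>\<in>?B. \<Gamma> \<subseteq> \<Phi>" by blast
    have n: "(side a, \<Gamma>) \<in> N" using \<Gamma>(1) by (auto simp: N_def)
    define c0 where "c0 = \<beta> (side a, \<Gamma>)"
    have c0: "side c0 = side a" "fil c0 = \<Gamma>" using g\<beta>[OF n] by (simp_all add: c0_def side_def fil_def)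
    have "indicator (D c) x = (if c = c0 then 1 else 0 :: real)" if c: "side c = side a" for c
    proof (cases "c = c0")
      case True
      have "x \<in> D c0" using \<Gamma> by (auto simp: D_def E_def c0)
      then show ?thesis using True by simp
    next
      case False
      have "x \<notin> D c"
      proof
        assume "x \<in> D c"
        then have x: "x \<in> fil c" "\<And>\<Phi>'. \<Phi>' \<in> C (side a) \<Longrightarrow> \<Phi>' \<subset> fil c \<Longrightarrow> x \<notin> \<Phi>'" by (auto simp: D_def E_def c)
        then have "\<Gamma> \<subseteq> fil c" using \<Gamma>(2) filC(1)[of c] c by auto
        then have "\<Gamma> = fil c" using x(2)[of \<Gamma>] \<Gamma>(1) by blast
        then show False using inj_fil[of c c0] c c0 False by simp
      qed
      then show ?thesis using False by simp
    qed
    then have "(\<Sum>c | side c = side a \<and> fil c \<subseteq> fil a. indicator (D c) x) = (\<Sum>c | side c = side a \<and> fil c \<subseteq> fil a. if c = c0 then 1 else 0 :: real)"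
      by (intro sum.cong) auto
    also have "\<dots> = 1" using c0 \<Gamma>(2) \<open>fil a \<in> ?B\<close> by simp
    finally show ?thesis using True by simp
  qed
  have "measure lborel (convex hull (insert (vert_m {}) (insert (vert_p {})
      (range (\<lambda>a. if side a then vert_p (fil a) else vert_m (fil a)))))) = 2 ^ (CARD('a) + 1) / fact (CARD('a) + 1)"
  proof (rule measure_layered_simplex[where D = D])
    show "a \<in> D a" for a using \<beta>(1)[of "side a" "fil a"] gN[of a] by (simp add: D_def sf)
    show "(a, b) \<in> L" if "b \<in> D a" for a b
      using \<beta>(2)[of "side a" "fil a" b] that gN[of a] by (simp add: D_def sf)
  qed (use inj_fil layers in auto)
  moreover have "vert_p ` Cp \<union> vert_m ` Cm = insert (vert_m {}) (insert (vert_p {})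
      (range (\<lambda>a. if side a then vert_p (fil a) else vert_m (fil a))))"
  proof
    show "vert_p ` Cp \<union> vert_m ` Cm \<subseteq> insert (vert_m {}) (insert (vert_p {})
      (range (\<lambda>a. if side a then vert_p (fil a) else vert_m (fil a))))"
    proof
      fix v assume "v \<in> vert_p ` Cp \<union> vert_m ` Cm"
      then obtain s \<Phi> where v: "\<Phi> \<in> C s" "v = (if s then vert_p \<Phi> else vert_m \<Phi>)"
        by (auto simp: C_def intro: that[of _ True] that[of _ False])
      show "v \<in> insert (vert_m {}) (insert (vert_p {})
        (range (\<lambda>a. if side a then vert_p (fil a) else vert_m (fil a))))"
      proof (cases "\<Phi> = {}")
        case True
        then show ?thesis using v(2) by simp
      next
        case False
        then have "(s, \<Phi>) \<in> N" using v(1) by (simp add: N_def)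
        then have "side (\<beta> (s, \<Phi>)) = s" "fil (\<beta> (s, \<Phi>)) = \<Phi>" using g\<beta> by (simp_all add: side_def fil_def)
        then have "v = (if side (\<beta> (s, \<Phi>)) then vert_p (fil (\<beta> (s, \<Phi>))) else vert_m (fil (\<beta> (s, \<Phi>))))"
          using v(2) by (simp only:)
        then show ?thesis by blast
      qed
    qed
    show "insert (vert_m {}) (insert (vert_p {})
      (range (\<lambda>a. if side a then vert_p (fil a) else vert_m (fil a)))) \<subseteq> vert_p ` Cp \<union> vert_m ` Cm"
    proof -
      have "(if side a then vert_p (fil a) else vert_m (fil a)) \<in> vert_p ` Cp \<union> vert_m ` Cm" for a
        using filC(1)[of a] by (auto simp: C_def split: if_splits)
      then show ?thesis using empty_in by blast
    qed
  qed
  ultimately show ?thesis by simp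
qed

lemma unimodular_clique_complex: "unimodular_triangulation even_odd_lattice even_odd_cell clique_complex"
  unfolding unimodular_triangulation_def
proof (intro conjI ballI impI)
  fix S assume "S \<in> clique_complex"
  then obtain W where W: "W \<in> cliques" "S = convex hull W" by (auto simp: clique_complex_def)
  have "vert_p \<Phi> \<in> even_odd_lattice" for \<Phi> :: "'a set"
  proof -
    have "\<exists>k::int. (2 *\<^sub>R indicator_vec \<Phi>) $ a = 2 * of_int k" for a :: 'a
      by (rule exI[of _ "if a \<in> \<Phi> then 1 else 0"]) (simp add: indicator_vec_def)
    moreover have "\<exists>k::int. 1 = 2 * of_int k + (1::real)" by (rule exI[of _ 0]) simp
    ultimately show ?thesis unfolding even_odd_lattice_def vert_p_def by blast
  qed
  moreover have "vert_m \<Phi> \<in> even_odd_lattice" for \<Phi> :: "'a set"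
  proof -
    have "\<exists>k::int. ((-2) *\<^sub>R indicator_vec \<Phi>) $ a = 2 * of_int k" for a :: 'a
      by (rule exI[of _ "if a \<in> \<Phi> then -1 else 0"]) (simp add: indicator_vec_def)
    moreover have "\<exists>k::int. -1 = 2 * of_int k + (1::real)" by (rule exI[of _ "-1"]) simp
    ultimately show ?thesis unfolding even_odd_lattice_def vert_m_def by blast
  qed
  ultimately show "simplex_vertices S \<subseteq> even_odd_lattice"
    using vertices_clique[OF W(1)] W(2) clique_in_V[OF W(1)] by (auto simp: verts_def)
next
  fix S assume "S \<in> clique_complex" and dim: "aff_dim S = int DIM((real ^ 'a) \<times> real)"
  then obtain W where W: "W \<in> cliques" "S = convex hull W" by (auto simp: clique_complex_def)
  obtain Cp Cm where C: "filter_chain rp Cp" "filter_chain rm Cm" "non_interfering rp rm Cp Cm"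
    "W = vert_p ` Cp \<union> vert_m ` Cm" using cliques_iff[THEN iffD1, OF W(1)] by blast
  \<comment> \<open>By affine independence, dimension \<open>CARD('a) + 1\<close> means
    \<open>CARD('a) + 2\<close> vertices, the count required by
    \<open>measure_full_simplex\<close>.\<close>
  have "aff_dim S = int (card W) - 1"
    unfolding W(2) aff_dim_convex_hull
    using aff_dim_affine_independent[OF clique_affine_independent[OF W(1)]] by simp
  then have "card W = CARD('a) + 2" using dim by simp
  then have S: "measure lborel S = 2 ^ (CARD('a) + 1) / fact (CARD('a) + 1)"
    using measure_full_simplex[OF C(1-3)] C(4) W(2) by simp
  have cell: "measure lborel (even_odd_cell :: ((real ^ 'a) \<times> real) set) = 2 ^ (CARD('a) + 1)"
  proof -
    have two: "(2 *\<^sub>R One) \<bullet> b = 2" if "b \<in> Basis" for b :: "(real ^ 'a) \<times> real"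
      using that by simp
    then have "(\<Prod>b\<in>(Basis :: ((real ^ 'a) \<times> real) set). (2 *\<^sub>R One - 0) \<bullet> b) = (\<Prod>b\<in>(Basis :: ((real ^ 'a) \<times> real) set). 2)"
      by (intro prod.cong) auto
    moreover have "\<forall>b\<in>(Basis :: ((real ^ 'a) \<times> real) set). 0 \<bullet> b \<le> (2 *\<^sub>R One) \<bullet> b" using two by simp
    ultimately show ?thesis unfolding even_odd_cell_def measure_lborel_cbox_eq by simp
  qed
  show "normalized_volume even_odd_cell S = 1"
    unfolding normalized_volume_def S cell by simp
qed

end

theorem theorem4p3:
  fixes rp rm :: "'a::finite rel"
  assumes "double_poset rp rm" and "compatible rp rm"
  shows "piecewise_linear_homeomorphism (transfer_map rp rm)
    \<and> transfer_map rp rm ` integer_lattice = integer_lattice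
    \<and> transfer_map rp rm ` double_chain_polytope rp rm = double_order_polytope rp rm
    \<and> triangulates (non_interfering_simplices rp rm) (double_order_polytope rp rm)
    \<and> regular_triangulation (non_interfering_simplices rp rm)
    \<and> unimodular_triangulation even_odd_lattice even_odd_cell (non_interfering_simplices rp rm)
    \<and> flag_triangulation (non_interfering_simplices rp rm)"
proof -
  obtain L where "linear_order_on UNIV L" "rp \<subseteq> L" "rm \<subseteq> L"
    using assms(2) by (auto simp: compatible_def)
  then interpret compatible_posets rp rm L
    using assms(1) by unfold_locales (auto simp: double_poset_def)
  show ?thesis
    unfolding triangulates_def non_interfering_simplices_eq
    using transfer_map_homeomorphism transfer_map_lattice transfer_map_polytope simplicial_clique_complex
      Union_clique_complex hull_verts regular_clique_complex unimodular_clique_complex flag_clique_complex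
    by simp
qed

end
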